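(* Let $(\mathcal{M},\tau)$ be a finite von Neumann algebra with a faithful normal tracial state $\tau$, and let $\mathcal{M}_{++}$ be its set of invertible positive elements. For $A,B\in\mathcal{M}_{++}$ let $d_\tau(A,B)$ be the square root of $$d_\tau(A,B)^2:=\tau\!\left(\log\!\left(\frac{A+B}{2}\right)\right)-\frac12\tau(\log A)-\frac12\tau(\log B).$$ Then $d_\tau$ is a metric on $\mathcal{M}_{++}$.
   Context: A tracial state satisfies $\tau(\mathbf{1})=1$ and $\tau(xy)=\tau(yx)$ for all $x,y$. $\log$ is applied by continuous functional calculus. Part of the claim is that the right-hand side defining $d_\tau(A,B)^2$ is nonnegative. *)

theory Defs
  imports "HOL-Analysis.Analysis" "HOL-Computational_Algebra.Polynomial"
begin

section \<open>Complex Hilbert spaces and bounded operators\<close>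

text \<open>A complex Hilbert space is presented as a real Hilbert space whose real inner product is the
  real part of a complex inner product, linear in the first argument.  In particular
  \<open>norm x = sqrt (Re (cip x x))\<close>, and the topology is the library's norm topology.\<close>

class complex_hilbert_space = real_inner + complete_space +
  fixes cscale :: "complex \<Rightarrow> 'a \<Rightarrow> 'a"
    and cip :: "'a \<Rightarrow> 'a \<Rightarrow> complex"
  assumes cscale_add_right: "cscale c (x + y) = cscale c x + cscale c y"
    and cscale_add_left: "cscale (c + d) x = cscale c x + cscale d x"
    and cscale_cscale: "cscale c (cscale d x) = cscale (c * d) x"
    and cscale_of_real: "cscale (complex_of_real r) x = r *\<^sub>R x"
    and cip_add_left: "cip (x + y) z = cip x z + cip y z"
    and cip_cscale_left: "cip (cscale c x) y = c * cip x y"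
    and cip_commute: "cip x y = cnj (cip y x)"
    and Re_cip: "Re (cip x y) = inner x y"

subclass (in complex_hilbert_space) banach ..

instantiation complex :: complex_hilbert_space
begin

definition cscale_complex :: "complex \<Rightarrow> complex \<Rightarrow> complex"
  where "cscale_complex c x = c * x"

definition cip_complex :: "complex \<Rightarrow> complex \<Rightarrow> complex"
  where "cip_complex x y = x * cnj y"

instance
  by standard
    (auto simp: cscale_complex_def cip_complex_def algebra_simps scaleR_conv_of_real
      inner_complex_def)

end

text \<open>\<open>'h \<Rightarrow>\<^sub>L 'h\<close> is the library type of bounded real-linear maps with the operator norm;
  \<open>B(H)\<close> is the set of those that are complex-linear.\<close>

definition bounded_ops :: "('h::complex_hilbert_space \<Rightarrow>\<^sub>L 'h) set"
  where "bounded_ops = {T. \<forall>c x. blinfun_apply T (cscale c x) = cscale c (blinfun_apply T x)}"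

definition cscale_op :: "complex \<Rightarrow> ('h::complex_hilbert_space \<Rightarrow>\<^sub>L 'h) \<Rightarrow> ('h \<Rightarrow>\<^sub>L 'h)"
  where "cscale_op c T = Blinfun (\<lambda>x. cscale c (blinfun_apply T x))"

definition adj_op :: "('h::complex_hilbert_space \<Rightarrow>\<^sub>L 'h) \<Rightarrow> ('h \<Rightarrow>\<^sub>L 'h)"
  where "adj_op T = (THE S. S \<in> bounded_ops \<and>
           (\<forall>x y. cip (blinfun_apply T x) y = cip x (blinfun_apply S y)))"

definition self_adjoint_op :: "('h::complex_hilbert_space \<Rightarrow>\<^sub>L 'h) \<Rightarrow> bool"
  where "self_adjoint_op T \<longleftrightarrow> adj_op T = T"

text \<open>Membership in \<open>\<real>\<^sub>\<ge>\<^sub>0\<close> says that the complex number \<open>cip (T x) x\<close> is real and nonnegative.\<close>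

definition positive_op :: "('h::complex_hilbert_space \<Rightarrow>\<^sub>L 'h) \<Rightarrow> bool"
  where "positive_op T \<longleftrightarrow> T \<in> bounded_ops \<and> (\<forall>x. cip (blinfun_apply T x) x \<in> \<real>\<^sub>\<ge>\<^sub>0)"

definition le_op :: "('h::complex_hilbert_space \<Rightarrow>\<^sub>L 'h) \<Rightarrow> ('h \<Rightarrow>\<^sub>L 'h) \<Rightarrow> bool"
  where "le_op S T \<longleftrightarrow> positive_op (T - S)"


section \<open>Continuous functional calculus\<close>

definition spectrum_op :: "('h::complex_hilbert_space \<Rightarrow>\<^sub>L 'h) \<Rightarrow> complex set"
  where "spectrum_op T = {z. \<not> (\<exists>S \<in> bounded_ops.
           S o\<^sub>L (T - cscale_op z id_blinfun) = id_blinfun \<and>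
           (T - cscale_op z id_blinfun) o\<^sub>L S = id_blinfun)}"

definition poly_op :: "real poly \<Rightarrow> ('h::complex_hilbert_space \<Rightarrow>\<^sub>L 'h) \<Rightarrow> ('h \<Rightarrow>\<^sub>L 'h)"
  where "poly_op p T = (\<Sum>i\<le>degree p. coeff p i *\<^sub>R (((o\<^sub>L) T ^^ i) id_blinfun))"

text \<open>For self-adjoint \<open>T\<close> (whose spectrum is a compact subset of the real line) and \<open>f\<close> continuous
  on the spectrum, \<open>f(T)\<close> is the common operator-norm limit of \<open>p\<^sub>n(T)\<close> over all sequences of
  polynomials \<open>p\<^sub>n\<close> converging to \<open>f\<close> uniformly on the spectrum.\<close>

definition cfc_op :: "(real \<Rightarrow> real) \<Rightarrow> ('h::complex_hilbert_space \<Rightarrow>\<^sub>L 'h) \<Rightarrow> ('h \<Rightarrow>\<^sub>L 'h)"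
  where "cfc_op f T = (THE S. \<forall>p :: nat \<Rightarrow> real poly.
           uniform_limit {t. complex_of_real t \<in> spectrum_op T} (\<lambda>n. poly (p n)) f sequentially
             \<longrightarrow> (\<lambda>n. poly_op (p n) T) \<longlonglongrightarrow> S)"

definition log_op :: "('h::complex_hilbert_space \<Rightarrow>\<^sub>L 'h) \<Rightarrow> ('h \<Rightarrow>\<^sub>L 'h)"
  where "log_op T = cfc_op ln T"


section \<open>Finite von Neumann algebras and tracial states\<close>

definition commutant :: "('h::complex_hilbert_space \<Rightarrow>\<^sub>L 'h) set \<Rightarrow> ('h \<Rightarrow>\<^sub>L 'h) set"
  where "commutant M = {T \<in> bounded_ops. \<forall>S\<in>M. T o\<^sub>L S = S o\<^sub>L T}"

text \<open>The double commutant condition already makes \<open>M\<close> a unital, weakly closed subalgebra.\<close>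

definition von_neumann_algebra :: "('h::complex_hilbert_space \<Rightarrow>\<^sub>L 'h) set \<Rightarrow> bool"
  where "von_neumann_algebra M \<longleftrightarrow>
           M \<subseteq> bounded_ops \<and> (\<forall>T\<in>M. adj_op T \<in> M) \<and> commutant (commutant M) = M"

definition finite_von_neumann_algebra :: "('h::complex_hilbert_space \<Rightarrow>\<^sub>L 'h) set \<Rightarrow> bool"
  where "finite_von_neumann_algebra M \<longleftrightarrow> von_neumann_algebra M \<and>
           (\<forall>V\<in>M. adj_op V o\<^sub>L V = id_blinfun \<longrightarrow> V o\<^sub>L adj_op V = id_blinfun)"

definition state_on ::
    "('h::complex_hilbert_space \<Rightarrow>\<^sub>L 'h) set \<Rightarrow> (('h \<Rightarrow>\<^sub>L 'h) \<Rightarrow> complex) \<Rightarrow> bool"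
  where "state_on M \<tau> \<longleftrightarrow>
           (\<forall>X\<in>M. \<forall>Y\<in>M. \<tau> (X + Y) = \<tau> X + \<tau> Y) \<and>
           (\<forall>c. \<forall>X\<in>M. \<tau> (cscale_op c X) = c * \<tau> X) \<and>
           (\<forall>X\<in>M. positive_op X \<longrightarrow> \<tau> X \<in> \<real>\<^sub>\<ge>\<^sub>0) \<and>
           \<tau> id_blinfun = 1"

definition tracial_on ::
    "('h::complex_hilbert_space \<Rightarrow>\<^sub>L 'h) set \<Rightarrow> (('h \<Rightarrow>\<^sub>L 'h) \<Rightarrow> complex) \<Rightarrow> bool"
  where "tracial_on M \<tau> \<longleftrightarrow> (\<forall>X\<in>M. \<forall>Y\<in>M. \<tau> (X o\<^sub>L Y) = \<tau> (Y o\<^sub>L X))"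

definition faithful_on ::
    "('h::complex_hilbert_space \<Rightarrow>\<^sub>L 'h) set \<Rightarrow> (('h \<Rightarrow>\<^sub>L 'h) \<Rightarrow> complex) \<Rightarrow> bool"
  where "faithful_on M \<tau> \<longleftrightarrow> (\<forall>X\<in>M. positive_op X \<and> \<tau> X = 0 \<longrightarrow> X = 0)"

text \<open>Normality: \<open>\<tau>\<close> preserves suprema of bounded increasing nets of self-adjoint elements.  The net
  enters through its range, an upward directed set \<open>D\<close>; \<open>S\<close> is the least upper bound of \<open>D\<close> among
  the self-adjoint elements of \<open>M\<close>.\<close>

definition normal_on ::
    "('h::complex_hilbert_space \<Rightarrow>\<^sub>L 'h) set \<Rightarrow> (('h \<Rightarrow>\<^sub>L 'h) \<Rightarrow> complex) \<Rightarrow> bool"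
  where "normal_on M \<tau> \<longleftrightarrow>
           (\<forall>D S. D \<noteq> {} \<and> D \<subseteq> {X\<in>M. self_adjoint_op X} \<and>
              (\<forall>X\<in>D. \<forall>Y\<in>D. \<exists>Z\<in>D. le_op X Z \<and> le_op Y Z) \<and>
              S \<in> M \<and> self_adjoint_op S \<and> (\<forall>X\<in>D. le_op X S) \<and>
              (\<forall>U\<in>M. self_adjoint_op U \<and> (\<forall>X\<in>D. le_op X U) \<longrightarrow> le_op S U)
            \<longrightarrow> Re (\<tau> S) = (SUP X\<in>D. Re (\<tau> X)))"

definition faithful_normal_tracial_state ::
    "('h::complex_hilbert_space \<Rightarrow>\<^sub>L 'h) set \<Rightarrow> (('h \<Rightarrow>\<^sub>L 'h) \<Rightarrow> complex) \<Rightarrow> bool"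
  where "faithful_normal_tracial_state M \<tau> \<longleftrightarrow>
           state_on M \<tau> \<and> faithful_on M \<tau> \<and> normal_on M \<tau> \<and> tracial_on M \<tau>"


section \<open>The distance\<close>

definition positive_invertibles ::
    "('h::complex_hilbert_space \<Rightarrow>\<^sub>L 'h) set \<Rightarrow> ('h \<Rightarrow>\<^sub>L 'h) set"
  where "positive_invertibles M = {A\<in>M. positive_op A \<and>
           (\<exists>B\<in>M. A o\<^sub>L B = id_blinfun \<and> B o\<^sub>L A = id_blinfun)}"

definition d_tau_sq ::
    "(('h::complex_hilbert_space \<Rightarrow>\<^sub>L 'h) \<Rightarrow> complex) \<Rightarrow> ('h \<Rightarrow>\<^sub>L 'h) \<Rightarrow> ('h \<Rightarrow>\<^sub>L 'h) \<Rightarrow> complex"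
  where "d_tau_sq \<tau> A B =
           \<tau> (log_op ((1/2) *\<^sub>R (A + B))) - 1/2 * \<tau> (log_op A) - 1/2 * \<tau> (log_op B)"

definition d_tau ::
    "(('h::complex_hilbert_space \<Rightarrow>\<^sub>L 'h) \<Rightarrow> complex) \<Rightarrow> ('h \<Rightarrow>\<^sub>L 'h) \<Rightarrow> ('h \<Rightarrow>\<^sub>L 'h) \<Rightarrow> real"
  where "d_tau \<tau> A B = sqrt (Re (d_tau_sq \<tau> A B))"

text \<open>The locale \<open>Metric_space\<close> asks for nonnegativity and symmetry on the whole type, so a distance
  that is only meaningful on \<open>S\<close> is set to \<open>0\<close> when an argument lies outside \<open>S\<close>.\<close>

definition metric_on :: "'a set \<Rightarrow> ('a \<Rightarrow> 'a \<Rightarrow> real) \<Rightarrow> bool"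
  where "metric_on S d \<longleftrightarrow> Metric_space S (\<lambda>x y. if x \<in> S \<and> y \<in> S then d x y else 0)"

end

theory Submission
  imports Defs "HOL-Computational_Algebra.Fundamental_Theorem_Algebra"
begin

text \<open>
  Write \<open>L X = \<tau> (log X)\<close>.  For two positive invertible elements \<open>X\<close>, \<open>Y\<close>, applying Bernstein polynomials
  to both gives approximate couplings of their spectral distributions, with weights
  \<open>\<tau> (b\<^sub>k(X) b\<^sub>l(Y)) \<ge> 0\<close>.  Hence a scalar inequality \<open>\<Sum> f\<^sub>i(u) g\<^sub>i(v) \<ge> 0\<close> implies
  \<open>\<Sum> \<tau> (f\<^sub>i(X) g\<^sub>i(Y)) \<ge> 0\<close>.  This yields the strict concavity of \<open>L\<close>, hence nonnegativity and
  definiteness, and the tangent bounds showing that \<open>L (S X S) - L X\<close> does not depend on \<open>X\<close>.  So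
  in the triangle inequality \<open>d(A,C) \<le> d(A,B) + d(B,C)\<close> one may assume \<open>B = 1\<close>.

  The right-hand side then depends on the spectral distributions only, so \<open>A\<close> may be replaced
  by a unitary conjugate that almost maximizes \<open>L (A + C)\<close>.  A second-order expansion along a
  Cayley transform shows that such an \<open>A\<close> almost commutes with \<open>(A + C)\<^sup>-\<^sup>1\<close>, and therefore with
  \<open>C\<close>, in \<open>2\<close>-norm.  For almost commuting pairs \<open>\<tau> (p(A + C))\<close> is almost the expectation of
  \<open>p(u + v)\<close> under the coupling, and the claim reduces to the scalar triangle inequality, that is,
  to the subadditivity of \<open>sqrt (log cosh)\<close>.
\<close>

section \<open>Bounded endomorphisms as a ring\<close>

text \<open>The obstacle is the joint term \<open>L (x + y)\<close>. A coupling integrates only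
  products with a function of \<open>x\<close> to the left of a function of \<open>y\<close>, and
  the logarithm of a sum has no such form unless \<open>x\<close> and \<open>y\<close> commute. With
  \<open>1\<close> in the middle, all other terms involve one variable. Raising the joint term
  within the spectral class of \<open>x\<close> leaves them fixed, so the extreme case implies the
  general one. Traces are linear and square roots are not; the triangle inequality is therefore
  traded for the family \<open>D x y \<le> D x 1 / r + D y 1 / (1 - r)\<close> with
  \<open>0 < r < 1\<close>. The supremum need not be attained, so all statements about a maximizer
  are quantitative, with constants that are uniform over an order interval and fixed before the
  element is chosen. A step of size \<open>s\<close> gains \<open>2 * s\<close> times the squared
  \<open>2\<close>-norm of a commutator, up to order \<open>s\<^sup>2\<close>; hence near
  commutation in \<open>2\<close>-norm. Scalars are real throughout: skew-adjoint elements replace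
  multiples of the imaginary unit, and the complex structure enters only where the algebra is
  matched with \<open>M\<close>.\<close>

text \<open>A copy of the bounded endomorphisms whose composition is a ring multiplication, so that the
  class-based algebra of the library applies.\<close>

typedef (overloaded) ('a::real_normed_vector) endo = "UNIV :: ('a \<Rightarrow>\<^sub>L 'a) set"
  morphisms rep_endo Endo ..

setup_lifting type_definition_endo

text \<open>The sort stays below \<open>real_normed_algebra_1\<close>: on the zero space
  \<open>1 = 0\<close>, so neither \<open>0 \<noteq> 1\<close> nor \<open>norm 1 = 1\<close> can be
  proved.\<close>

instantiation endo :: (real_normed_vector) "{real_normed_algebra, monoid_mult}"
begin

lift_definition zero_endo :: "'a endo" is 0 .
lift_definition one_endo :: "'a endo" is id_blinfun .
lift_definition plus_endo :: "'a endo \<Rightarrow> 'a endo \<Rightarrow> 'a endo" is "(+)" .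
lift_definition minus_endo :: "'a endo \<Rightarrow> 'a endo \<Rightarrow> 'a endo" is "(-)" .
lift_definition uminus_endo :: "'a endo \<Rightarrow> 'a endo" is uminus .
lift_definition times_endo :: "'a endo \<Rightarrow> 'a endo \<Rightarrow> 'a endo" is "(o\<^sub>L)" .
lift_definition scaleR_endo :: "real \<Rightarrow> 'a endo \<Rightarrow> 'a endo" is scaleR .
lift_definition norm_endo :: "'a endo \<Rightarrow> real" is norm .

definition sgn_endo :: "'a endo \<Rightarrow> 'a endo" where "sgn_endo x = scaleR (inverse (norm x)) x"
definition dist_endo :: "'a endo \<Rightarrow> 'a endo \<Rightarrow> real" where "dist_endo x y = norm (x - y)"
definition [code del]:
  "(uniformity :: ('a endo \<times> 'a endo) filter) = (INF e\<in>{0 <..}. principal {(x, y). dist x y < e})"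
definition open_endo :: "'a endo set \<Rightarrow> bool"
  where [code del]: "open_endo S = (\<forall>x\<in>S. \<forall>\<^sub>F (x', y) in uniformity. x' = x \<longrightarrow> y \<in> S)"

instance
proof
  fix x y z :: "'a endo" and a b :: real
  show "x + y + z = x + (y + z)" by transfer (rule add.assoc)
  show "x + y = y + x" by transfer (rule add.commute)
  show "0 + x = x" by transfer simp
  show "- x + x = 0" by transfer simp
  show "x - y = x + - y" by transfer simp
  show "x * y * z = x * (y * z)" by transfer (rule blinfun_eqI, simp)
  show "(x + y) * z = x * z + y * z"
    by transfer (rule blinfun_eqI, simp add: blinfun.bilinear_simps)
  show "x * (y + z) = x * y + x * z"
    by transfer (rule blinfun_eqI, simp add: blinfun.bilinear_simps)
  show "1 * x = x" by transfer (rule blinfun_eqI, simp)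
  show "x * 1 = x" by transfer (rule blinfun_eqI, simp)
  show "a *\<^sub>R (x + y) = a *\<^sub>R x + a *\<^sub>R y" by transfer (rule scaleR_add_right)
  show "(a + b) *\<^sub>R x = a *\<^sub>R x + b *\<^sub>R x" by transfer (rule scaleR_add_left)
  show "a *\<^sub>R b *\<^sub>R x = (a * b) *\<^sub>R x" by transfer simp
  show "1 *\<^sub>R x = x" by transfer simp
  show "a *\<^sub>R x * y = a *\<^sub>R (x * y)"
    by transfer (rule blinfun_eqI, simp add: blinfun.bilinear_simps)
  show "x * a *\<^sub>R y = a *\<^sub>R (x * y)"
    by transfer (rule blinfun_eqI, simp add: blinfun.bilinear_simps)
  show "dist x y = norm (x - y)" by (rule dist_endo_def)
  show "(uniformity :: ('a endo \<times> 'a endo) filter) = (INF e\<in>{0 <..}. principal {(x, y). dist x y < e})"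
    by (rule uniformity_endo_def)
  show "open U = (\<forall>x\<in>U. \<forall>\<^sub>F (x', y) in uniformity. x' = x \<longrightarrow> y \<in> U)" for U :: "'a endo set"
    by (rule open_endo_def)
  show "sgn x = inverse (norm x) *\<^sub>R x" by (rule sgn_endo_def)
  show "(norm x = 0) = (x = 0)" by transfer simp
  show "norm (x + y) \<le> norm x + norm y" by transfer (rule norm_triangle_ineq)
  show "norm (a *\<^sub>R x) = \<bar>a\<bar> * norm x" by transfer simp
  show "norm (x * y) \<le> norm x * norm y" by transfer (rule norm_blinfun_compose)
qed

end

lemma tendsto_rep_endo_iff:
  fixes x :: "'a::real_normed_vector endo"
  shows "((\<lambda>n. rep_endo (X n)) \<longlongrightarrow> rep_endo x) F \<longleftrightarrow> (X \<longlongrightarrow> x) F"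
proof -
  have "norm (rep_endo a - rep_endo b) = norm (a - b)" for a b :: "'a endo"
    by transfer simp
  then show ?thesis by (simp add: tendsto_iff dist_norm)
qed

instance endo :: (banach) banach
proof
  fix X :: "nat \<Rightarrow> 'a endo" assume X: "Cauchy X"
  have *: "dist (rep_endo a) (rep_endo b) = dist a b" for a b :: "'a endo"
    unfolding dist_norm by transfer simp
  have "Cauchy (\<lambda>n. rep_endo (X n))" using X by (simp add: Cauchy_def *)
  then obtain L where "(\<lambda>n. rep_endo (X n)) \<longlonglongrightarrow> L" using Cauchy_convergent convergent_def by blast
  then have "X \<longlonglongrightarrow> Endo L" by (simp add: tendsto_rep_endo_iff [symmetric] Endo_inverse)
  then show "convergent X" by (auto simp: convergent_def)
qed

lift_definition ap :: "'a::real_normed_vector endo \<Rightarrow> 'a \<Rightarrow> 'a" is blinfun_apply .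

lemma endo_eqI: "(\<And>v. ap x v = ap y v) \<Longrightarrow> x = y"
  by transfer (rule blinfun_eqI)

lemma bounded_bilinear_ap: "bounded_bilinear ap"
proof
  fix a a' :: "'a endo" and b b' :: 'a and r :: real
  show "ap (a + a') b = ap a b + ap a' b" by transfer (simp add: blinfun.bilinear_simps)
  show "ap a (b + b') = ap a b + ap a b'" by transfer (simp add: blinfun.bilinear_simps)
  show "ap (r *\<^sub>R a) b = r *\<^sub>R ap a b" by transfer (simp add: blinfun.bilinear_simps)
  show "ap a (r *\<^sub>R b) = r *\<^sub>R ap a b" by transfer (simp add: blinfun.bilinear_simps)
  show "\<exists>K. \<forall>(a::'a endo) b. norm (ap a b) \<le> norm a * norm b * K"
    by (rule exI [of _ 1], transfer, simp add: norm_blinfun)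
qed

interpretation ap: bounded_bilinear ap
  by (rule bounded_bilinear_ap)

lemmas ap_simps = ap.add_left ap.add_right ap.diff_left ap.diff_right ap.minus_left ap.minus_right
  ap.scaleR_left ap.scaleR_right ap.zero_left ap.zero_right

lemma ap_mult [simp]: "ap (x * y) v = ap x (ap y v)" by transfer simp
lemma ap_one [simp]: "ap 1 v = v" by transfer simp

lemma norm_ap: "norm (ap x v) \<le> norm x * norm v" by transfer (rule norm_blinfun)

lemma norm_endo_bound: "0 \<le> c \<Longrightarrow> (\<And>v. norm (ap x v) \<le> c * norm v) \<Longrightarrow> norm x \<le> c"
  by transfer (rule norm_blinfun_bound)

lemma norm_one_endo_le: "norm (1 :: 'a::real_normed_vector endo) \<le> 1"
  by (rule norm_endo_bound) auto


section \<open>Evaluation of real polynomials at algebra elements\<close>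

definition peval :: "real poly \<Rightarrow> 'a \<Rightarrow> 'a::{real_algebra, monoid_mult}"
  where "peval p x = fold_coeffs (\<lambda>a y. a *\<^sub>R 1 + x * y) p 0"

lemma peval_0 [simp]: "peval 0 x = 0"
  by (simp add: peval_def)

lemma peval_pCons [simp]: "peval (pCons a p) x = a *\<^sub>R 1 + x * peval p x"
  by (cases "a = 0 \<and> p = 0") (auto simp: peval_def)

lemma peval_1 [simp]: "peval 1 x = 1"
  by (simp add: one_pCons)

lemma peval_add: "peval (p + q) x = peval p x + peval q x"
proof (induction p q rule: poly_induct2)
  case (pCons a p b q)
  then show ?case by (simp add: algebra_simps)
qed simp

lemma peval_smult: "peval (smult c p) x = c *\<^sub>R peval p x"
  by (induction p) (simp_all add: algebra_simps)

lemma peval_minus: "peval (- p) x = - peval p x"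
  using peval_smult [of "-1" p x] by simp

lemma peval_diff: "peval (p - q) x = peval p x - peval q x"
  using peval_add [of p "- q" x] by (simp add: peval_minus)

lemma peval_mult: "peval (p * q) x = peval p x * peval q x"
  by (induction p) (simp_all add: algebra_simps peval_add peval_smult)

lemma peval_sum: "peval (sum p I) x = (\<Sum>i\<in>I. peval (p i) x)"
  by (induction I rule: infinite_finite_induct) (simp_all add: peval_add)

lemma peval_power: "peval (p ^ n) x = peval p x ^ n"
  by (induction n) (simp_all add: peval_mult)

lemma peval_pcompose: "peval (pcompose p q) x = peval p (peval q x)"
  by (induction p) (simp_all add: pcompose_pCons peval_add peval_mult)

lemma peval_commute: "peval p x * peval q x = peval q x * peval p x"
  by (metis mult.commute peval_mult)

lemma peval_intertwine:
  assumes "w * x = y * w"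
  shows "w * peval p x = peval p y * w"
proof (induction p)
  case (pCons a p)
  have "w * (x * peval p x) = y * (w * peval p x)" by (metis assms mult.assoc)
  then show ?case using pCons by (simp add: algebra_simps)
qed simp

lemma peval_altdef: "peval p x = (\<Sum>i\<le>degree p. coeff p i *\<^sub>R x ^ i)"
proof (induction p rule: pCons_induct)
  case (pCons a p)
  show ?case
  proof (cases "p = 0")
    case False
    have "peval (pCons a p) x = a *\<^sub>R 1 + (\<Sum>i\<le>degree p. coeff p i *\<^sub>R x ^ Suc i)"
      by (simp add: pCons.IH sum_distrib_left)
    also have "\<dots> = (\<Sum>i\<le>Suc (degree p). coeff (pCons a p) i *\<^sub>R x ^ i)"
      by (subst sum.atMost_Suc_shift) simp
    finally show ?thesis using False by simp
  qed simp
qed simp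


section \<open>Invertibility and the Neumann series\<close>

definition invertible_elem :: "'a::monoid_mult \<Rightarrow> bool"
  where "invertible_elem x \<longleftrightarrow> (\<exists>y. x * y = 1 \<and> y * x = 1)"

lemma invertible_elem_mult:
  assumes "invertible_elem x" "invertible_elem y"
  shows "invertible_elem (x * y)"
proof -
  obtain u v where "x * u = 1" "u * x = 1" "y * v = 1" "v * y = 1"
    using assms unfolding invertible_elem_def by blast
  then have "x * y * (v * u) = 1" "v * u * (x * y) = 1"
    by (metis mult.assoc mult.right_neutral)+
  then show ?thesis unfolding invertible_elem_def by blast
qed

lemma invertible_elem_scaleR:
  fixes x :: "'a::{real_algebra, monoid_mult}"
  assumes "invertible_elem x" "c \<noteq> 0"
  shows "invertible_elem (c *\<^sub>R x)"
proof -
  obtain u where "x * u = 1" "u * x = 1" using assms unfolding invertible_elem_def by blast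
  then have "c *\<^sub>R x * (inverse c *\<^sub>R u) = 1" "inverse c *\<^sub>R u * (c *\<^sub>R x) = 1"
    using assms by simp_all
  then show ?thesis unfolding invertible_elem_def by blast
qed

lemma invertible_elem_near_one:
  fixes x :: "'a::{real_normed_algebra, monoid_mult, banach}"
  assumes "norm (1 - x) < 1"
  shows "invertible_elem x"
proof -
  define y where "y = 1 - x"
  have y: "norm y < 1" using assms by (simp add: y_def)
  \<comment> \<open>The factor \<open>max 1 (norm 1)\<close> covers \<open>k = 0\<close>, because
    the sort says nothing about \<open>norm 1\<close>; the other powers are bounded by
    submultiplicativity.\<close>
  have bd: "norm (y ^ k) \<le> max 1 (norm (1::'a)) * norm y ^ k" for k
  proof (cases k)
    case (Suc m)
    have "norm (y ^ Suc m) \<le> norm y ^ Suc m"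
    proof (induction m)
      case (Suc m)
      have "norm (y ^ Suc (Suc m)) \<le> norm y * norm (y ^ Suc m)"
        by (simp only: power_Suc [of y "Suc m"] norm_mult_ineq)
      also have "\<dots> \<le> norm y * norm y ^ Suc m" using Suc by (intro mult_left_mono) auto
      finally show ?case by simp
    qed simp
    also have "\<dots> \<le> max 1 (norm (1::'a)) * norm y ^ Suc m"
      by (simp add: mult_le_cancel_right1 del: power_Suc)
    finally show ?thesis by (simp add: Suc)
  qed simp
  have "summable (\<lambda>k. max 1 (norm (1::'a)) * norm y ^ k)"
    using y by (intro summable_mult summable_geometric) simp
  then have "summable (\<lambda>k. norm (y ^ k))"
    by (rule summable_comparison_test') (use bd in simp)
  then have sm: "summable (\<lambda>k. y ^ k)" and nl: "(\<lambda>k. y ^ k) \<longlonglongrightarrow> 0"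
    by (auto intro: summable_norm_cancel summable_LIMSEQ_zero)
  define S where "S n = (\<Sum>k<n. y ^ k)" for n
  have SL: "S \<longlonglongrightarrow> suminf (\<lambda>k. y ^ k)" unfolding S_def by (rule summable_LIMSEQ [OF sm])
  have "x * S n = 1 - y ^ n \<and> S n * x = 1 - y ^ n" for n
  proof (induction n)
    case (Suc n)
    have xy: "x = 1 - y" by (simp add: y_def)
    have "x * y ^ n = y ^ n - y ^ Suc n" "y ^ n * x = y ^ n - y ^ Suc n"
      unfolding xy by (simp_all add: algebra_simps power_commutes)
    then have "x * S (Suc n) = x * S n + (y ^ n - y ^ Suc n)"
      and "S (Suc n) * x = S n * x + (y ^ n - y ^ Suc n)"
      by (simp_all add: S_def distrib_left distrib_right)
    then show ?case using Suc by simp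
  qed (simp add: S_def)
  then have "(\<lambda>n. x * S n) \<longlonglongrightarrow> 1 - 0" "(\<lambda>n. S n * x) \<longlonglongrightarrow> 1 - 0"
    by (simp_all only:, intro tendsto_intros nl)+
  moreover have "(\<lambda>n. x * S n) \<longlonglongrightarrow> x * suminf (\<lambda>k. y ^ k)" "(\<lambda>n. S n * x) \<longlonglongrightarrow> suminf (\<lambda>k. y ^ k) * x"
    by (intro tendsto_intros SL)+
  ultimately have "x * suminf (\<lambda>k. y ^ k) = 1" "suminf (\<lambda>k. y ^ k) * x = 1"
    using LIMSEQ_unique by fastforce+
  then show ?thesis unfolding invertible_elem_def by blast
qed

section \<open>Symmetric operators\<close>

text \<open>A relation instead of an operation, so that no representation theorem is needed for
  existence. The inner product is the real one; \<open>adjoint_pair_cip\<close> links it to the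
  complex one.\<close>

definition adjoint_pair :: "'a::real_inner endo \<Rightarrow> 'a endo \<Rightarrow> bool"
  where "adjoint_pair x y \<longleftrightarrow> (\<forall>u v. inner (ap x u) v = inner u (ap y v))"

abbreviation selfadj :: "'a::real_inner endo \<Rightarrow> bool"
  where "selfadj x \<equiv> adjoint_pair x x"

lemma adjoint_pair_commute: "adjoint_pair x y \<Longrightarrow> adjoint_pair y x"
  unfolding adjoint_pair_def by (metis inner_commute)

lemma adjoint_pair_0: "adjoint_pair 0 0" and adjoint_pair_1: "adjoint_pair 1 1"
  by (simp_all add: adjoint_pair_def ap_simps)

lemma adjoint_pair_add: "adjoint_pair x y \<Longrightarrow> adjoint_pair x' y' \<Longrightarrow> adjoint_pair (x + x') (y + y')"
  and adjoint_pair_diff: "adjoint_pair x y \<Longrightarrow> adjoint_pair x' y' \<Longrightarrow> adjoint_pair (x - x') (y - y')"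
  and adjoint_pair_scaleR: "adjoint_pair x y \<Longrightarrow> adjoint_pair (c *\<^sub>R x) (c *\<^sub>R y)"
  and adjoint_pair_minus: "adjoint_pair x y \<Longrightarrow> adjoint_pair (- x) (- y)"
  and adjoint_pair_mult: "adjoint_pair x y \<Longrightarrow> adjoint_pair x' y' \<Longrightarrow> adjoint_pair (x * x') (y' * y)"
  by (simp_all add: adjoint_pair_def ap_simps inner_add_left inner_add_right
      inner_diff_left inner_diff_right)

lemmas adjoint_pair_intros = adjoint_pair_0 adjoint_pair_1 adjoint_pair_add adjoint_pair_diff
  adjoint_pair_scaleR adjoint_pair_minus adjoint_pair_mult

lemma adjoint_pair_unique: "adjoint_pair x y \<Longrightarrow> adjoint_pair x z \<Longrightarrow> y = z"
proof (rule endo_eqI)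
  fix v assume "adjoint_pair x y" "adjoint_pair x z"
  then have "inner u (ap y v) = inner u (ap z v)" for u unfolding adjoint_pair_def by metis
  then show "ap y v = ap z v" by (metis vector_eq_ldot)
qed

lemma selfadj_peval: "selfadj x \<Longrightarrow> selfadj (peval p x)"
proof (induction p)
  case (pCons a p)
  have "x * peval p x = peval p x * x" using peval_commute [of "[:0,1:]" x p] by simp
  then show ?case using pCons adjoint_pair_mult [of x x "peval p x" "peval p x"]
    by (auto intro!: adjoint_pair_intros)
qed (simp add: adjoint_pair_0)

lemma adjoint_pair_lim:
  assumes "X \<longlonglongrightarrow> x" "Y \<longlonglongrightarrow> y" "\<And>n. adjoint_pair (X n) (Y n)"
  shows "adjoint_pair x y"
  unfolding adjoint_pair_def
proof (intro allI)
  fix u v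
  have "(\<lambda>n. inner (ap (X n) u) v) \<longlonglongrightarrow> inner (ap x u) v"
    by (intro tendsto_intros ap.tendsto assms)
  moreover have "(\<lambda>n. inner u (ap (Y n) v)) \<longlonglongrightarrow> inner u (ap y v)"
    by (intro tendsto_intros ap.tendsto assms)
  moreover have "inner (ap (X n) u) v = inner u (ap (Y n) v)" for n
    using assms(3) by (simp add: adjoint_pair_def)
  ultimately show "inner (ap x u) v = inner u (ap y v)" using LIMSEQ_unique by simp
qed

section \<open>Order bounds given by the quadratic form\<close>

definition op_between :: "real \<Rightarrow> real \<Rightarrow> 'a::real_inner endo \<Rightarrow> bool"
  where "op_between a b x \<longleftrightarrow> selfadj x \<and>
    (\<forall>v. a * (norm v)\<^sup>2 \<le> inner (ap x v) v \<and> inner (ap x v) v \<le> b * (norm v)\<^sup>2)"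

lemma op_between_selfadj: "op_between a b x \<Longrightarrow> selfadj x"
  by (simp add: op_between_def)

lemma op_between_mono:
  assumes "op_between a b x" "a' \<le> a" "b \<le> b'"
  shows "op_between a' b' x"
proof -
  have "a' * (norm v)\<^sup>2 \<le> a * (norm v)\<^sup>2" "b * (norm v)\<^sup>2 \<le> b' * (norm v)\<^sup>2" for v :: 'a
    using assms by (auto intro: mult_right_mono)
  then show ?thesis using assms(1) unfolding op_between_def by (meson order_trans)
qed

lemma op_between_add: "op_between a b x \<Longrightarrow> op_between c d y \<Longrightarrow> op_between (a + c) (b + d) (x + y)"
  unfolding op_between_def
  by (auto intro!: adjoint_pair_intros add_mono simp: ap_simps inner_add_left distrib_right)

lemma op_between_scaleR: "op_between a b x \<Longrightarrow> 0 \<le> c \<Longrightarrow> op_between (c * a) (c * b) (c *\<^sub>R x)"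
  unfolding op_between_def
  by (auto intro!: adjoint_pair_intros mult_left_mono simp: ap_simps mult.assoc)

lemma op_between_minus: "op_between a b x \<Longrightarrow> op_between (- b) (- a) (- x)"
  unfolding op_between_def by (auto intro!: adjoint_pair_intros simp: ap_simps)

lemma op_between_scalar: "op_between c c (c *\<^sub>R 1)"
  unfolding op_between_def
  by (auto intro!: adjoint_pair_intros simp: ap_simps power2_norm_eq_inner)

lemma selfadj_op_between_norm:
  assumes "selfadj x"
  shows "op_between (- norm x) (norm x) x"
proof -
  have "\<bar>inner (ap x v) v\<bar> \<le> norm x * (norm v)\<^sup>2" for v
    using Cauchy_Schwarz_ineq2 [of "ap x v" v] norm_ap [of x v]
    by (smt (verit) mult_right_mono norm_ge_zero power2_eq_square mult.assoc)
  then show ?thesis using assms unfolding op_between_def by (smt (verit) mult_minus_left)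
qed

text \<open>By polarization, the quadratic form of a symmetric operator controls its norm.\<close>

lemma norm_le_of_op_between:
  assumes x: "op_between (- c) c x" and c: "0 \<le> c"
  shows "norm x \<le> c"
proof (rule norm_endo_bound [OF c])
  fix u
  have s: "selfadj x" using x by (rule op_between_selfadj)
  have q: "inner (ap x v) v \<le> c * (norm v)\<^sup>2" "- c * (norm v)\<^sup>2 \<le> inner (ap x v) v" for v
    using x by (auto simp: op_between_def)
  show "norm (ap x u) \<le> c * norm u"
  proof (cases "ap x u = 0 \<or> u = 0")
    case False
    \<comment> \<open>The vector \<open>v\<close> points along \<open>ap x u\<close> and is rescaled
      to the length of \<open>u\<close>, so that \<open>inner (ap x u) v\<close> becomes
      \<open>norm u * norm (ap x u)\<close>.\<close>
    define r where "r = norm u / norm (ap x u)"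
    define v where "v = r *\<^sub>R ap x u"
    have nv: "norm v = norm u" using False by (simp add: v_def r_def)
    have "inner (ap x v) u = inner (ap x u) v"
      using s unfolding adjoint_pair_def by (metis inner_commute)
    then have "4 * inner (ap x u) v
        = inner (ap x (u + v)) (u + v) - inner (ap x (u - v)) (u - v)"
      by (simp add: ap_simps inner_add_left inner_add_right inner_diff_left inner_diff_right)
    also have "\<dots> \<le> c * (norm (u + v))\<^sup>2 + c * (norm (u - v))\<^sup>2"
      using q(1) [of "u + v"] q(2) [of "u - v"] by simp
    also have "\<dots> = c * (2 * ((norm u)\<^sup>2 + (norm v)\<^sup>2))"
      by (simp add: power2_norm_eq_inner inner_add_left inner_add_right inner_diff_left
          inner_diff_right algebra_simps inner_commute)
    also have "\<dots> = 4 * (c * (norm u)\<^sup>2)" by (simp add: nv)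
    finally have "inner (ap x u) v \<le> c * (norm u)\<^sup>2" by simp
    moreover have "inner (ap x u) v = norm u * norm (ap x u)"
      using False by (simp add: v_def r_def power2_norm_eq_inner [symmetric] power2_eq_square)
    ultimately show ?thesis using False by (simp add: power2_eq_square)
  qed (use c ap.zero_right in auto)
qed

text \<open>After division by a number \<open>d\<close> that dominates \<open>b\<close> and
  \<open>c\<close>, the operator is within \<open>1 - c / d < 1\<close> of the identity, and the
  Neumann series applies.\<close>

lemma op_between_positive_invertible:
  fixes x :: "'a::{real_inner, banach} endo"
  assumes x: "op_between c b x" and c: "0 < c"
  shows "invertible_elem x"
proof -
  define d where "d = \<bar>b\<bar> + c"
  have d: "d > 0" "c \<le> d" "b \<le> d" using c by (auto simp: d_def)
  have "op_between c d x" using x d by (intro op_between_mono [OF x]) auto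
  then have "op_between (1 + - (1 / d * d)) (1 + - (1 / d * c)) (1 *\<^sub>R 1 + - ((1 / d) *\<^sub>R x))"
    using d by (intro op_between_add op_between_scalar op_between_minus op_between_scaleR) auto
  then have "op_between 0 (1 - c / d) (1 - (1 / d) *\<^sub>R x)" using d by simp
  then have "op_between (- (1 - c / d)) (1 - c / d) (1 - (1 / d) *\<^sub>R x)"
    by (rule op_between_mono) (use d in auto)
  then have "norm (1 - (1 / d) *\<^sub>R x) \<le> 1 - c / d"
    using d c by (intro norm_le_of_op_between) (auto simp: field_simps)
  also have "\<dots> < 1" using d c by simp
  finally have "invertible_elem ((1 / d) *\<^sub>R x)" by (rule invertible_elem_near_one)
  from invertible_elem_scaleR [OF this, of d] show ?thesis using d by simp
qed

section \<open>The real spectrum and the norm of a polynomial in a symmetric operator\<close>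

text \<open>A real polynomial splits into linear factors and factors \<open>(X - \<alpha>)\<^sup>2 + \<beta>\<^sup>2\<close>; the latter are
  invertible on symmetric operators, so only real roots matter.\<close>

lemma peval_invertible:
  fixes x :: "'a::{real_inner, banach} endo"
  assumes s: "selfadj x" and "P \<noteq> 0" and "\<And>r. poly P r = 0 \<Longrightarrow> invertible_elem (x - r *\<^sub>R 1)"
  shows "invertible_elem (peval P x)"
  using assms(2,3)
proof (induction "degree P" arbitrary: P rule: less_induct)
  case less
  show ?case
  proof (cases "degree P = 0")
    case True
    then obtain a where a: "P = [:a:]" by (rule degree_eq_zeroE)
    then have "a \<noteq> 0" using less by auto
    moreover have "invertible_elem (1::'a endo)" unfolding invertible_elem_def by (metis mult_1)
    ultimately show ?thesis using a by (simp add: invertible_elem_scaleR)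
  next
    case False
    have step: ?thesis if "P = Q * R" "degree Q > 0" "invertible_elem (peval Q x)" for Q R
    proof -
      have "R \<noteq> 0" "Q \<noteq> 0" using that less.prems by auto
      then have "degree R < degree P" using that by (simp add: degree_mult_eq)
      moreover have "invertible_elem (x - r *\<^sub>R 1)" if "poly R r = 0" for r
        using less.prems(2) [of r] that \<open>P = Q * R\<close> by simp
      ultimately have "invertible_elem (peval R x)" using less.hyps \<open>R \<noteq> 0\<close> by blast
      then show ?thesis using that by (simp add: peval_mult invertible_elem_mult)
    qed
    show ?thesis
    proof (cases "\<exists>r. poly P r = 0")
      case True
      then obtain r where r: "poly P r = 0" by blast
      then obtain R where R: "P = [:- r, 1:] * R" using poly_eq_0_iff_dvd by (meson dvdE)
      show ?thesis using less.prems(2) [OF r] by (intro step [OF R]) simp_all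
    next
      case nr: False
      let ?Q = "map_poly complex_of_real P"
      have "degree ?Q \<noteq> 0" using False by (simp add: degree_map_poly)
      then obtain z where z: "poly ?Q z = 0"
        using fundamental_theorem_of_algebra [of ?Q] by (auto simp: constant_degree)
      have im: "Im z \<noteq> 0"
      proof
        assume "Im z = 0"
        then have "z = of_real (Re z)" by (simp add: complex_eq_iff)
        moreover have "poly (map_poly complex_of_real p) (of_real r) = of_real (poly p r)" for p r
          by (induction p) (simp_all add: map_poly_pCons)
        ultimately have "of_real (poly P (Re z)) = (0::complex)" using z by metis
        then show False using nr by simp
      qed
      \<comment> \<open>The real quadratic with roots \<open>z\<close> and its conjugate. The
        remainder modulo \<open>q\<close> has degree at most one and vanishes at the non-real
        \<open>z\<close>, which forces both of its coefficients to be zero.\<close>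
      define q where "q = [: (Re z)\<^sup>2 + (Im z)\<^sup>2, - 2 * Re z, 1:]"
      have qz: "poly (map_poly complex_of_real q) z = 0"
        by (simp add: q_def map_poly_pCons complex_eq_iff power2_eq_square algebra_simps)
      define R where "R = P mod q"
      have q0: "q \<noteq> 0" "degree q = 2" by (simp_all add: q_def)
      have "degree R < 2"
        using degree_mod_less [of q P] q0 by (auto simp: R_def)
      moreover obtain a R' where R': "R = pCons a R'" by (rule pCons_cases)
      ultimately have "degree R' = 0" by (auto split: if_splits)
      then obtain b where R: "R = [:a, b:]" using R' by (metis degree_eq_zeroE)
      have "P = q * (P div q) + R" by (simp add: R_def)
      moreover have add: "map_poly complex_of_real (p + p') = map_poly of_real p + map_poly of_real p'" for p p'
        by (rule poly_eqI) (simp add: coeff_map_poly)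
      moreover have "map_poly complex_of_real (p * p') = map_poly of_real p * map_poly of_real p'" for p p'
      proof (induction p)
        case (pCons a p)
        then show ?case by (simp add: map_poly_pCons add map_poly_smult)
      qed simp
      ultimately have "map_poly complex_of_real P
          = map_poly complex_of_real q * map_poly complex_of_real (P div q) + map_poly complex_of_real R"
        by metis
      then have "poly (map_poly complex_of_real R) z = 0" using z qz by simp
      then have "of_real a + of_real b * z = 0"
        by (simp add: R map_poly_pCons mult.commute)
      then have "b * Im z = 0" "a + b * Re z = 0" by (auto simp: complex_eq_iff)
      then have "R = 0" using im by (simp add: R)
      then have Pq: "P = q * (P div q)" using \<open>P = q * (P div q) + R\<close> by simp
      have "invertible_elem (peval q x)"
      proof -
        let ?y = "x - Re z *\<^sub>R 1"
        have sy: "selfadj ?y" using s by (intro adjoint_pair_intros)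
        have pq: "peval q x = (Im z)\<^sup>2 *\<^sub>R 1 + ?y * ?y"
          by (simp add: q_def algebra_simps power2_eq_square scaleR_2 flip: scaleR_scaleR)
        let ?n = "norm ?y"
        have "op_between 0 (?n\<^sup>2) (?y * ?y)"
          unfolding op_between_def
        proof (intro conjI allI)
          show "selfadj (?y * ?y)" by (intro adjoint_pair_mult sy)
          fix v
          have *: "inner (ap (?y * ?y) v) v = (norm (ap ?y v))\<^sup>2"
            using sy unfolding adjoint_pair_def by (metis ap_mult power2_norm_eq_inner)
          show "0 * (norm v)\<^sup>2 \<le> inner (ap (?y * ?y) v) v" by (simp only: *) simp
          show "inner (ap (?y * ?y) v) v \<le> ?n\<^sup>2 * (norm v)\<^sup>2" unfolding *
            by (metis norm_ap norm_ge_zero power_mono power_mult_distrib)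
        qed
        from op_between_add [OF op_between_scalar [of "(Im z)\<^sup>2"] this] pq
        have "op_between ((Im z)\<^sup>2) ((Im z)\<^sup>2 + ?n\<^sup>2) (peval q x)" by simp
        then show ?thesis by (rule op_between_positive_invertible) (use im in simp)
      qed
      with Pq show ?thesis using q0 by (metis step zero_less_numeral)
    qed
  qed
qed

definition rspec :: "'a::real_normed_vector endo \<Rightarrow> real set"
  where "rspec x = {r. \<not> invertible_elem (x - r *\<^sub>R 1)}"

lemma rspec_subset:
  fixes x :: "'a::{real_inner, banach} endo"
  assumes x: "op_between a b x"
  shows "rspec x \<subseteq> {a..b}"
proof
  fix r assume r: "r \<in> rspec x"
  show "r \<in> {a..b}"
  proof (rule ccontr)
    assume "r \<notin> {a..b}"
    then consider "r < a" | "b < r" by fastforce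
    then have "invertible_elem (x - r *\<^sub>R 1)"
    proof cases
      case 1
      have "op_between (a + - r) (b + - r) (x + - (r *\<^sub>R 1))"
        by (intro op_between_add x op_between_minus op_between_scalar)
      then show ?thesis using op_between_positive_invertible 1 by fastforce
    next
      case 2
      have "op_between (- b + r) (- a + r) (- x + (r *\<^sub>R 1))"
        by (intro op_between_add x op_between_minus op_between_scalar)
      then have "invertible_elem (- x + (r *\<^sub>R 1))" using op_between_positive_invertible 2 by fastforce
      from invertible_elem_scaleR [OF this, of "-1"] show ?thesis by simp
    qed
    then show False using r by (simp add: rspec_def)
  qed
qed

text \<open>With \<open>s = norm y\<close>, the operator \<open>s\<^sup>2 - y\<^sup>2\<close> is not bounded below on the unit sphere.\<close>

lemma norm_square_not_invertible:
  fixes y :: "'a::{real_inner, banach} endo"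
  assumes s: "selfadj y" and ne: "(1::'a endo) \<noteq> 0"
  shows "\<not> invertible_elem ((norm y)\<^sup>2 *\<^sub>R 1 - y * y)"
proof
  let ?s = "norm y"
  assume "invertible_elem (?s\<^sup>2 *\<^sub>R 1 - y * y)"
  then obtain w where w: "w * (?s\<^sup>2 *\<^sub>R 1 - y * y) = 1" unfolding invertible_elem_def by blast
  have w0: "norm w > 0" using w ne by auto
  \<comment> \<open>A left inverse \<open>w\<close> bounds the operator below by
    \<open>1 / norm w\<close>.\<close>
  define c where "c = 1 / norm w"
  have c: "c > 0" using w0 by (simp add: c_def)
  have below: "c * norm v \<le> norm (?s\<^sup>2 *\<^sub>R v - ap y (ap y v))" for v
  proof -
    have "v = ap w (?s\<^sup>2 *\<^sub>R v - ap y (ap y v))"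
      using arg_cong [OF w, of "\<lambda>z. ap z v"] by (simp add: ap_simps)
    then have "norm v \<le> norm w * norm (?s\<^sup>2 *\<^sub>R v - ap y (ap y v))" by (metis norm_ap)
    then show ?thesis using w0 by (simp add: c_def field_simps)
  qed
  show False
  proof (cases "?s = 0")
    case True
    then have "y = 0" by simp
    have "v = 0" for v :: 'a using below [of v] c by (simp add: \<open>y = 0\<close> ap_simps zero_less_mult_iff mult_le_0_iff)
    then have "(1::'a endo) = 0" by (intro endo_eqI) (metis)
    then show False using ne by simp
  next
    case False
    then have s0: "?s > 0" by simp
    \<comment> \<open>Expanding the square of \<open>below\<close> and estimating
      \<open>norm (ap y (ap y v))\<close> by \<open>?s * norm (ap y v)\<close> leaves exactly this
      factor. It is smaller than \<open>?s\<^sup>2\<close>, although \<open>?s\<close> is the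
      operator norm of \<open>y\<close>.\<close>
    define k where "k = ?s\<^sup>2 - c\<^sup>2 / ?s\<^sup>2"
    have up: "(norm (ap y v))\<^sup>2 \<le> k * (norm v)\<^sup>2" for v
    proof -
      have "(c * norm v)\<^sup>2 \<le> (norm (?s\<^sup>2 *\<^sub>R v - ap y (ap y v)))\<^sup>2"
        using below c by (intro power_mono) auto
      also have "\<dots> = ?s\<^sup>2 * ?s\<^sup>2 * (norm v)\<^sup>2 - 2 * ?s\<^sup>2 * (norm (ap y v))\<^sup>2 + (norm (ap y (ap y v)))\<^sup>2"
      proof -
        have "inner v (ap y (ap y v)) = (norm (ap y v))\<^sup>2"
          using s unfolding adjoint_pair_def by (simp add: power2_norm_eq_inner)
        moreover have "(norm (a - b))\<^sup>2 = (norm a)\<^sup>2 - 2 * inner a b + (norm b)\<^sup>2" for a b :: 'a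
          by (simp add: power2_norm_eq_inner inner_diff_left inner_diff_right inner_commute)
        ultimately show ?thesis by (simp add: power_mult_distrib power2_eq_square)
      qed
      also have "(norm (ap y (ap y v)))\<^sup>2 \<le> ?s\<^sup>2 * (norm (ap y v))\<^sup>2"
        by (metis norm_ap norm_ge_zero power_mono power_mult_distrib)
      finally have "?s\<^sup>2 * (norm (ap y v))\<^sup>2 \<le> ?s\<^sup>2 * (k * (norm v)\<^sup>2)"
        using s0 by (simp add: k_def power_mult_distrib algebra_simps)
      then show ?thesis using s0 by simp
    qed
    have "norm (ap y v) \<le> sqrt (max 0 k) * norm v" for v
    proof (rule power2_le_imp_le)
      have "k * (norm v)\<^sup>2 \<le> max 0 k * (norm v)\<^sup>2" by (intro mult_right_mono) auto
      then show "(norm (ap y v))\<^sup>2 \<le> (sqrt (max 0 k) * norm v)\<^sup>2"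
        using up [of v] by (simp add: power_mult_distrib)
    qed simp
    then have "?s \<le> sqrt (max 0 k)" by (intro norm_endo_bound) auto
    then have "?s\<^sup>2 \<le> (sqrt (max 0 k))\<^sup>2" by (intro power_mono) auto
    then have "?s\<^sup>2 \<le> max 0 k" by simp
    moreover have "max 0 k < ?s\<^sup>2" using s0 c by (simp add: k_def)
    ultimately show False by simp
  qed
qed

text \<open>The norm is attained on the spectrum: the square of the norm of \<open>q(x)\<close>,
  minus \<open>q * q\<close>, is not invertible at \<open>x\<close> by
  \<open>norm_square_not_invertible\<close>, so by \<open>peval_invertible\<close> one of its real
  roots lies in \<open>rspec x\<close>.\<close>

lemma norm_peval_le:
  fixes x :: "'a::{real_inner, banach} endo"
  assumes s: "selfadj x" and "0 \<le> c" and c: "\<And>r. r \<in> rspec x \<Longrightarrow> \<bar>poly p r\<bar> \<le> c"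
  shows "norm (peval p x) \<le> c"
proof (cases "(1::'a endo) = 0")
  case True
  then have "peval p x = 0" by (metis mult_1 mult_zero_left)
  then show ?thesis using \<open>0 \<le> c\<close> by simp
next
  case ne: False
  have *: "\<exists>r\<in>rspec x. (poly q r)\<^sup>2 = (norm (peval q x))\<^sup>2"
    if "[:(norm (peval q x))\<^sup>2:] - q * q \<noteq> 0" for q
  proof (rule ccontr)
    assume n: "\<not> ?thesis"
    let ?P = "[:(norm (peval q x))\<^sup>2:] - q * q"
    have "invertible_elem (peval ?P x)"
      using s that
    proof (rule peval_invertible)
      fix r assume "poly ?P r = 0"
      then have "(poly q r)\<^sup>2 = (norm (peval q x))\<^sup>2" by (simp add: power2_eq_square)
      then show "invertible_elem (x - r *\<^sub>R 1)" using n by (auto simp: rspec_def)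
    qed
    moreover have "peval ?P x = (norm (peval q x))\<^sup>2 *\<^sub>R 1 - peval q x * peval q x"
      by (simp add: peval_diff peval_mult)
    ultimately show False using norm_square_not_invertible [OF selfadj_peval [OF s] ne] by metis
  qed
  have "\<exists>r\<in>rspec x. (poly p r)\<^sup>2 = (norm (peval p x))\<^sup>2"
  proof (cases "[:(norm (peval p x))\<^sup>2:] - p * p = 0")
    \<comment> \<open>Here \<open>p * p\<close> is constant, so every spectral point will do; one
      exists because the polynomial attached to \<open>[:0, 1:]\<close> is never zero.\<close>
    case True
    have "[:(norm (peval [:0, 1:] x))\<^sup>2:] - [:0, 1:] * [:0, 1:] \<noteq> (0::real poly)" by simp
    from * [OF this] obtain r where r: "r \<in> rspec x" by blast
    have "poly ([:(norm (peval p x))\<^sup>2:] - p * p) r = 0" using True by simp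
    then show ?thesis using r by (auto simp: power2_eq_square)
  qed (rule *)
  then obtain r where "r \<in> rspec x" "norm (peval p x) = \<bar>poly p r\<bar>"
    by (metis abs_norm_cancel power2_eq_iff abs_minus_cancel)
  then show ?thesis using c by simp
qed

section \<open>Continuous functional calculus\<close>

lemma poly_add_fun: "poly (p + q) = (\<lambda>r. poly p r + poly q r)"
  and poly_mult_fun: "poly (p * q) = (\<lambda>r. poly p r * poly q r)"
  and poly_pcompose_fun: "poly (pcompose p q) = (\<lambda>r. poly p (poly q r))"
  by (simp_all add: fun_eq_iff poly_pcompose)

section \<open>Bernstein polynomials on an interval\<close>

definition bern_basis :: "real \<Rightarrow> real \<Rightarrow> nat \<Rightarrow> nat \<Rightarrow> real poly"
  where "bern_basis a b n k =
    pcompose (smult (real (n choose k)) ([:0, 1:] ^ k * [:1, - 1:] ^ (n - k))) [:- a / (b - a), 1 / (b - a):]"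

definition bern_node :: "real \<Rightarrow> real \<Rightarrow> nat \<Rightarrow> nat \<Rightarrow> real"
  where "bern_node a b n k = a + (b - a) * (real k / real n)"

definition bern_poly :: "real \<Rightarrow> real \<Rightarrow> (real \<Rightarrow> real) \<Rightarrow> nat \<Rightarrow> real poly"
  where "bern_poly a b f n = (\<Sum>k\<le>n. smult (f (bern_node a b n k)) (bern_basis a b n k))"

lemma poly_bern_basis:
  "poly (bern_basis a b n k) r = Bernstein n k ((r - a) / (b - a))"
proof -
  have e: "poly [:- a / (b - a), 1 / (b - a):] r = (r - a) / (b - a)"
    by (simp add: diff_divide_distrib)
  show ?thesis
    unfolding bern_basis_def poly_pcompose e by (simp add: Bernstein_def)
qed

lemma bern_basis_nonneg:
  assumes "a < b" "r \<in> {a..b}"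
  shows "0 \<le> poly (bern_basis a b n k) r"
  unfolding poly_bern_basis using assms
  by (intro Bernstein_nonneg) (auto simp: field_simps)

lemma bern_node_in:
  assumes "a < b" "k \<le> n"
  shows "bern_node a b n k \<in> {a..b}"
proof -
  have "0 \<le> real k / real n" "real k / real n \<le> 1" using assms by (auto simp: divide_le_eq_1)
  then have "0 \<le> (b - a) * (real k / real n)" "(b - a) * (real k / real n) \<le> b - a"
    using assms by (auto intro: mult_nonneg_nonneg mult_left_le simp del: times_divide_eq_right)
  then show ?thesis by (simp add: bern_node_def)
qed

lemma bern_poly_uniform_limit:
  fixes f :: "real \<Rightarrow> real"
  assumes ab: "a < b" and f: "continuous_on {a..b} f"
  shows "uniform_limit {a..b} (\<lambda>n. poly (bern_poly a b f n)) f sequentially"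
proof (rule uniform_limitI)
  fix e :: real assume e: "e > 0"
  define g where "g = (\<lambda>s. f (a + (b - a) * s))"
  have "continuous_on {0..1} g" unfolding g_def
  proof (rule continuous_on_compose2 [OF f])
    show "(\<lambda>s. a + (b - a) * s) ` {0..1} \<subseteq> {a..b}"
    proof clarify
      fix s :: real assume "s \<in> {0..1}"
      then have "0 \<le> (b - a) * s" "(b - a) * s \<le> b - a"
        using ab by (auto intro: mult_nonneg_nonneg mult_left_le)
      then show "a + (b - a) * s \<in> {a..b}" by simp
    qed
  qed (intro continuous_intros)
  then obtain N where N: "\<And>n s. N \<le> n \<Longrightarrow> s \<in> {0..1} \<Longrightarrow> \<bar>g s - (\<Sum>k\<le>n. g (k/n) * Bernstein n k s)\<bar> < e"
    using Bernstein_Weierstrass [OF _ e] by blast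
  have "dist (poly (bern_poly a b f n) r) (f r) < e" if "N \<le> n" "r \<in> {a..b}" for n r
  proof -
    define s where "s = (r - a) / (b - a)"
    have "(b - a) * s = r - a" using ab by (simp add: s_def)
    then have "g s = f r" by (simp add: g_def)
    moreover have "s \<in> {0..1}" using that ab by (auto simp: s_def)
    moreover have "poly (bern_poly a b f n) r = (\<Sum>k\<le>n. g (k/n) * Bernstein n k s)"
      using ab by (simp add: bern_poly_def poly_sum poly_bern_basis g_def bern_node_def s_def)
    ultimately show ?thesis using N [OF that(1), of s] by (simp add: dist_real_def abs_minus_commute)
  qed
  then show "\<forall>\<^sub>F n in sequentially. \<forall>r\<in>{a..b}. dist (poly (bern_poly a b f n) r) (f r) < e"
    unfolding eventually_sequentially by blast
qed

section \<open>The functional calculus of a symmetric operator\<close>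

definition fc :: "(real \<Rightarrow> real) \<Rightarrow> 'a endo \<Rightarrow> 'a::{real_inner, banach} endo"
  where "fc f x = (THE y. \<forall>p. uniform_limit (rspec x) (\<lambda>n. poly (p n)) f sequentially
    \<longrightarrow> (\<lambda>n. peval (p n) x) \<longlonglongrightarrow> y)"

lemma norm_peval_diff_le:
  fixes x :: "'a::{real_inner, banach} endo"
  assumes "selfadj x" "0 \<le> c" "\<And>r. r \<in> rspec x \<Longrightarrow> \<bar>poly p r - poly q r\<bar> \<le> c"
  shows "norm (peval p x - peval q x) \<le> c"
  using norm_peval_le [of x c "p - q"] assms by (simp add: peval_diff)

text \<open>Bernstein polynomials provide one approximating sequence. By
  \<open>norm_peval_diff_le\<close>, any two sequences with the same uniform limit on the spectrum
  have norm-close values at \<open>x\<close>.\<close>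

lemma fc_spec:
  fixes x :: "'a::{real_inner, banach} endo"
  assumes x: "op_between a b x" and ab: "a < b" and f: "continuous_on {a..b} f"
  shows "\<exists>!y. \<forall>p. uniform_limit (rspec x) (\<lambda>n. poly (p n)) f sequentially
    \<longrightarrow> (\<lambda>n. peval (p n) x) \<longlonglongrightarrow> y"
proof -
  have s: "selfadj x" and sub: "rspec x \<subseteq> {a..b}"
    using x by (auto dest: op_between_selfadj rspec_subset)
  let ?q = "bern_poly a b f"
  have q: "uniform_limit (rspec x) (\<lambda>n. poly (?q n)) f sequentially"
    using bern_poly_uniform_limit [OF ab f] sub by (rule uniform_limit_on_subset)
  have close: "\<exists>N. \<forall>m\<ge>N. \<forall>n\<ge>N. norm (peval (p m) x - peval (?q n) x) < e"
    if p: "uniform_limit (rspec x) (\<lambda>n. poly (p n)) f sequentially" and "e > 0" for p and e :: real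
  proof -
    have "e / 4 > 0" using \<open>e > 0\<close> by simp
    then obtain M N where M: "\<And>m r. m \<ge> M \<Longrightarrow> r \<in> rspec x \<Longrightarrow> dist (poly (p m) r) (f r) < e / 4"
      and N: "\<And>m r. m \<ge> N \<Longrightarrow> r \<in> rspec x \<Longrightarrow> dist (poly (?q m) r) (f r) < e / 4"
      using uniform_limitD [OF p] uniform_limitD [OF q] unfolding eventually_sequentially by metis
    have "norm (peval (p m) x - peval (?q n) x) < e" if "m \<ge> max M N" "n \<ge> max M N" for m n
    proof -
      have "norm (peval (p m) x - peval (?q n) x) \<le> e / 2"
      proof (rule norm_peval_diff_le [OF s])
        fix r assume "r \<in> rspec x"
        then have "\<bar>poly (p m) r - f r\<bar> < e / 4" "\<bar>poly (?q n) r - f r\<bar> < e / 4"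
          using M [of m r] N [of n r] that unfolding dist_real_def by auto
        then show "\<bar>poly (p m) r - poly (?q n) r\<bar> \<le> e / 2" by arith
      qed (use \<open>e > 0\<close> in auto)
      then show ?thesis using \<open>e > 0\<close> by simp
    qed
    then show ?thesis by blast
  qed
  have "Cauchy (\<lambda>n. peval (?q n) x)"
    using close [OF q] by (intro CauchyI) meson
  then obtain y where y: "(\<lambda>n. peval (?q n) x) \<longlonglongrightarrow> y"
    using Cauchy_convergent convergent_def by blast
  show ?thesis
  proof (rule ex1I)
    show "\<forall>p. uniform_limit (rspec x) (\<lambda>n. poly (p n)) f sequentially
      \<longrightarrow> (\<lambda>n. peval (p n) x) \<longlonglongrightarrow> y"
    proof (intro allI impI)
      fix p assume p: "uniform_limit (rspec x) (\<lambda>n. poly (p n)) f sequentially"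
      have "(\<lambda>n. peval (p n) x - peval (?q n) x) \<longlonglongrightarrow> 0"
        using close [OF p] by (intro LIMSEQ_I) (metis diff_zero)
      from tendsto_add [OF this y] show "(\<lambda>n. peval (p n) x) \<longlonglongrightarrow> y" by simp
    qed
    fix z assume "\<forall>p. uniform_limit (rspec x) (\<lambda>n. poly (p n)) f sequentially
      \<longrightarrow> (\<lambda>n. peval (p n) x) \<longlonglongrightarrow> z"
    then show "z = y" using q y LIMSEQ_unique by blast
  qed
qed

lemma fc_lim:
  fixes x :: "'a::{real_inner, banach} endo"
  assumes x: "op_between a b x" and ab: "a < b" and f: "continuous_on {a..b} f"
    and p: "uniform_limit {a..b} (\<lambda>n. poly (p n)) f sequentially"
  shows "(\<lambda>n. peval (p n) x) \<longlonglongrightarrow> fc f x"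
  using theI' [OF fc_spec [OF x ab f]] uniform_limit_on_subset [OF p rspec_subset [OF x]]
  unfolding fc_def by blast

lemma fc_bern_lim:
  fixes x :: "'a::{real_inner, banach} endo"
  assumes "op_between a b x" "a < b" "continuous_on {a..b} f"
  shows "(\<lambda>n. peval (bern_poly a b f n) x) \<longlonglongrightarrow> fc f x"
  by (intro fc_lim [OF assms] bern_poly_uniform_limit assms)

locale op_interval =
  fixes a b :: real and x :: "'a::{real_inner, banach} endo"
  assumes lt: "a < b" and between: "op_between a b x"
begin

lemma selfadj: "selfadj x"
  using between by (rule op_between_selfadj)

lemma fc_poly [simp]: "fc (poly p) x = peval p x"
proof -
  have "(\<lambda>n. peval p x) \<longlonglongrightarrow> fc (poly p) x"
    by (intro fc_lim [OF between lt] continuous_intros) (auto intro: uniform_limitI)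
  then show ?thesis by (simp add: LIMSEQ_const_iff)
qed

lemma fc_cong: "(\<And>r. r \<in> {a..b} \<Longrightarrow> f r = g r) \<Longrightarrow> fc f x = fc g x"
proof -
  assume "\<And>r. r \<in> {a..b} \<Longrightarrow> f r = g r"
  then have "uniform_limit (rspec x) h f sequentially \<longleftrightarrow> uniform_limit (rspec x) h g sequentially" for h
    using rspec_subset [OF between] by (intro uniform_limit_cong') auto
  then show ?thesis by (simp add: fc_def)
qed

lemma fc_const [simp]: "fc (\<lambda>r. c) x = c *\<^sub>R 1"
proof -
  have "(\<lambda>r. c) = poly [:c:]" by auto
  then show ?thesis using fc_poly [of "[:c:]"] by simp
qed

lemma fc_id [simp]: "fc (\<lambda>r. r) x = x"
proof -
  have "(\<lambda>r::real. r) = poly [:0, 1:]" by auto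
  then show ?thesis using fc_poly [of "[:0, 1:]"] by simp
qed

lemma fc_add:
  assumes "continuous_on {a..b} f" "continuous_on {a..b} g"
  shows "fc (\<lambda>r. f r + g r) x = fc f x + fc g x"
proof (rule LIMSEQ_unique)
  show "(\<lambda>n. peval (bern_poly a b f n + bern_poly a b g n) x) \<longlonglongrightarrow> fc f x + fc g x"
    unfolding peval_add by (intro tendsto_add fc_bern_lim between lt assms)
  show "(\<lambda>n. peval (bern_poly a b f n + bern_poly a b g n) x) \<longlonglongrightarrow> fc (\<lambda>r. f r + g r) x"
    by (intro fc_lim [OF between lt] continuous_intros assms)
      (simp only: poly_add_fun, intro uniform_limit_add bern_poly_uniform_limit lt assms)
qed

lemma fc_mult:
  assumes f: "continuous_on {a..b} f" and g: "continuous_on {a..b} g"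
  shows "fc (\<lambda>r. f r * g r) x = fc f x * fc g x"
proof (rule LIMSEQ_unique)
  show "(\<lambda>n. peval (bern_poly a b f n * bern_poly a b g n) x) \<longlonglongrightarrow> fc f x * fc g x"
    unfolding peval_mult by (intro tendsto_mult fc_bern_lim between lt assms)
  have "bounded (f ` {a..b})" "bounded (g ` {a..b})"
    using f g by (auto intro!: compact_imp_bounded compact_continuous_image)
  then show "(\<lambda>n. peval (bern_poly a b f n * bern_poly a b g n) x) \<longlonglongrightarrow> fc (\<lambda>r. f r * g r) x"
    by (intro fc_lim [OF between lt] continuous_intros assms)
      (simp only: poly_mult_fun, intro bounded_bilinear.bounded_uniform_limit [OF bounded_bilinear_mult]
        bern_poly_uniform_limit lt assms)
qed

lemma fc_scale:
  assumes "continuous_on {a..b} f"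
  shows "fc (\<lambda>r. c * f r) x = c *\<^sub>R fc f x"
  using fc_mult [of "\<lambda>r. c" f] assms by (simp add: continuous_on_const)

lemma fc_diff:
  assumes "continuous_on {a..b} f" "continuous_on {a..b} g"
  shows "fc (\<lambda>r. f r - g r) x = fc f x - fc g x"
  using fc_add [of f "\<lambda>r. (- 1) * g r"] fc_scale [of g "- 1"] assms
  by (simp add: continuous_on_minus)

lemma fc_selfadj:
  assumes "continuous_on {a..b} f"
  shows "selfadj (fc f x)"
  by (rule adjoint_pair_lim [OF fc_bern_lim [OF between lt assms] fc_bern_lim [OF between lt assms]]) (intro selfadj_peval selfadj)

text \<open>Positivity is seen from a self-adjoint square root. The factorization itself is used
  again for the coupling weights.\<close>

lemma fc_nonneg:
  assumes "continuous_on {a..b} f" "\<And>r. r \<in> {a..b} \<Longrightarrow> 0 \<le> f r"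
  shows "fc f x = fc (\<lambda>r. sqrt (f r)) x * fc (\<lambda>r. sqrt (f r)) x"
    and "0 \<le> inner (ap (fc f x) v) v"
proof -
  have c: "continuous_on {a..b} (\<lambda>r. sqrt (f r))" by (intro continuous_intros assms)
  show *: "fc f x = fc (\<lambda>r. sqrt (f r)) x * fc (\<lambda>r. sqrt (f r)) x"
    using assms(2) by (subst fc_mult [OF c c, symmetric]) (intro fc_cong, simp)
  have "inner (ap (fc f x) v) v = inner (ap (fc (\<lambda>r. sqrt (f r)) x) v) (ap (fc (\<lambda>r. sqrt (f r)) x) v)"
    unfolding * ap_mult using fc_selfadj [OF c] unfolding adjoint_pair_def by blast
  then show "0 \<le> inner (ap (fc f x) v) v" by simp
qed

lemma fc_between:
  assumes f: "continuous_on {a..b} f" and "\<And>r. r \<in> {a..b} \<Longrightarrow> c \<le> f r \<and> f r \<le> d"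
  shows "op_between c d (fc f x)"
  unfolding op_between_def
proof (intro conjI allI)
  show "selfadj (fc f x)" by (rule fc_selfadj [OF f])
  fix v
  have "0 \<le> inner (ap (fc (\<lambda>r. f r - c) x) v) v" "0 \<le> inner (ap (fc (\<lambda>r. d - f r) x) v) v"
    using assms by (auto intro!: fc_nonneg continuous_intros)
  moreover have "fc (\<lambda>r. f r - c) x = fc f x - c *\<^sub>R 1" "fc (\<lambda>r. d - f r) x = d *\<^sub>R 1 - fc f x"
    using f by (simp_all add: fc_diff continuous_on_const)
  ultimately show "c * (norm v)\<^sup>2 \<le> inner (ap (fc f x) v) v" "inner (ap (fc f x) v) v \<le> d * (norm v)\<^sup>2"
    by (auto simp: ap_simps inner_diff_left power2_norm_eq_inner)
qed

lemma fc_norm: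
  assumes "continuous_on {a..b} f" "\<And>r. r \<in> {a..b} \<Longrightarrow> \<bar>f r\<bar> \<le> c"
  shows "norm (fc f x) \<le> c"
proof (rule norm_le_of_op_between)
  show "op_between (- c) c (fc f x)" using assms by (intro fc_between) (auto simp: abs_le_iff minus_le_iff)
  show "0 \<le> c" using assms(2) [of a] lt by auto
qed

text \<open>Applied to affine and constant \<open>q\<close>: the logarithms of \<open>x / 2\<close>,
  of \<open>(x + 1) / 2\<close> and of \<open>1\<close> become functions of
  \<open>x\<close>.\<close>

lemma fc_pcompose:
  assumes y: "op_between c d (peval q x)" and cd: "c < d" and f: "continuous_on {c..d} f"
    and q: "\<And>r. r \<in> {a..b} \<Longrightarrow> poly q r \<in> {c..d}"
  shows "fc f (peval q x) = fc (\<lambda>r. f (poly q r)) x"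
proof (rule LIMSEQ_unique)
  show "(\<lambda>n. peval (bern_poly c d f n) (peval q x)) \<longlonglongrightarrow> fc f (peval q x)"
    by (intro fc_bern_lim y cd f)
  have "uniform_limit {a..b} (\<lambda>n r. poly (bern_poly c d f n) (poly q r)) (\<lambda>r. f (poly q r)) sequentially"
    using bern_poly_uniform_limit [OF cd f] q
    unfolding uniform_limit_iff by (auto elim!: eventually_mono)
  then have "uniform_limit {a..b} (\<lambda>n. poly (pcompose (bern_poly c d f n) q)) (\<lambda>r. f (poly q r)) sequentially"
    by (simp only: poly_pcompose_fun)
  then have "(\<lambda>n. peval (pcompose (bern_poly c d f n) q) x) \<longlonglongrightarrow> fc (\<lambda>r. f (poly q r)) x"
    using q by (intro fc_lim [OF between lt] continuous_on_compose2 [OF f] continuous_intros) auto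
  then show "(\<lambda>n. peval (bern_poly c d f n) (peval q x)) \<longlonglongrightarrow> fc (\<lambda>r. f (poly q r)) x"
    by (simp only: peval_pcompose)
qed

end

section \<open>Tracial algebras\<close>

text \<open>Junk unless \<open>x\<close> has an adjoint; the elements of a tracial algebra have one by assumption.\<close>

definition star :: "'a::real_inner endo \<Rightarrow> 'a endo"
  where "star x = (THE y. adjoint_pair x y)"

lemma star_eq: "adjoint_pair x y \<Longrightarrow> star x = y"
  unfolding star_def using adjoint_pair_unique by blast

lemma norm_adjoint_pair_le:
  assumes "adjoint_pair x y"
  shows "norm y \<le> norm x"
proof (rule norm_endo_bound)
  fix v
  have "(norm (ap y v))\<^sup>2 = inner (ap x (ap y v)) v"
    using assms by (simp add: adjoint_pair_def power2_norm_eq_inner)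
  also have "\<dots> \<le> norm (ap x (ap y v)) * norm v" by (rule norm_cauchy_schwarz)
  also have "\<dots> \<le> norm x * norm (ap y v) * norm v" by (intro mult_right_mono norm_ap) auto
  finally show "norm (ap y v) \<le> norm x * norm v"
    by (cases "ap y v = 0") (auto simp: power2_eq_square mult_ac)
qed auto

text \<open>The complex structure is dropped: scalars are real and \<open>t\<close> plays the role
  of the real part of the trace. Norm limits are required to stay in \<open>N\<close> only when
  self-adjoint, since membership in \<open>N\<close> asks for an adjoint and such a limit is its
  own.\<close>

locale tracial_algebra =
  fixes N :: "'h::{real_inner, banach} endo set" and t :: "'h endo \<Rightarrow> real"
  assumes one_N [simp]: "1 \<in> N"
    and add_N [simp]: "x \<in> N \<Longrightarrow> y \<in> N \<Longrightarrow> x + y \<in> N"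
    and scaleR_N [simp]: "x \<in> N \<Longrightarrow> c *\<^sub>R x \<in> N"
    and mult_N [simp]: "x \<in> N \<Longrightarrow> y \<in> N \<Longrightarrow> x * y \<in> N"
    and lim_N: "(\<And>n. X n \<in> N) \<Longrightarrow> X \<longlonglongrightarrow> x \<Longrightarrow> selfadj x \<Longrightarrow> x \<in> N"
    and adj_N: "x \<in> N \<Longrightarrow> \<exists>y\<in>N. adjoint_pair x y"
    and t_add: "x \<in> N \<Longrightarrow> y \<in> N \<Longrightarrow> t (x + y) = t x + t y"
    and t_scaleR: "x \<in> N \<Longrightarrow> t (c *\<^sub>R x) = c * t x"
    and t_comm: "x \<in> N \<Longrightarrow> y \<in> N \<Longrightarrow> t (x * y) = t (y * x)"
    and t_one: "t 1 = 1"
    and t_nonneg: "x \<in> N \<Longrightarrow> selfadj x \<Longrightarrow> (\<And>v. 0 \<le> inner (ap x v) v) \<Longrightarrow> 0 \<le> t x"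
    and t_adj: "x \<in> N \<Longrightarrow> y \<in> N \<Longrightarrow> adjoint_pair x y \<Longrightarrow> t x = t y"
    and t_faithful: "x \<in> N \<Longrightarrow> selfadj x \<Longrightarrow> (\<And>v. 0 \<le> inner (ap x v) v) \<Longrightarrow> t x = 0 \<Longrightarrow> x = 0"
begin

lemma zero_N [simp]: "0 \<in> N"
  using scaleR_N [OF one_N, of 0] by simp

lemma minus_N [simp]: "x \<in> N \<Longrightarrow> - x \<in> N"
  using scaleR_N [of x "- 1"] by simp

lemma diff_N [simp]: "x \<in> N \<Longrightarrow> y \<in> N \<Longrightarrow> x - y \<in> N"
  using add_N [of x "- y"] by simp

lemma sum_N [simp]: "(\<And>i. i \<in> I \<Longrightarrow> f i \<in> N) \<Longrightarrow> sum f I \<in> N"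
  by (induction I rule: infinite_finite_induct) auto

lemma power_N [simp]: "x \<in> N \<Longrightarrow> x ^ n \<in> N"
  by (induction n) auto

lemma peval_N [simp]: "x \<in> N \<Longrightarrow> peval p x \<in> N"
  by (induction p) auto

lemma fc_N:
  assumes "op_between a b x" "a < b" "continuous_on {a..b} f" "x \<in> N"
  shows "fc f x \<in> N"
proof (rule lim_N [OF _ fc_bern_lim])
  interpret op_interval a b x using assms by unfold_locales
  show "selfadj (fc f x)" using assms by (intro fc_selfadj)
qed (use assms in auto)

lemma t_zero [simp]: "t 0 = 0"
  using t_scaleR [OF one_N, of 0] by simp

lemma t_minus: "x \<in> N \<Longrightarrow> t (- x) = - t x"
  using t_scaleR [of x "- 1"] by simp

lemma t_diff: "x \<in> N \<Longrightarrow> y \<in> N \<Longrightarrow> t (x - y) = t x - t y"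
  using t_add [of x "- y"] by (simp add: t_minus)

lemma t_sum: "(\<And>i. i \<in> I \<Longrightarrow> f i \<in> N) \<Longrightarrow> t (sum f I) = (\<Sum>i\<in>I. t (f i))"
  by (induction I rule: infinite_finite_induct) (auto simp: t_add)

lemma star_pair: "x \<in> N \<Longrightarrow> adjoint_pair x (star x)"
  using adj_N star_eq by metis

lemma star_N [simp]: "x \<in> N \<Longrightarrow> star x \<in> N"
  using adj_N star_eq by metis

lemma star_add: "x \<in> N \<Longrightarrow> y \<in> N \<Longrightarrow> star (x + y) = star x + star y"
  by (intro star_eq adjoint_pair_add star_pair)

lemma star_scaleR: "x \<in> N \<Longrightarrow> star (c *\<^sub>R x) = c *\<^sub>R star x"
  by (intro star_eq adjoint_pair_mult adjoint_pair_scaleR star_pair)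

lemma star_mult: "x \<in> N \<Longrightarrow> y \<in> N \<Longrightarrow> star (x * y) = star y * star x"
  by (intro star_eq adjoint_pair_mult adjoint_pair_scaleR star_pair)

lemma star_star: "x \<in> N \<Longrightarrow> star (star x) = x"
  by (intro star_eq adjoint_pair_commute [OF star_pair])

lemma t_star: "x \<in> N \<Longrightarrow> t (star x) = t x"
  using t_adj [OF _ star_N star_pair] by simp

lemma inner_star_mult: "x \<in> N \<Longrightarrow> inner (ap (star x * y) u) v = inner (ap y u) (ap x v)"
  using star_pair [THEN adjoint_pair_commute] by (simp add: adjoint_pair_def)

lemma selfadj_star_mult: "x \<in> N \<Longrightarrow> selfadj (star x * x)"
  by (intro adjoint_pair_mult star_pair adjoint_pair_commute [OF star_pair])

section \<open>The \<open>2\<close>-norm and the Cauchy-Schwarz inequality\<close>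

definition n2 :: "'h endo \<Rightarrow> real"
  where "n2 x = sqrt (t (star x * x))"

lemma t_star_mult_nonneg: "x \<in> N \<Longrightarrow> 0 \<le> t (star x * x)"
  by (rule t_nonneg) (simp_all add: selfadj_star_mult inner_star_mult del: ap_mult)

lemma n2_nonneg [simp]: "x \<in> N \<Longrightarrow> 0 \<le> n2 x"
  by (simp add: n2_def t_star_mult_nonneg)

lemma n2_square: "x \<in> N \<Longrightarrow> (n2 x)\<^sup>2 = t (star x * x)"
  by (simp add: n2_def t_star_mult_nonneg)

lemma n2_add_scaleR_square:
  assumes "x \<in> N" "y \<in> N"
  shows "(n2 (x + r *\<^sub>R y))\<^sup>2 = (n2 x)\<^sup>2 + 2 * r * t (star x * y) + r\<^sup>2 * (n2 y)\<^sup>2"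
proof -
  have "t (star y * x) = t (star x * y)"
    using t_star [of "star x * y"] assms by (simp add: star_mult star_star)
  moreover have "star (x + r *\<^sub>R y) * (x + r *\<^sub>R y) =
      star x * x + (r *\<^sub>R (star x * y) + (r *\<^sub>R (star y * x) + r\<^sup>2 *\<^sub>R (star y * y)))"
    using assms by (simp add: star_add star_scaleR distrib_left distrib_right scaleR_add_right power2_eq_square)
  ultimately show ?thesis using assms by (simp add: n2_square t_add t_scaleR)
qed

lemma t_cauchy_schwarz:
  assumes "x \<in> N" "y \<in> N"
  shows "\<bar>t (star x * y)\<bar> \<le> n2 x * n2 y"
proof -
  let ?A = "(n2 y)\<^sup>2" and ?B = "2 * t (star x * y)" and ?C = "(n2 x)\<^sup>2"
  have q: "0 \<le> ?A * r\<^sup>2 + ?B * r + ?C" for r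
  proof -
    have "0 \<le> (n2 (x + r *\<^sub>R y))\<^sup>2" by simp
    then show ?thesis unfolding n2_add_scaleR_square [OF assms] by (simp add: algebra_simps)
  qed
  have "(t (star x * y))\<^sup>2 \<le> (n2 x * n2 y)\<^sup>2"
  proof (cases "?A = 0")
    case True
    have "t (star x * y) = 0"
    proof (rule ccontr)
      assume "t (star x * y) \<noteq> 0"
      \<comment> \<open>Without the quadratic coefficient the form is affine in \<open>r\<close>,
        and this \<open>r\<close> gives it the value \<open>- 1\<close>.\<close>
      then have "?B * (- (?C + 1) / ?B) + ?C = - 1" by simp
      then show False using q [of "- (?C + 1) / ?B"] True by simp
    qed
    then show ?thesis by simp
  next
    case False
    then have A: "?A > 0" by simp
    have "0 \<le> ?A * (- t (star x * y) / ?A)\<^sup>2 + ?B * (- t (star x * y) / ?A) + ?C" by (rule q)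
    also have "\<dots> = ?C - (t (star x * y))\<^sup>2 / ?A" using A by (simp add: field_simps power2_eq_square)
    finally show ?thesis using A by (simp add: field_simps power_mult_distrib)
  qed
  then show ?thesis using assms by (metis abs_le_square_iff abs_of_nonneg mult_nonneg_nonneg n2_nonneg)
qed

lemma n2_triangle:
  assumes "x \<in> N" "y \<in> N"
  shows "n2 (x + y) \<le> n2 x + n2 y"
proof (rule power2_le_imp_le)
  show "(n2 (x + y))\<^sup>2 \<le> (n2 x + n2 y)\<^sup>2"
    using n2_add_scaleR_square [OF assms, of 1] t_cauchy_schwarz [OF assms]
    by (simp add: power2_sum)
qed (use assms in simp)

text \<open>The operator \<open>c\<^sup>2 *\<^sub>R (star y * y) - star x * x\<close> has a
  nonnegative quadratic form, hence a nonnegative trace. This is the source of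
  \<open>n2 (x * y) \<le> norm x * n2 y\<close>, which lets all factors but one be measured in
  operator norm.\<close>

lemma n2_le_of_norm_le:
  assumes "x \<in> N" "y \<in> N" "0 \<le> c" "\<And>v. norm (ap x v) \<le> c * norm (ap y v)"
  shows "n2 x \<le> c * n2 y"
proof (rule power2_le_imp_le)
  let ?z = "c\<^sup>2 *\<^sub>R (star y * y) - star x * x"
  have "0 \<le> t ?z"
  proof (rule t_nonneg)
    show "selfadj ?z" using assms by (intro adjoint_pair_diff adjoint_pair_scaleR selfadj_star_mult)
    fix v
    have "(norm (ap x v))\<^sup>2 \<le> (c * norm (ap y v))\<^sup>2" using assms by (intro power_mono) auto
    then show "0 \<le> inner (ap ?z v) v"
      using assms by (simp add: ap_simps inner_diff_left inner_star_mult power2_norm_eq_inner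
          power_mult_distrib del: ap_mult)
  qed (use assms in simp)
  then show "(n2 x)\<^sup>2 \<le> (c * n2 y)\<^sup>2"
    using assms by (simp add: n2_square t_diff t_scaleR power_mult_distrib)
qed (use assms in simp)

lemma n2_mult_left:
  assumes "x \<in> N" "y \<in> N"
  shows "n2 (x * y) \<le> norm x * n2 y"
  using assms by (intro n2_le_of_norm_le) (auto intro: norm_ap)

lemma n2_star: "x \<in> N \<Longrightarrow> n2 (star x) = n2 x"
  by (simp add: n2_def star_star t_comm)

lemma n2_mult_right:
  assumes "x \<in> N" "y \<in> N"
  shows "n2 (x * y) \<le> n2 x * norm y"
proof -
  have "n2 (x * y) = n2 (star y * star x)" using n2_star [of "x * y"] assms by (simp add: star_mult)
  also have "\<dots> \<le> norm (star y) * n2 (star x)" using assms by (intro n2_mult_left) auto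
  also have "\<dots> \<le> norm y * n2 x" using assms
    by (auto simp: n2_star intro!: mult_right_mono norm_adjoint_pair_le star_pair)
  finally show ?thesis by (simp add: mult.commute)
qed

lemma n2_one: "n2 1 = 1"
  by (simp add: n2_def star_eq [OF adjoint_pair_1] t_one)

lemma t_le_n2: "x \<in> N \<Longrightarrow> \<bar>t x\<bar> \<le> n2 x"
  using t_cauchy_schwarz [of 1 x] by (simp add: star_eq [OF adjoint_pair_1] n2_one)

lemma t_le_norm: "x \<in> N \<Longrightarrow> \<bar>t x\<bar> \<le> norm x"
  using t_le_n2 [of x] n2_mult_left [of x 1] by (simp add: n2_one)

lemma n2_eq_0:
  assumes "x \<in> N" "t (star x * x) = 0"
  shows "x = 0"
proof (rule endo_eqI)
  fix v
  have "star x * x = 0" using assms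
    by (intro t_faithful) (simp_all add: selfadj_star_mult inner_star_mult del: ap_mult)
  then have "inner (ap x v) (ap x v) = 0" using inner_star_mult [OF assms(1), of x v v] by (simp add: ap_simps)
  then show "ap x v = ap 0 v" by (simp add: ap_simps)
qed

lemma t_tendsto:
  assumes "\<And>n. X n \<in> N" "x \<in> N" "X \<longlonglongrightarrow> x"
  shows "(\<lambda>n. t (X n)) \<longlonglongrightarrow> t x"
proof -
  have "(\<lambda>n. t (X n) - t x) \<longlonglongrightarrow> 0"
  proof (rule Lim_null_comparison)
    show "\<forall>\<^sub>F n in sequentially. norm (t (X n) - t x) \<le> norm (X n - x)"
      using t_le_norm [of "X _ - x"] assms by (auto simp: t_diff)
    show "(\<lambda>n. norm (X n - x)) \<longlonglongrightarrow> 0" using assms by (simp add: LIM_zero tendsto_norm_zero)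
  qed
  then show ?thesis by (rule LIM_zero_cancel)
qed

end

section \<open>Couplings of two spectral distributions\<close>

locale op_pair = tracial_algebra N t
  for N :: "'h::{real_inner, banach} endo set" and t +
  fixes a b :: real and x y :: "'h endo"
  assumes lt: "a < b" and x: "op_between a b x" "x \<in> N" and y: "op_between a b y" "y \<in> N"
begin

sublocale X: op_interval a b x
  using lt x by unfold_locales

sublocale Y: op_interval a b y
  using lt y by unfold_locales

text \<open>Bernstein polynomials turn the (in general non-commuting) pair \<open>x, y\<close> into a sequence of
  couplings on \<open>[a, b] \<times> [a, b]\<close> whose weights are nonnegative, since the trace of a product of two
  positive elements is nonnegative.\<close>

definition weight :: "nat \<Rightarrow> nat \<Rightarrow> nat \<Rightarrow> real"
  where "weight n k l = t (peval (bern_basis a b n k) x * peval (bern_basis a b n l) y)"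

text \<open>A relation, so that convergence is carried along with the value and no limit measure has
  to be constructed.\<close>

definition has_expect :: "(real \<Rightarrow> real \<Rightarrow> real) \<Rightarrow> real \<Rightarrow> bool"
  where "has_expect F c \<longleftrightarrow>
    (\<lambda>n. \<Sum>k\<le>n. \<Sum>l\<le>n. F (bern_node a b n k) (bern_node a b n l) * weight n k l) \<longlonglongrightarrow> c"

text \<open>With square roots \<open>S\<close> and \<open>T\<close> of the two basis values,
  cyclicity turns the weight into the trace of \<open>star (T * S) * (T * S)\<close>.\<close>

lemma weight_nonneg: "0 \<le> weight n k l"
proof -
  let ?p = "poly (bern_basis a b n k)" and ?q = "poly (bern_basis a b n l)"
  let ?S = "fc (\<lambda>r. sqrt (?p r)) x" and ?T = "fc (\<lambda>r. sqrt (?q r)) y"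
  have c: "continuous_on {a..b} (\<lambda>r. sqrt (?p r))" "continuous_on {a..b} (\<lambda>r. sqrt (?q r))"
    by (intro continuous_intros)+
  have S: "peval (bern_basis a b n k) x = ?S * ?S" "peval (bern_basis a b n l) y = ?T * ?T"
    using X.fc_nonneg(1) [of ?p] Y.fc_nonneg(1) [of ?q] bern_basis_nonneg [OF lt]
    by (simp_all only: X.fc_poly Y.fc_poly) (simp_all add: continuous_intros)
  have N: "?S \<in> N" "?T \<in> N" using fc_N x y c lt by blast+
  have "star (?T * ?S) = ?S * ?T"
    using X.fc_selfadj [OF c(1)] Y.fc_selfadj [OF c(2)] by (intro star_eq adjoint_pair_mult)
  then have "0 \<le> t (?S * ?T * (?T * ?S))" using t_star_mult_nonneg [of "?T * ?S"] N by simp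
  also have "\<dots> = weight n k l"
    unfolding weight_def S using t_comm [of "?S * (?T * ?T)" ?S] N by (simp add: mult.assoc)
  finally show ?thesis .
qed

text \<open>A Bernstein polynomial is linear in the values of the function at the nodes, so the
  trace of the product of the two approximants is exactly the double sum.\<close>

lemma has_expect_prod:
  assumes f: "continuous_on {a..b} f" and g: "continuous_on {a..b} g"
  shows "has_expect (\<lambda>u v. f u * g v) (t (fc f x * fc g y))"
proof -
  have "(\<lambda>n. t (peval (bern_poly a b f n) x * peval (bern_poly a b g n) y)) \<longlonglongrightarrow> t (fc f x * fc g y)"
    using x y f g lt
    by (intro t_tendsto tendsto_mult fc_bern_lim) (auto intro!: mult_N fc_N [of a b])
  moreover have "t (peval (bern_poly a b f n) x * peval (bern_poly a b g n) y)
    = (\<Sum>k\<le>n. \<Sum>l\<le>n. f (bern_node a b n k) * g (bern_node a b n l) * weight n k l)" for n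
  proof -
    have "peval (bern_poly a b f n) x * peval (bern_poly a b g n) y
      = (\<Sum>k\<le>n. \<Sum>l\<le>n. (f (bern_node a b n k) * g (bern_node a b n l)) *\<^sub>R
          (peval (bern_basis a b n k) x * peval (bern_basis a b n l) y))"
      unfolding bern_poly_def peval_sum peval_smult sum_product
      by (intro sum.cong refl) simp
    then show ?thesis using x y by (simp add: t_sum t_scaleR weight_def)
  qed
  ultimately show ?thesis unfolding has_expect_def by simp
qed

lemma has_expect_left: "continuous_on {a..b} f \<Longrightarrow> has_expect (\<lambda>u v. f u) (t (fc f x))"
  using has_expect_prod [of f "\<lambda>v. 1"] by simp

lemma has_expect_right: "continuous_on {a..b} g \<Longrightarrow> has_expect (\<lambda>u v. g v) (t (fc g y))"
  using has_expect_prod [of "\<lambda>u. 1" g] by simp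

lemma has_expect_const: "has_expect (\<lambda>u v. c) c"
  using has_expect_left [of "\<lambda>u. c"] by (simp add: t_scaleR t_one)

lemma has_expect_add:
  assumes "has_expect F c" "has_expect G d"
  shows "has_expect (\<lambda>u v. F u v + G u v) (c + d)"
  using tendsto_add [OF assms [unfolded has_expect_def]]
  by (simp add: has_expect_def distrib_right sum.distrib)

lemma has_expect_diff:
  assumes "has_expect F c" "has_expect G d"
  shows "has_expect (\<lambda>u v. F u v - G u v) (c - d)"
  using tendsto_diff [OF assms [unfolded has_expect_def]]
  by (simp add: has_expect_def left_diff_distrib sum_subtractf)

lemma has_expect_scale: "has_expect F c \<Longrightarrow> has_expect (\<lambda>u v. r * F u v) (r * c)"
  unfolding has_expect_def
  using tendsto_mult_left [of _ c sequentially r] by (force simp: sum_distrib_left mult.assoc)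

lemma has_expect_sum:
  "(\<And>i. i \<in> I \<Longrightarrow> has_expect (F i) (c i)) \<Longrightarrow> has_expect (\<lambda>u v. \<Sum>i\<in>I. F i u v) (\<Sum>i\<in>I. c i)"
proof (induction I rule: infinite_finite_induct)
  case (insert i I)
  then show ?case by (auto intro!: has_expect_add)
qed (use has_expect_const [of 0] in auto)

text \<open>The bridge from scalars to traces: all nodes lie in \<open>{a..b}\<close> and all
  weights are nonnegative, so a pointwise inequality passes to the approximating sums.\<close>

lemma has_expect_mono:
  assumes "has_expect F c" "has_expect G d"
    and "\<And>u v. u \<in> {a..b} \<Longrightarrow> v \<in> {a..b} \<Longrightarrow> F u v \<le> G u v"
  shows "c \<le> d"
proof (rule LIMSEQ_le)
  show "(\<lambda>n. \<Sum>k\<le>n. \<Sum>l\<le>n. F (bern_node a b n k) (bern_node a b n l) * weight n k l) \<longlonglongrightarrow> c"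
    and "(\<lambda>n. \<Sum>k\<le>n. \<Sum>l\<le>n. G (bern_node a b n k) (bern_node a b n l) * weight n k l) \<longlonglongrightarrow> d"
    using assms by (simp_all add: has_expect_def)
  show "\<exists>N. \<forall>n\<ge>N. (\<Sum>k\<le>n. \<Sum>l\<le>n. F (bern_node a b n k) (bern_node a b n l) * weight n k l)
    \<le> (\<Sum>k\<le>n. \<Sum>l\<le>n. G (bern_node a b n k) (bern_node a b n l) * weight n k l)"
    using assms(3) bern_node_in [OF lt] weight_nonneg by (auto intro!: sum_mono mult_right_mono)
qed

end

section \<open>The trace of the logarithm\<close>

lemma ln_le_tangent_minus_square:
  fixes u v c :: real
  assumes "0 < u" "0 < v" "u \<le> c" "v \<le> c"
  shows "ln v \<le> ln u + inverse u * v - 1 - 1 / (2 * c\<^sup>2) * (u - v)\<^sup>2"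
proof -
  \<comment> \<open>Up to a constant, \<open>h\<close> is the gap between the tangent at
    \<open>u\<close> and \<open>ln\<close>, less the square. On \<open>0 < w \<le> c\<close> its
    derivative has the sign of \<open>w - u\<close>, because \<open>u * w \<le> c\<^sup>2\<close>;
    so \<open>u\<close> is a minimum.\<close>
  define h where "h w = w / u - ln w - (u - w)\<^sup>2 / (2 * c\<^sup>2)" for w
  define h' where "h' w = (w - u) * (1 / (u * w) - 1 / c\<^sup>2)" for w
  have c: "0 < c" using assms by simp
  have d: "(h has_real_derivative h' w) (at w)" if "0 < w" for w
  proof -
    have "(h has_real_derivative (1 / u - 1 / w - 2 * (u - w) * (- 1) / (2 * c\<^sup>2))) (at w)"
      unfolding h_def using that c assms
      by (auto intro!: derivative_eq_intros simp: field_simps)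
    moreover have "1 / u - 1 / w - 2 * (u - w) * (- 1) / (2 * c\<^sup>2) = h' w"
      using that c assms by (simp add: h'_def field_simps)
    ultimately show ?thesis by simp
  qed
  have pos: "0 \<le> 1 / (u * w) - 1 / c\<^sup>2" if "0 < w" "w \<le> c" for w
  proof -
    have "u * w \<le> c * c" using that assms by (intro mult_mono) auto
    then have "1 / (c * c) \<le> 1 / (u * w)" using that assms by (intro divide_left_mono) auto
    then show ?thesis by (simp add: power2_eq_square)
  qed
  have "h u \<le> h v"
  proof (cases "u \<le> v")
    case True
    then show ?thesis
    proof (rule DERIV_nonneg_imp_nondecreasing)
      fix w assume w: "u \<le> w" "w \<le> v"
      then have "0 \<le> h' w" unfolding h'_def using assms by (intro mult_nonneg_nonneg pos) auto
      then show "\<exists>d. (h has_real_derivative d) (at w) \<and> 0 \<le> d" using d [of w] w assms by auto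
    qed
  next
    case False
    then have "v \<le> u" by simp
    then show ?thesis
    proof (rule DERIV_nonpos_imp_nonincreasing)
      fix w assume w: "v \<le> w" "w \<le> u"
      then have "h' w \<le> 0" unfolding h'_def using assms by (intro mult_nonpos_nonneg pos) auto
      then show "\<exists>d. (h has_real_derivative d) (at w) \<and> d \<le> 0" using d [of w] w assms by auto
    qed
  qed
  then show ?thesis using assms by (simp add: h_def field_simps)
qed

text \<open>A step of length \<open>1 / n\<close> changes \<open>f\<close> by at most
  \<open>c / n\<^sup>2\<close>, so \<open>n\<close> steps change it by at most \<open>c / n\<close>.
  This stands in for the vanishing of a derivative.\<close>

lemma const_of_quadratic_variation:
  fixes f :: "real \<Rightarrow> real"
  assumes f: "\<And>r q. r \<in> {0..1} \<Longrightarrow> q \<in> {0..1} \<Longrightarrow> \<bar>f r - f q\<bar> \<le> c * (r - q)\<^sup>2"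
  shows "f 1 = f 0"
proof -
  have b: "\<bar>f 1 - f 0\<bar> \<le> c * inverse (real (Suc n))" for n
  proof -
    let ?n = "real (Suc n)"
    have "\<bar>f (k / ?n) - f 0\<bar> \<le> k * (c / ?n\<^sup>2)" if "k \<le> Suc n" for k
      using that
    proof (induction k)
      case (Suc k)
      have "\<bar>f (Suc k / ?n) - f (k / ?n)\<bar> \<le> c * (Suc k / ?n - k / ?n)\<^sup>2"
        using Suc.prems by (intro f) (auto simp: divide_le_eq_1)
      also have "Suc k / ?n - k / ?n = 1 / ?n" by (simp add: diff_divide_distrib [symmetric])
      finally have "\<bar>f (Suc k / ?n) - f (k / ?n)\<bar> \<le> c / ?n\<^sup>2" by (simp add: power_divide)
      moreover have "Suc k * (c / ?n\<^sup>2) = k * (c / ?n\<^sup>2) + c / ?n\<^sup>2"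
        by (simp add: distrib_right add_divide_distrib)
      ultimately show ?case using Suc by simp
    qed simp
    from this [of "Suc n"] have "\<bar>f 1 - f 0\<bar> \<le> ?n * (c / ?n\<^sup>2)" by simp
    moreover have "m * (c / m\<^sup>2) = c * inverse m" if "m > 0" for m :: real
      using that by (simp add: power2_eq_square field_simps)
    then have "?n * (c / ?n\<^sup>2) = c * inverse ?n" by simp
    ultimately show ?thesis by simp
  qed
  have "(\<lambda>n. c * inverse (real (Suc n))) \<longlonglongrightarrow> c * 0"
    by (intro tendsto_intros LIMSEQ_inverse_real_of_nat)
  then have "\<bar>f 1 - f 0\<bar> \<le> c * 0" by (rule LIMSEQ_le_const) (use b in auto)
  then show ?thesis by simp
qed

lemma (in op_interval) fc_inverse:
  assumes "0 < a"
  shows "x * fc inverse x = 1" "fc inverse x * x = 1" "norm (fc inverse x) \<le> 1 / a"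
proof -
  have c: "continuous_on {a..b} (inverse :: real \<Rightarrow> real)" using assms by (intro continuous_intros) auto
  have "fc (\<lambda>r. r * inverse r) x = x * fc inverse x" "fc (\<lambda>r. inverse r * r) x = fc inverse x * x"
    by (simp_all add: fc_mult c continuous_on_id)
  moreover have "fc (\<lambda>r. r * inverse r) x = fc (\<lambda>r. 1) x" "fc (\<lambda>r. inverse r * r) x = fc (\<lambda>r. 1) x"
    using assms by (intro fc_cong; simp)+
  ultimately show "x * fc inverse x = 1" "fc inverse x * x = 1" by simp_all
  show "norm (fc inverse x) \<le> 1 / a"
    using assms by (intro fc_norm c) (auto simp: field_simps)
qed

text \<open>The lower bound rests on \<open>norm v \<le> c * norm (ap s v)\<close>, obtained from
  the left inverse of \<open>s\<close>. The positive number \<open>c\<close> replaces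
  \<open>norm s'\<close>, which is \<open>0\<close> on the zero space.\<close>

lemma op_between_congruence:
  assumes x: "op_between a b x" and a: "0 < a" and b: "0 \<le> b" and s: "selfadj s" and ss: "s' * s = 1"
    and c: "norm s' \<le> c" "0 < c"
  shows "op_between (a / c\<^sup>2) (b * (norm s)\<^sup>2) (s * x * s)"
  unfolding op_between_def
proof (intro conjI allI)
  have "selfadj (s * (x * s))"
    using adjoint_pair_mult [OF s adjoint_pair_mult [OF op_between_selfadj [OF x] s]]
    by (simp add: mult.assoc)
  then show "selfadj (s * x * s)" by (simp add: mult.assoc)
  fix v
  have e: "inner (ap (s * x * s) v) v = inner (ap x (ap s v)) (ap s v)"
    using s by (simp add: adjoint_pair_def)
  have "norm v \<le> norm s' * norm (ap s v)" using norm_ap [of s' "ap s v"] ss by (metis ap_mult ap_one)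
  also have "\<dots> \<le> c * norm (ap s v)" using c by (intro mult_right_mono) auto
  finally have "(norm v)\<^sup>2 \<le> (c * norm (ap s v))\<^sup>2" by (intro power_mono) auto
  then have "a * (norm v)\<^sup>2 \<le> a * (c\<^sup>2 * (norm (ap s v))\<^sup>2)"
    using a by (simp add: power_mult_distrib)
  then have "a / c\<^sup>2 * (norm v)\<^sup>2 \<le> a * (norm (ap s v))\<^sup>2"
    using c by (simp add: field_simps)
  also have "\<dots> \<le> inner (ap (s * x * s) v) v" unfolding e using x by (simp add: op_between_def)
  finally show "a / c\<^sup>2 * (norm v)\<^sup>2 \<le> inner (ap (s * x * s) v) v" .
  have "(norm (ap s v))\<^sup>2 \<le> (norm s * norm v)\<^sup>2" by (intro power_mono norm_ap) auto
  then have "b * (norm (ap s v))\<^sup>2 \<le> b * (norm s)\<^sup>2 * (norm v)\<^sup>2"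
    using b by (simp add: power_mult_distrib mult_left_mono mult.assoc)
  moreover have "inner (ap (s * x * s) v) v \<le> b * (norm (ap s v))\<^sup>2"
    unfolding e using x by (simp add: op_between_def)
  ultimately show "inner (ap (s * x * s) v) v \<le> b * (norm s)\<^sup>2 * (norm v)\<^sup>2" by simp
qed

lemma op_between_convex:
  assumes "op_between a b x" "op_between a b y" "0 \<le> r" "r \<le> 1"
  shows "op_between a b (x + r *\<^sub>R (y - x))"
proof -
  have "op_between ((1 - r) * a + r * a) ((1 - r) * b + r * b) ((1 - r) *\<^sub>R x + r *\<^sub>R y)"
    using assms by (intro op_between_add op_between_scaleR) auto
  moreover have "(1 - r) *\<^sub>R x + r *\<^sub>R y = x + r *\<^sub>R (y - x)" by (simp add: algebra_simps)
  moreover have "(1 - r) * a + r * a = a" "(1 - r) * b + r * b = b" by (simp_all add: algebra_simps)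
  ultimately show ?thesis by simp
qed

lemma midpoint_eq: "(1 / 2) *\<^sub>R (x + y) = x + (1 / 2) *\<^sub>R (y - (x :: 'a::real_vector))"
proof -
  have "(1 / 2) *\<^sub>R x + (1 / 2) *\<^sub>R x = x" by (simp flip: scaleR_add_left)
  then show ?thesis by (simp add: scaleR_add_right scaleR_diff_right algebra_simps)
qed

lemma op_between_midpoint:
  "op_between a b x \<Longrightarrow> op_between a b y \<Longrightarrow> op_between a b ((1 / 2) *\<^sub>R (x + y))"
  unfolding midpoint_eq by (rule op_between_convex) auto

section \<open>Strict concavity and congruence\<close>

context tracial_algebra
begin

text \<open>The logarithm of the Fuglede-Kadison determinant.\<close>

definition L :: "'h endo \<Rightarrow> real"
  where "L x = t (fc ln x)"

text \<open>For matrices this is, up to normalization, the S-divergence, also known as the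
  Jensen-Bregman log-determinant divergence.\<close>

definition D :: "'h endo \<Rightarrow> 'h endo \<Rightarrow> real"
  where "D x y = L ((1 / 2) *\<^sub>R (x + y)) - 1 / 2 * L x - 1 / 2 * L y"

lemma L_le_tangent_minus_square:
  assumes ab: "0 < a" "a < b" and x: "op_between a b x" "x \<in> N" and y: "op_between a b y" "y \<in> N"
    and z: "z * x = 1"
  shows "L y \<le> L x + t (z * (y - x)) - 1 / (2 * b\<^sup>2) * t ((x - y) * (x - y))"
proof -
  interpret op_pair N t a b x y using assms by unfold_locales
  have cln: "continuous_on {a..b} ln" "continuous_on {a..b} (inverse :: real \<Rightarrow> real)"
    using ab by (auto intro!: continuous_intros)
  have zx: "fc inverse x = z" using X.fc_inverse [OF ab(1)] z by (metis mult.assoc mult_1 mult.right_neutral)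
  have zN: "z \<in> N" unfolding zx [symmetric] using fc_N x ab cln by blast
  have 1: "has_expect (\<lambda>u v. inverse u * v) (t (z * y))"
    using has_expect_prod [OF cln(2) continuous_on_id] by (simp add: zx)
  have 2: "has_expect (\<lambda>u v. u * u) (t (x * x))" "has_expect (\<lambda>u v. v * v) (t (y * y))"
    using has_expect_left [of "\<lambda>u. u * u"] has_expect_right [of "\<lambda>v. v * v"]
    by (simp_all add: X.fc_mult Y.fc_mult continuous_on_id continuous_on_mult)
  have 3: "has_expect (\<lambda>u v. u * v) (t (x * y))"
    using has_expect_prod [OF continuous_on_id continuous_on_id] by simp
  have 4: "has_expect (\<lambda>u v. ln u) (L x)" "has_expect (\<lambda>u v. ln v) (L y)"
    unfolding L_def using has_expect_left has_expect_right cln by blast+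
  have "L y \<le> L x + t (z * y) - 1 - 1 / (2 * b\<^sup>2) * (t (x * x) - 2 * t (x * y) + t (y * y))"
  proof (rule has_expect_mono)
    show "has_expect (\<lambda>u v. ln v) (L y)" by (rule 4)
    show "has_expect (\<lambda>u v. ln u + inverse u * v - 1 - 1 / (2 * b\<^sup>2) * (u * u - 2 * (u * v) + v * v))
      (L x + t (z * y) - 1 - 1 / (2 * b\<^sup>2) * (t (x * x) - 2 * t (x * y) + t (y * y)))"
      by (intro has_expect_add has_expect_diff has_expect_scale has_expect_const 1 2 3 4)
    fix u v :: real assume "u \<in> {a..b}" "v \<in> {a..b}"
    then have "ln v \<le> ln u + inverse u * v - 1 - 1 / (2 * b\<^sup>2) * (u - v)\<^sup>2"
      using ab by (intro ln_le_tangent_minus_square) auto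
    moreover have "(u - v)\<^sup>2 = u * u - 2 * (u * v) + v * v" by (simp add: power2_eq_square algebra_simps)
    ultimately show "ln v \<le> ln u + inverse u * v - 1 - 1 / (2 * b\<^sup>2) * (u * u - 2 * (u * v) + v * v)"
      by simp
  qed
  moreover have "t ((x - y) * (x - y)) = t (x * x) - 2 * t (x * y) + t (y * y)"
    using x y t_comm [of y x] by (simp add: algebra_simps t_diff t_add)
  moreover have "t (z * (y - x)) = t (z * y) - 1"
    using x y zN z by (simp add: right_diff_distrib t_diff t_one)
  ultimately show ?thesis by simp
qed

lemma t_square_nonneg: "x \<in> N \<Longrightarrow> selfadj x \<Longrightarrow> 0 \<le> t (x * x)"
  using t_star_mult_nonneg [of x] by (simp add: star_eq)

lemma L_le_tangent:
  assumes "0 < a" "a < b" "op_between a b x" "x \<in> N" "op_between a b y" "y \<in> N" "z * x = 1"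
  shows "L y \<le> L x + t (z * (y - x))"
proof -
  have "0 \<le> 1 / (2 * b\<^sup>2) * t ((x - y) * (x - y))"
    using assms by (intro mult_nonneg_nonneg t_square_nonneg adjoint_pair_diff op_between_selfadj) auto
  then show ?thesis using L_le_tangent_minus_square [OF assms] by simp
qed

text \<open>Tangent bounds at the midpoint, evaluated at \<open>x\<close> and at \<open>y\<close>:
  the displacements are opposite, so the linear terms cancel in the average. Halving the
  displacement turns \<open>1 / (2 * b\<^sup>2)\<close> into
  \<open>1 / (8 * b\<^sup>2)\<close>.\<close>

lemma D_ge_square:
  assumes ab: "0 < a" "a < b" and x: "op_between a b x" "x \<in> N" and y: "op_between a b y" "y \<in> N"
  shows "1 / (8 * b\<^sup>2) * t ((x - y) * (x - y)) \<le> D x y"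
proof -
  let ?w = "(1 / 2) *\<^sub>R (x + y)"
  have w: "op_between a b ?w" "?w \<in> N" using x y by (auto intro: op_between_midpoint)
  interpret W: op_interval a b ?w using w ab by unfold_locales
  let ?z = "fc inverse ?w"
  have z: "?z * ?w = 1" using W.fc_inverse ab by simp
  have zN: "?z \<in> N" using ab by (intro fc_N [of a b] w continuous_intros) auto
  have w1: "?w = x - (1 / 2) *\<^sub>R (x - y)"
    unfolding midpoint_eq [of x y] by (simp add: scaleR_diff_right)
  have w2: "?w = y + (1 / 2) *\<^sub>R (x - y)"
    unfolding add.commute [of x y] midpoint_eq [of y x] ..
  have e: "x - ?w = (1 / 2) *\<^sub>R (x - y)" "?w - x = - ((1 / 2) *\<^sub>R (x - y))"
    unfolding w1 by simp_all
  have e': "y - ?w = - ((1 / 2) *\<^sub>R (x - y))" "?w - y = (1 / 2) *\<^sub>R (x - y)"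
    unfolding w2 by simp_all
  have "L x \<le> L ?w + 1 / 2 * t (?z * (x - y)) - 1 / (8 * b\<^sup>2) * t ((x - y) * (x - y))"
    using L_le_tangent_minus_square [OF ab w x z] x y zN unfolding e by (simp add: t_scaleR t_minus)
  moreover have "L y \<le> L ?w - 1 / 2 * t (?z * (x - y)) - 1 / (8 * b\<^sup>2) * t ((x - y) * (x - y))"
    using L_le_tangent_minus_square [OF ab w y z] x y zN unfolding e' by (simp add: t_scaleR t_minus)
  ultimately show ?thesis unfolding D_def by argo
qed

lemma D_nonneg:
  assumes "0 < a" "a < b" "op_between a b x" "x \<in> N" "op_between a b y" "y \<in> N"
  shows "0 \<le> D x y"
proof -
  have "0 \<le> 1 / (8 * b\<^sup>2) * t ((x - y) * (x - y))"
    using assms by (intro mult_nonneg_nonneg t_square_nonneg adjoint_pair_diff op_between_selfadj) auto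
  then show ?thesis using D_ge_square [OF assms] by simp
qed

lemma D_eq_0:
  assumes ab: "0 < a" "a < b" and x: "op_between a b x" "x \<in> N" and y: "op_between a b y" "y \<in> N"
    and "D x y = 0"
  shows "x = y"
proof -
  have s: "selfadj (x - y)" using x y by (intro adjoint_pair_diff op_between_selfadj)
  have "t ((x - y) * (x - y)) \<le> 0"
    using D_ge_square [OF ab x y] ab \<open>D x y = 0\<close> by (simp add: field_simps)
  then have "t (star (x - y) * (x - y)) = 0"
    using t_square_nonneg [OF _ s] x y by (simp add: star_eq [OF s])
  then show ?thesis using n2_eq_0 [of "x - y"] x y by simp
qed

lemma D_commute: "D x y = D y x"
  by (simp add: D_def add.commute)

lemma D_self: "D x x = 0"
proof -
  have "(1 / 2) *\<^sub>R (x + x) = x" by (simp add: midpoint_eq)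
  then show ?thesis by (simp add: D_def)
qed

text \<open>The difference \<open>L (s z s) - L z\<close> has vanishing derivative along segments, because
  \<open>(s z s)\<^sup>-\<^sup>1 (s h s)\<close> and \<open>z\<^sup>-\<^sup>1 h\<close> have the same trace.\<close>

lemma L_congruence:
  assumes ab: "0 < a" "a < b" and x: "op_between a b x" "x \<in> N" and y: "op_between a b y" "y \<in> N"
    and s: "selfadj s" "s \<in> N" and s': "s' * s = 1" "s * s' = 1" "s' \<in> N"
  shows "L (s * y * s) - L y = L (s * x * s) - L x"
proof -
  define c where "c = norm s' + 1"
  define a' where "a' = a / c\<^sup>2"
  \<comment> \<open>The maximum ensures \<open>a' < b'\<close>, which the tangent bounds ask
    for.\<close>
  define b' where "b' = max (b * (norm s)\<^sup>2) (a' + 1)"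
  have c: "norm s' \<le> c" "0 < c" by (auto simp: c_def intro: add_nonneg_pos)
  have ab': "0 < a'" "a' < b'" using ab c by (auto simp: a'_def b'_def)
  have bt: "op_between a' b' (s * z * s)" if "op_between a b z" for z
    using op_between_congruence [OF that _ _ s(1) s'(1) c] ab
    by (auto simp: a'_def b'_def intro: op_between_mono)
  define z where "z r = x + r *\<^sub>R (y - x)" for r
  define f where "f r = L (s * z r * s) - L (z r)" for r
  define e where "e = y - x"
  have zb: "op_between a b (z r)" "z r \<in> N" if "r \<in> {0..1}" for r
    using that x y by (auto simp: z_def intro: op_between_convex)
  define i where "i r = fc inverse (z r)" for r
  have i: "i r * z r = 1" "z r * i r = 1" "norm (i r) \<le> 1 / a" "i r \<in> N" if "r \<in> {0..1}" for r
  proof -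
    interpret op_interval a b "z r" using zb that ab by unfold_locales auto
    show "i r * z r = 1" "z r * i r = 1" "norm (i r) \<le> 1 / a"
      using fc_inverse ab by (auto simp: i_def)
    show "i r \<in> N" unfolding i_def using ab zb that by (intro fc_N [of a b] continuous_intros) auto
  qed
  have zd: "z q - z r = (q - r) *\<^sub>R e" for q r by (simp add: z_def e_def algebra_simps)
  have eN: "e \<in> N" using x y by (simp add: e_def)
  have up: "L (z q) - L (z r) \<le> (q - r) * t (i r * e)"
    "L (s * z q * s) - L (s * z r * s) \<le> (q - r) * t (i r * e)"
    if "q \<in> {0..1}" "r \<in> {0..1}" for q r
  proof -
    show "L (z q) - L (z r) \<le> (q - r) * t (i r * e)"
      using L_le_tangent [OF ab zb [OF that(2)] zb [OF that(1)] i(1) [OF that(2)]] i that eN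
      by (simp add: zd t_scaleR)
    have "s' * i r * s' * (s * z r * s) = s' * (i r * (s' * s * z r)) * s" by (simp add: mult.assoc)
    then have inv: "s' * i r * s' * (s * z r * s) = 1" using s' i that by simp
    have "s' * i r * s' * (s * z q * s - s * z r * s) = s' * i r * s' * (s * (z q - z r) * s)"
      by (simp add: algebra_simps)
    also have "\<dots> = (q - r) *\<^sub>R (s' * (i r * (s' * s * e)) * s)"
      by (simp add: zd mult.assoc)
    finally have "t (s' * i r * s' * (s * z q * s - s * z r * s)) = (q - r) * t (s' * (i r * e) * s)"
      using s' s eN i that by (simp add: t_scaleR)
    also have "t (s' * (i r * e) * s) = t (s * (s' * (i r * e)))"
      using s' s eN i that by (intro t_comm) auto
    also have "s * (s' * (i r * e)) = i r * e" using s' by (simp flip: mult.assoc)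
    finally show "L (s * z q * s) - L (s * z r * s) \<le> (q - r) * t (i r * e)"
      using L_le_tangent [OF ab' bt [OF zb(1) [OF that(2)]] _ bt [OF zb(1) [OF that(1)]] _ inv] s zb that
      by simp
  qed
  have "f 1 = f 0"
  proof (rule const_of_quadratic_variation)
    fix r q :: real assume rq: "r \<in> {0..1}" "q \<in> {0..1}"
    \<comment> \<open>The tangent bounds at both ends enclose the increments of both functions of
      \<open>L\<close> between \<open>(r - q) * t (i r * e)\<close> and
      \<open>(r - q) * t (i q * e)\<close>, so the increments differ by at most the distance of
      these numbers.\<close>
    have "\<bar>f r - f q\<bar> \<le> \<bar>(r - q) * t (i r * e) - (r - q) * t (i q * e)\<bar>"
      using up [OF rq] up [OF rq(2,1)] unfolding f_def by (simp add: algebra_simps)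
    also have "\<dots> = \<bar>r - q\<bar> * \<bar>t ((i r - i q) * e)\<bar>"
    proof -
      have "t ((i r - i q) * e) = t (i r * e) - t (i q * e)"
        using i rq eN by (simp add: left_diff_distrib t_diff)
      then show ?thesis by (simp only: right_diff_distrib [symmetric] abs_mult)
    qed
    also have "\<bar>t ((i r - i q) * e)\<bar> \<le> norm ((i r - i q) * e)"
      using i rq eN by (intro t_le_norm) auto
    \<comment> \<open>The resolvent identity supplies the second factor
      \<open>\<bar>r - q\<bar>\<close>.\<close>
    also have "i r - i q = i r * (z q - z r) * i q"
      using i rq by (simp add: algebra_simps)
    also have "norm (i r * (z q - z r) * i q * e) \<le> 1 / a * (\<bar>r - q\<bar> * norm e) * (1 / a) * norm e"
    proof -
      have "norm (i r * (z q - z r) * i q * e) \<le> norm (i r) * norm (z q - z r) * norm (i q) * norm e"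
        by (meson mult_right_mono norm_ge_zero norm_mult_ineq order_trans)
      also have "\<dots> \<le> 1 / a * norm (z q - z r) * (1 / a) * norm e"
        using i rq ab by (intro mult_mono) auto
      finally show ?thesis by (simp add: zd abs_minus_commute)
    qed
    finally have "\<bar>f r - f q\<bar> \<le> \<bar>r - q\<bar> * (1 / a * (\<bar>r - q\<bar> * norm e) * (1 / a) * norm e)"
      by (simp add: mult_left_mono)
    also have "\<dots> = (norm e / a)\<^sup>2 * (\<bar>r - q\<bar> * \<bar>r - q\<bar>)" by (simp add: power2_eq_square)
    finally show "\<bar>f r - f q\<bar> \<le> (norm e / a)\<^sup>2 * (r - q)\<^sup>2" by (simp add: power2_eq_square)
  qed
  then show ?thesis by (simp add: f_def z_def)
qed

text \<open>The shift of \<open>L\<close> under the congruence is the same at \<open>x\<close>, at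
  \<open>y\<close> and at the midpoint, and the coefficients \<open>1\<close>,
  \<open>- 1 / 2\<close>, \<open>- 1 / 2\<close> add up to zero.\<close>

lemma D_congruence:
  assumes ab: "0 < a" "a < b" and x: "op_between a b x" "x \<in> N" and y: "op_between a b y" "y \<in> N"
    and s: "selfadj s" "s \<in> N" and s': "s' * s = 1" "s * s' = 1" "s' \<in> N"
  shows "D (s * x * s) (s * y * s) = D x y"
proof -
  let ?w = "(1 / 2) *\<^sub>R (x + y)"
  have w: "op_between a b ?w" "?w \<in> N" using x y by (auto intro: op_between_midpoint)
  have "(1 / 2) *\<^sub>R (s * x * s + s * y * s) = s * ?w * s" by (simp add: algebra_simps)
  moreover have "L (s * ?w * s) - L ?w = L (s * x * s) - L x"
    using L_congruence [OF ab x w s s'] .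
  moreover have "L (s * y * s) - L y = L (s * x * s) - L x"
    using L_congruence [OF ab x y s s'] .
  ultimately show ?thesis unfolding D_def by simp
qed

end

section \<open>Nearly commuting pairs\<close>

text \<open>\<open>ordered_power x y n\<close> is \<open>(x + y)\<^sup>n\<close> expanded with every \<open>x\<close> moved to the left of every \<open>y\<close>.\<close>

primrec ordered_power :: "'a::{ring, monoid_mult} \<Rightarrow> 'a \<Rightarrow> nat \<Rightarrow> 'a"
  where "ordered_power x y 0 = 1"
  | "ordered_power x y (Suc n) = x * ordered_power x y n + ordered_power x y n * y"

definition ordered_poly :: "real poly \<Rightarrow> 'a \<Rightarrow> 'a \<Rightarrow> 'a::{real_algebra, monoid_mult}"
  where "ordered_poly p x y = (\<Sum>i\<le>degree p. coeff p i *\<^sub>R ordered_power x y i)"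

lemma norm_ordered_power_le:
  fixes x y :: "'a::real_normed_vector endo"
  assumes "norm x \<le> c" "norm y \<le> c"
  shows "norm (ordered_power x y n) \<le> (2 * c) ^ n"
proof (induction n)
  case (Suc n)
  have c: "0 \<le> c" using assms norm_ge_zero order_trans by blast
  have "norm (ordered_power x y (Suc n))
      \<le> norm (x * ordered_power x y n) + norm (ordered_power x y n * y)"
    by (simp add: norm_triangle_ineq)
  also have "\<dots> \<le> norm x * norm (ordered_power x y n) + norm (ordered_power x y n) * norm y"
    by (intro add_mono norm_mult_ineq)
  also have "\<dots> \<le> c * (2 * c) ^ n + (2 * c) ^ n * c"
    using assms Suc c by (intro add_mono mult_mono) auto
  finally show ?case by (simp add: algebra_simps)
qed (simp add: norm_one_endo_le)

context tracial_algebra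
begin

lemma ordered_power_N [simp]: "x \<in> N \<Longrightarrow> y \<in> N \<Longrightarrow> ordered_power x y n \<in> N"
  by (induction n) auto

text \<open>Leibniz rule: if \<open>K\<close> is the commutator of \<open>y\<close> with the ordered
  power \<open>T\<close>, the next one is \<open>(y * x - x * y) * T + x * K + K * y\<close>. In
  each term only a commutator is measured in \<open>2\<close>-norm, so \<open>d\<close> depends on
  \<open>c\<close> and \<open>n\<close> alone.\<close>

lemma ordered_power_commutator:
  "\<exists>d\<ge>0. \<forall>x\<in>N. \<forall>y\<in>N. norm x \<le> c \<longrightarrow> norm y \<le> c \<longrightarrow>
    n2 (y * ordered_power x y n - ordered_power x y n * y) \<le> d * n2 (y * x - x * y)"
proof (induction n)
  case 0
  have "n2 0 = 0" by (simp add: n2_def star_eq [OF adjoint_pair_0])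
  then show ?case by (intro exI [of _ 0]) simp
next
  case (Suc n)
  then obtain d where d: "d \<ge> 0" and IH: "\<And>x y. x \<in> N \<Longrightarrow> y \<in> N \<Longrightarrow> norm x \<le> c \<Longrightarrow> norm y \<le> c \<Longrightarrow>
    n2 (y * ordered_power x y n - ordered_power x y n * y) \<le> d * n2 (y * x - x * y)" by blast
  \<comment> \<open>The witness has one summand per term of \<open>e1\<close>, with absolute values
    because \<open>0 \<le> c\<close> is known only once \<open>x\<close> and \<open>y\<close> are
    fixed.\<close>
  show ?case
  proof (intro exI [of _ "\<bar>2 * c\<bar> ^ n + \<bar>c\<bar> * d + d * \<bar>c\<bar>"] conjI ballI impI)
    show "0 \<le> \<bar>2 * c\<bar> ^ n + \<bar>c\<bar> * d + d * \<bar>c\<bar>" using d by (intro add_nonneg_nonneg) auto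
    fix x y assume xy: "x \<in> N" "y \<in> N" "norm x \<le> c" "norm y \<le> c"
    have c: "0 \<le> c" using xy norm_ge_zero order_trans by blast
    let ?T = "ordered_power x y n" and ?e = "n2 (y * x - x * y)"
    let ?K = "y * ?T - ?T * y"
    have e: "0 \<le> ?e" and K: "0 \<le> n2 ?K" "n2 ?K \<le> d * ?e" using xy IH by auto
    have e1: "y * ordered_power x y (Suc n) - ordered_power x y (Suc n) * y
        = (y * x - x * y) * ?T + x * ?K + ?K * y"
      by (simp add: algebra_simps)
    have "n2 (y * ordered_power x y (Suc n) - ordered_power x y (Suc n) * y)
        \<le> n2 ((y * x - x * y) * ?T) + n2 (x * ?K) + n2 (?K * y)"
      unfolding e1 using xy by (smt (verit) n2_triangle add_N mult_N diff_N ordered_power_N)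
    also have "\<dots> \<le> ?e * norm ?T + norm x * n2 ?K + n2 ?K * norm y"
      using xy by (intro add_mono n2_mult_left n2_mult_right) auto
    also have "\<dots> \<le> ?e * (2 * c) ^ n + c * (d * ?e) + d * ?e * c"
      using xy K e d c norm_ordered_power_le [OF xy(3,4)] by (intro add_mono mult_mono) auto
    finally show "n2 (y * ordered_power x y (Suc n) - ordered_power x y (Suc n) * y)
        \<le> (\<bar>2 * c\<bar> ^ n + \<bar>c\<bar> * d + d * \<bar>c\<bar>) * ?e"
      using c by (simp add: algebra_simps)
  qed
qed

text \<open>The recursion for ordered powers differs from left multiplication by
  \<open>x + y\<close> only in the commutator of \<open>y\<close> with the ordered power.\<close>

lemma ordered_power_approx:
  "\<exists>d\<ge>0. \<forall>x\<in>N. \<forall>y\<in>N. norm x \<le> c \<longrightarrow> norm y \<le> c \<longrightarrow>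
    n2 ((x + y) ^ n - ordered_power x y n) \<le> d * n2 (y * x - x * y)"
proof (induction n)
  case 0
  have "n2 0 = 0" by (simp add: n2_def star_eq [OF adjoint_pair_0])
  then show ?case by (intro exI [of _ 0]) simp
next
  case (Suc n)
  then obtain d where d: "d \<ge> 0" and IH: "\<And>x y. x \<in> N \<Longrightarrow> y \<in> N \<Longrightarrow> norm x \<le> c \<Longrightarrow> norm y \<le> c \<Longrightarrow>
    n2 ((x + y) ^ n - ordered_power x y n) \<le> d * n2 (y * x - x * y)" by blast
  obtain d' where d': "d' \<ge> 0" and K: "\<And>x y. x \<in> N \<Longrightarrow> y \<in> N \<Longrightarrow> norm x \<le> c \<Longrightarrow> norm y \<le> c \<Longrightarrow>
    n2 (y * ordered_power x y n - ordered_power x y n * y) \<le> d' * n2 (y * x - x * y)"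
    using ordered_power_commutator by blast
  show ?case
  proof (intro exI [of _ "2 * \<bar>c\<bar> * d + d'"] conjI ballI impI)
    show "0 \<le> 2 * \<bar>c\<bar> * d + d'" using d d' by (intro add_nonneg_nonneg) auto
    fix x y assume xy: "x \<in> N" "y \<in> N" "norm x \<le> c" "norm y \<le> c"
    have c: "0 \<le> c" using xy norm_ge_zero order_trans by blast
    let ?T = "ordered_power x y n"
    have e1: "(x + y) ^ Suc n - ordered_power x y (Suc n) = (x + y) * ((x + y) ^ n - ?T) + (y * ?T - ?T * y)"
      by (simp add: algebra_simps)
    have "n2 ((x + y) ^ Suc n - ordered_power x y (Suc n))
        \<le> n2 ((x + y) * ((x + y) ^ n - ?T)) + n2 (y * ?T - ?T * y)"
      unfolding e1 using xy by (intro n2_triangle) auto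
    also have "\<dots> \<le> norm (x + y) * n2 ((x + y) ^ n - ?T) + d' * n2 (y * x - x * y)"
      using xy by (intro add_mono n2_mult_left K) auto
    also have "norm (x + y) * n2 ((x + y) ^ n - ?T) \<le> (2 * c) * (d * n2 (y * x - x * y))"
      using xy c norm_triangle_ineq [of x y] by (intro mult_mono IH) auto
    finally show "n2 ((x + y) ^ Suc n - ordered_power x y (Suc n))
        \<le> (2 * \<bar>c\<bar> * d + d') * n2 (y * x - x * y)"
      using c by (simp add: algebra_simps)
  qed
qed

text \<open>The constant depends on \<open>p\<close> and \<open>c\<close> only. It has to be
  available before the nearly optimal element is chosen, since the tolerance of that choice is
  computed from it.\<close>

lemma ordered_poly_approx:
  "\<exists>d\<ge>0. \<forall>x\<in>N. \<forall>y\<in>N. norm x \<le> c \<longrightarrow> norm y \<le> c \<longrightarrow>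
    t (peval p (x + y)) \<le> t (ordered_poly p x y) + d * n2 (y * x - x * y)"
proof -
  obtain d where d: "\<And>n. d n \<ge> 0" and D: "\<And>n x y. x \<in> N \<Longrightarrow> y \<in> N \<Longrightarrow> norm x \<le> c \<Longrightarrow> norm y \<le> c \<Longrightarrow>
    n2 ((x + y) ^ n - ordered_power x y n) \<le> d n * n2 (y * x - x * y)"
    using ordered_power_approx [of c] by metis
  show ?thesis
  proof (intro exI [of _ "\<Sum>i\<le>degree p. \<bar>coeff p i\<bar> * d i"] conjI ballI impI)
    show "0 \<le> (\<Sum>i\<le>degree p. \<bar>coeff p i\<bar> * d i)" using d by (intro sum_nonneg) auto
    fix x y assume xy: "x \<in> N" "y \<in> N" "norm x \<le> c" "norm y \<le> c"
    have "t (peval p (x + y)) - t (ordered_poly p x y)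
        = (\<Sum>i\<le>degree p. coeff p i * t ((x + y) ^ i - ordered_power x y i))"
      using xy by (simp add: peval_altdef ordered_poly_def t_sum t_scaleR t_diff right_diff_distrib
          sum_subtractf)
    also have "\<dots> \<le> (\<Sum>i\<le>degree p. \<bar>coeff p i\<bar> * (d i * n2 (y * x - x * y)))"
    proof (rule sum_mono)
      fix i
      have "coeff p i * t ((x + y) ^ i - ordered_power x y i)
          \<le> \<bar>coeff p i\<bar> * \<bar>t ((x + y) ^ i - ordered_power x y i)\<bar>"
        by (metis abs_ge_self abs_mult)
      also have "\<bar>t ((x + y) ^ i - ordered_power x y i)\<bar> \<le> d i * n2 (y * x - x * y)"
        using t_le_n2 [of "(x + y) ^ i - ordered_power x y i"] D [of x y i] xy by simp
      finally show "coeff p i * t ((x + y) ^ i - ordered_power x y i)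
          \<le> \<bar>coeff p i\<bar> * (d i * n2 (y * x - x * y))" by (simp add: mult_left_mono)
    qed
    finally show "t (peval p (x + y))
        \<le> t (ordered_poly p x y) + (\<Sum>i\<le>degree p. \<bar>coeff p i\<bar> * d i) * n2 (y * x - x * y)"
      by (simp add: sum_distrib_right mult.assoc)
  qed
qed

end

text \<open>The outer powers make the induction go through: one step of the recursion puts an
  \<open>x\<close> to the left of the ordered power or a \<open>y\<close> to its right.\<close>

lemma (in op_pair) has_expect_ordered_power:
  "has_expect (\<lambda>u v. u ^ i * (u + v) ^ n * v ^ j) (t (x ^ i * ordered_power x y n * y ^ j))"
proof (induction n arbitrary: i j)
  case 0
  have pw: "(\<lambda>u::real. u ^ i) = poly ([:0, 1:] ^ i)" for i by (simp add: fun_eq_iff)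
  have "fc (\<lambda>u. u ^ i) x = x ^ i" for i
    unfolding pw X.fc_poly by (simp add: peval_power)
  moreover have "fc (\<lambda>u. u ^ j) y = y ^ j" for j
    unfolding pw Y.fc_poly by (simp add: peval_power)
  ultimately show ?case using has_expect_prod [of "\<lambda>u. u ^ i" "\<lambda>v. v ^ j"]
    by (simp add: continuous_on_power continuous_on_id)
next
  case (Suc n)
  have "has_expect (\<lambda>u v. u ^ Suc i * (u + v) ^ n * v ^ j + u ^ i * (u + v) ^ n * v ^ Suc j)
    (t (x ^ Suc i * ordered_power x y n * y ^ j) + t (x ^ i * ordered_power x y n * y ^ Suc j))"
    by (intro has_expect_add Suc)
  moreover have "u ^ Suc i * (u + v) ^ n * v ^ j + u ^ i * (u + v) ^ n * v ^ Suc j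
      = u ^ i * (u + v) ^ Suc n * v ^ j" for u v :: real
    by (simp add: algebra_simps)
  moreover have "t (x ^ Suc i * ordered_power x y n * y ^ j) + t (x ^ i * ordered_power x y n * y ^ Suc j)
      = t (x ^ i * ordered_power x y (Suc n) * y ^ j)"
    using x y by (simp add: t_add [symmetric] distrib_left distrib_right mult.assoc power_commutes [symmetric])
  ultimately show ?case by (simp only:)
qed

lemma (in op_pair) has_expect_ordered_poly:
  "has_expect (\<lambda>u v. poly p (u + v)) (t (ordered_poly p x y))"
proof -
  have "has_expect (\<lambda>u v. \<Sum>i\<le>degree p. coeff p i * (u + v) ^ i)
    (\<Sum>i\<le>degree p. coeff p i * t (ordered_power x y i))"
    using has_expect_ordered_power [of 0 _ 0] by (intro has_expect_sum has_expect_scale) simp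
  then show ?thesis using x y by (simp add: poly_altdef ordered_poly_def t_sum t_scaleR)
qed

section \<open>Maximizing over a unitary orbit\<close>

lemma op_between_norm_le:
  assumes "op_between a b x" "0 \<le> a" "a \<le> b"
  shows "norm x \<le> b"
  by (rule norm_le_of_op_between [OF op_between_mono [OF assms(1)]]) (use assms in auto)

lemma norm_mult_le_mult:
  fixes x y :: "'a::real_normed_algebra"
  assumes "norm x \<le> c" "norm y \<le> d"
  shows "norm (x * y) \<le> c * d"
proof -
  have "0 \<le> c" using assms norm_ge_zero order_trans by blast
  have "norm (x * y) \<le> norm x * norm y" by (rule norm_mult_ineq)
  also have "\<dots> \<le> c * d" using assms \<open>0 \<le> c\<close> by (intro mult_mono) auto
  finally show ?thesis .
qed

lemma norm_isometry_le:
  assumes "adjoint_pair w w'" "w' * w = 1"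
  shows "norm (ap w v) = norm v" "norm w \<le> 1"
proof -
  show n: "norm (ap w v) = norm v" for v
  proof -
    have "inner (ap w v) (ap w v) = inner v (ap (w' * w) v)"
      using assms(1) by (simp add: adjoint_pair_def)
    then show ?thesis using assms(2) by (simp add: norm_eq)
  qed
  then show "norm w \<le> 1" by (intro norm_endo_bound) auto
qed

lemma op_between_unitary_conj:
  assumes x: "op_between a b x" and w: "adjoint_pair w w'" "w * w' = 1"
  shows "op_between a b (w * x * w')"
  unfolding op_between_def
proof (intro conjI allI)
  have "selfadj (w * (x * w'))"
    using adjoint_pair_mult [OF w(1) adjoint_pair_mult [OF op_between_selfadj [OF x] adjoint_pair_commute [OF w(1)]]]
    by (simp add: mult.assoc)
  then show "selfadj (w * x * w')" by (simp add: mult.assoc)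
  fix v
  have e: "inner (ap (w * x * w') v) v = inner (ap x (ap w' v)) (ap w' v)"
    using w(1) by (simp add: adjoint_pair_def)
  have "norm (ap w' v) = norm v"
    using norm_isometry_le [OF adjoint_pair_commute [OF w(1)]] w(2) by simp
  then show "a * (norm v)\<^sup>2 \<le> inner (ap (w * x * w') v) v"
    "inner (ap (w * x * w') v) v \<le> b * (norm v)\<^sup>2"
    using x unfolding e op_between_def by metis+
qed

context tracial_algebra
begin

text \<open>The Cayley transform \<open>(1 + j) / (1 - j)\<close> of a skew-adjoint \<open>j\<close>, written as
  \<open>(1 + j)\<^sup>2 (1 - j\<^sup>2)\<^sup>-\<^sup>1\<close> so that only a self-adjoint element has to be inverted.\<close>

lemma cayley:
  assumes j: "j \<in> N" "adjoint_pair j (- j)"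
  obtains w w' where "w \<in> N" "w' \<in> N" "adjoint_pair w w'" "w * w' = 1" "w' * w = 1"
    "w = 1 + 2 *\<^sub>R j + j * j * (1 + w)" "w' = 1 - 2 *\<^sub>R j + j * j * (1 + w')"
proof -
  \<comment> \<open>This is \<open>1 - j * j\<close>; since \<open>- j\<close> is the adjoint of
    \<open>j\<close>, it is at least \<open>1\<close>.\<close>
  let ?y = "1 + (- j) * j"
  have "op_between 0 ((norm j)\<^sup>2) ((- j) * j)"
    unfolding op_between_def
  proof (intro conjI allI)
    show "selfadj (- j * j)" using adjoint_pair_mult [OF adjoint_pair_commute [OF j(2)] j(2)] .
    fix v
    have e: "inner (ap (- j * j) v) v = (norm (ap j v))\<^sup>2"
      using adjoint_pair_commute [OF j(2)] unfolding adjoint_pair_def ap_mult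
      by (simp only: power2_norm_eq_inner)
    show "0 * (norm v)\<^sup>2 \<le> inner (ap (- j * j) v) v" unfolding e by simp
    have "(norm (ap j v))\<^sup>2 \<le> (norm j * norm v)\<^sup>2" by (intro power_mono norm_ap) auto
    then show "inner (ap (- j * j) v) v \<le> (norm j)\<^sup>2 * (norm v)\<^sup>2"
      unfolding e by (simp add: power_mult_distrib)
  qed
  from op_between_add [OF op_between_scalar [of 1] this]
  have "op_between 1 (1 + (norm j)\<^sup>2) ?y" by simp
  \<comment> \<open>The upper bound is raised by \<open>1\<close> so that the interval is
    nondegenerate also for \<open>j = 0\<close>.\<close>
  then have y: "op_between 1 (2 + (norm j)\<^sup>2) ?y" by (rule op_between_mono) auto
  interpret Y: op_interval 1 "2 + (norm j)\<^sup>2" ?y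
    using y by unfold_locales (auto intro: add_pos_nonneg)
  define q where "q = fc inverse ?y"
  have yq: "?y * q = 1" "q * ?y = 1" using Y.fc_inverse by (auto simp: q_def)
  have c: "continuous_on {1..2 + (norm j)\<^sup>2} (inverse :: real \<Rightarrow> real)"
    by (intro continuous_intros) auto
  have qN: "q \<in> N" unfolding q_def by (rule fc_N [OF y Y.lt c]) (use j in simp)
  have qs: "selfadj q" unfolding q_def by (rule Y.fc_selfadj [OF c])
  have jq: "j * q = q * j"
  proof -
    have "j * q = q * ?y * (j * q)" using yq by simp
    also have "\<dots> = q * j * (?y * q)" by (simp add: algebra_simps)
    finally show ?thesis using yq by simp
  qed
  \<comment> \<open>Inserted once into the definitions of \<open>w\<close> and \<open>w'\<close>,
    this gives their exact expansions to second order.\<close>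
  have q1: "q = 1 + j * j * q" using yq(1) by (simp add: algebra_simps)
  define w where "w = (1 + j) * (1 + j) * q"
  define w' where "w' = (1 - j) * (1 - j) * q"
  have comm: "q * (1 + j) = (1 + j) * q" "q * (1 - j) = (1 - j) * q" using jq by (simp_all add: algebra_simps)
  have "?y * q * (?y * q) = 1" using yq by simp
  then have one: "(1 + j) * (1 - j) * q * ((1 + j) * (1 - j) * q) = 1" by (simp add: algebra_simps)
  have swap: "(1 - j) * (1 + j) = (1 + j) * (1 - j)" by (simp add: algebra_simps)
  have cq: "q * ((1 - j) * z) = (1 - j) * (q * z)" "q * ((1 + j) * z) = (1 + j) * (q * z)"
    "(1 - j) * ((1 + j) * z) = (1 + j) * ((1 - j) * z)" for z
    by (simp_all only: mult.assoc [symmetric] comm swap)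
  have "w * w' = (1 + j) * (1 - j) * q * ((1 + j) * (1 - j) * q)"
    "w' * w = (1 + j) * (1 - j) * q * ((1 + j) * (1 - j) * q)"
    unfolding w_def w'_def mult.assoc by (simp_all only: cq)
  then have ww: "w * w' = 1" "w' * w = 1" using one by simp_all
  have "adjoint_pair (1 + j) (1 + - j)" using j by (intro adjoint_pair_intros)
  then have aj: "adjoint_pair (1 + j) (1 - j)" by simp
  have "adjoint_pair w (q * ((1 - j) * (1 - j)))"
    unfolding w_def by (intro adjoint_pair_mult aj qs)
  moreover have "q * ((1 - j) * (1 - j)) = w'" unfolding w'_def using comm by (metis mult.assoc)
  ultimately have "adjoint_pair w w'" by simp
  moreover have "w = 1 + 2 *\<^sub>R j + j * j * (1 + w)"
  proof -
    have "w = (1 + j) * (1 + j) * (1 + j * j * q)" unfolding w_def by (subst q1) simp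
    also have "\<dots> = 1 + 2 *\<^sub>R j + j * j * (1 + (1 + j) * (1 + j) * q)"
      by (simp add: algebra_simps scaleR_2)
    finally show ?thesis by (simp add: w_def)
  qed
  moreover have "w' = 1 - 2 *\<^sub>R j + j * j * (1 + w')"
  proof -
    have "w' = (1 - j) * (1 - j) * (1 + j * j * q)" unfolding w'_def by (subst q1) simp
    also have "\<dots> = 1 - 2 *\<^sub>R j + j * j * (1 + (1 - j) * (1 - j) * q)"
      by (simp add: algebra_simps scaleR_2)
    finally show ?thesis by (simp add: w'_def)
  qed
  moreover have "w \<in> N" "w' \<in> N" using j qN by (auto simp: w_def w'_def)
  ultimately show ?thesis using ww that by blast
qed

text \<open>The tangent at \<open>y\<close> bounds \<open>L x\<close> from above with the slope
  \<open>fc inverse y\<close>. Exchanging it for the slope \<open>fc inverse x\<close> costs, by the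
  resolvent identity, a term that is quadratic in \<open>y - x\<close>.\<close>

lemma L_lower:
  assumes ab: "0 < a" "a < b" and x: "op_between a b x" "x \<in> N" and y: "op_between a b y" "y \<in> N"
  shows "L x + t (fc inverse x * (y - x)) - (norm (y - x))\<^sup>2 / a\<^sup>2 \<le> L y"
proof -
  interpret op_pair N t a b x y using assms by unfold_locales
  let ?p = "fc inverse x" and ?q = "fc inverse y"
  have c: "continuous_on {a..b} (inverse :: real \<Rightarrow> real)" using ab by (intro continuous_intros) auto
  have N: "?p \<in> N" "?q \<in> N" using fc_N x y c ab by blast+
  note p = X.fc_inverse [OF ab(1)] and q = Y.fc_inverse [OF ab(1)]
  have "L x \<le> L y + t (?q * (x - y))" by (rule L_le_tangent [OF ab y x q(2)])
  moreover have "t (?q * (x - y)) = - t (?q * (y - x))"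
    using t_minus [of "?q * (y - x)"] N x y by (simp add: algebra_simps)
  moreover have "t (?p * (y - x)) - t (?q * (y - x)) \<le> (norm (y - x))\<^sup>2 / a\<^sup>2"
  proof -
    have e0: "?q * (y - x) * ?p = ?p - ?q" using p q by (simp add: algebra_simps)
    have e: "?q * (y - x) * ?p * (y - x) = ?p * (y - x) - ?q * (y - x)"
      by (simp only: e0 left_diff_distrib)
    have "t (?p * (y - x)) - t (?q * (y - x)) = t (?q * (y - x) * ?p * (y - x))"
      unfolding e using N x y by (simp add: t_diff)
    also have "\<dots> \<le> norm (?q * (y - x) * ?p * (y - x))" using t_le_norm N x y by (smt (verit) mult_N diff_N)
    also have "\<dots> \<le> 1 / a * norm (y - x) * (1 / a) * norm (y - x)"
      by (intro norm_mult_le_mult p q order_refl)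
    finally show ?thesis by (simp add: power2_eq_square)
  qed
  ultimately show ?thesis by simp
qed

text \<open>Equal traces of all polynomials mean equal spectral distributions. The class is closed
  under unitary conjugation and serves in place of the unitary orbit of \<open>x\<close>.\<close>

definition spectral_class :: "real \<Rightarrow> real \<Rightarrow> 'h endo \<Rightarrow> 'h endo set"
  where "spectral_class a b x = {y \<in> N. op_between a b y \<and> (\<forall>p. t (peval p y) = t (peval p x))}"

lemma spectral_class_conj:
  assumes y: "y \<in> spectral_class a b x" and w: "w \<in> N" "w' \<in> N" "adjoint_pair w w'" "w * w' = 1" "w' * w = 1"
  shows "w * y * w' \<in> spectral_class a b x"
proof -
  have yN: "y \<in> N" using y by (simp add: spectral_class_def)
  have "t (peval p (w * y * w')) = t (peval p y)" for p
  proof -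
    have "w * y = w * y * w' * w" using w by (simp add: mult.assoc)
    from peval_intertwine [OF this, of p] have "w * peval p y * w' = peval p (w * y * w') * (w * w')"
      by (simp add: mult.assoc)
    then have "t (peval p (w * y * w')) = t (w * (peval p y * w'))" using w by (simp add: mult.assoc)
    also have "\<dots> = t (peval p y * w' * w)" using w yN by (intro t_comm) auto
    finally show ?thesis using w by (simp add: mult.assoc)
  qed
  then show ?thesis using y w by (auto simp: spectral_class_def intro: op_between_unitary_conj)
qed

lemma spectral_class_fc:
  assumes y: "y \<in> spectral_class a b x" and x: "op_between a b x" "x \<in> N"
    and ab: "a < b" and f: "continuous_on {a..b} f"
  shows "t (fc f y) = t (fc f x)"
proof (rule LIMSEQ_unique)
  have y': "op_between a b y" "y \<in> N" using y by (auto simp: spectral_class_def)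
  show "(\<lambda>n. t (peval (bern_poly a b f n) y)) \<longlonglongrightarrow> t (fc f y)"
    using y' ab f by (intro t_tendsto fc_bern_lim fc_N) auto
  have "(\<lambda>n. t (peval (bern_poly a b f n) x)) \<longlonglongrightarrow> t (fc f x)"
    using x ab f by (intro t_tendsto fc_bern_lim fc_N) auto
  then show "(\<lambda>n. t (peval (bern_poly a b f n) y)) \<longlonglongrightarrow> t (fc f x)"
    using y by (simp add: spectral_class_def)
qed

text \<open>Up to sign, the gradient of \<open>L (x + y)\<close> along the unitary orbit of
  \<open>x\<close>: with \<open>z = fc inverse (x + y)\<close>, the derivative in the direction
  \<open>j * x - x * j\<close> is
  \<open>t (z * (j * x - x * j)) = t (j * (x * z - z * x))\<close>.\<close>

definition defect :: "'h endo \<Rightarrow> 'h endo \<Rightarrow> 'h endo"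
  where "defect x y = x * fc inverse (x + y) - fc inverse (x + y) * x"

text \<open>Conjugating \<open>x\<close> by the Cayley transform of a small multiple of the defect increases
  \<open>L (x + y)\<close> to first order, unless the defect is small in \<open>2\<close>-norm.\<close>

lemma unitary_ascent:
  assumes ab: "0 < a" "a < b"
  obtains c where "0 \<le> c" and "\<And>x y s. op_between a b x \<Longrightarrow> x \<in> N \<Longrightarrow> op_between a b y \<Longrightarrow> y \<in> N \<Longrightarrow>
    0 \<le> s \<Longrightarrow> s \<le> 1 \<Longrightarrow> \<exists>w\<in>N. \<exists>w'\<in>N. adjoint_pair w w' \<and> w * w' = 1 \<and> w' * w = 1 \<and>
      L (x + y) + 2 * s * (n2 (defect x y))\<^sup>2 - c * s\<^sup>2 \<le> L (w * x * w' + y)"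
proof -
  \<comment> \<open>Here \<open>k\<close> bounds the norm of the defect,
    \<open>c1 * s\<^sup>2\<close> the second-order remainder \<open>R\<close>, and
    \<open>c2 * s\<close> the displacement of \<open>x\<close>; all depend on \<open>a\<close> and
    \<open>b\<close> only.\<close>
  define k where "k = b / a"
  define c1 where "c1 = 2 * k\<^sup>2 * b + (1 + 2 * k) * b * (2 * k\<^sup>2) + 4 * k\<^sup>2 * b"
  define c2 where "c2 = 4 * k * b + c1"
  define c where "c = c1 / (2 * a) + c2\<^sup>2 / (2 * a)\<^sup>2"
  have k0: "0 \<le> k" using ab by (simp add: k_def)
  have c1: "0 \<le> c1" "0 \<le> c2" using ab k0 unfolding c2_def c1_def by (auto intro!: add_nonneg_nonneg)
  have c0: "0 \<le> c" using ab c1 by (simp add: c_def)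
  show ?thesis
  proof (rule that [OF c0])
    fix x y :: "'h endo" and s :: real
    assume x: "op_between a b x" "x \<in> N" and y: "op_between a b y" "y \<in> N" and s: "0 \<le> s" "s \<le> 1"
    let ?u = "x + y"
    have ab2: "0 < 2 * a" "2 * a < 2 * b" using ab by auto
    have dbl: "op_between (2 * a) (2 * b) (z + y)" if "op_between a b z" for z
      using op_between_add [OF that y(1)] by simp
    have u: "op_between (2 * a) (2 * b) ?u" "?u \<in> N" using x y dbl by auto
    interpret U: op_interval "2 * a" "2 * b" ?u using u ab2 by unfold_locales auto
    define z where "z = fc inverse ?u"
    have ci: "continuous_on {2 * a..2 * b} (inverse :: real \<Rightarrow> real)"
      using ab by (intro continuous_intros) auto
    have z: "z \<in> N" "selfadj z" "norm z \<le> 1 / (2 * a)"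
      using fc_N [OF u(1) ab2(2) ci u(2)] U.fc_selfadj [OF ci] U.fc_inverse(3) ab2 by (auto simp: z_def)
    have nx: "norm x \<le> b" using ab by (intro op_between_norm_le [OF x(1)]) auto
    define K where "K = x * z - z * x"
    have KN: "K \<in> N" using x z by (simp add: K_def)
    have "adjoint_pair (x * z - z * x) (z * x - x * z)"
      using op_between_selfadj [OF x(1)] z by (intro adjoint_pair_intros)
    then have Ks: "adjoint_pair K (- K)" by (simp add: K_def)
    have nK: "norm K \<le> k"
    proof -
      have "norm K \<le> norm (x * z) + norm (z * x)" unfolding K_def by (rule norm_triangle_ineq4)
      also have "\<dots> \<le> b * (1 / (2 * a)) + (1 / (2 * a)) * b" by (intro add_mono norm_mult_le_mult nx z)
      finally show ?thesis using ab by (simp add: k_def field_simps)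
    qed
    \<comment> \<open>The sign turns the first-order term \<open>2 * t (z * (j * x - x * j))\<close>
      into \<open>- 2 * s * t (K * K)\<close>, which is nonnegative because \<open>K\<close> is
      skew-adjoint.\<close>
    define j where "j = (- s) *\<^sub>R K"
    have j: "j \<in> N" "adjoint_pair j (- j)"
      using KN adjoint_pair_scaleR [OF Ks, of "- s"] by (simp_all add: j_def)
    have nj: "norm j \<le> s * k" using nK s by (simp add: j_def mult_left_mono)
    obtain w w' where w: "w \<in> N" "w' \<in> N" "adjoint_pair w w'" "w * w' = 1" "w' * w = 1"
      and w1: "w = 1 + 2 *\<^sub>R j + j * j * (1 + w)" and w2: "w' = 1 - 2 *\<^sub>R j + j * j * (1 + w')"
      using cayley [OF j] .
    have nw: "norm w \<le> 1" "norm w' \<le> 1"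
      using norm_isometry_le(2) [OF w(3,5)] norm_isometry_le(2) [OF adjoint_pair_commute [OF w(3)] w(4)] by auto
    define F where "F = j * j * (1 + w)"
    define F' where "F' = j * j * (1 + w')"
    have one: "norm (1 + v) \<le> 2" if "norm v \<le> 1" for v :: "'h endo"
      using norm_triangle_ineq [of 1 v] norm_one_endo_le that by (smt (verit))
    have F: "norm F \<le> s * k * (s * k) * 2" "norm F' \<le> s * k * (s * k) * 2"
      unfolding F_def F'_def by (intro norm_mult_le_mult nj one nw)+
    have FN: "F \<in> N" "F' \<in> N" using j w by (simp_all add: F_def F'_def)
    \<comment> \<open>What remains of \<open>w * x * w'\<close> beyond
      \<open>x + 2 *\<^sub>R (j * x - x * j)\<close>; every term contains \<open>j\<close> at least
      twice.\<close>
    define R where "R = F * x * w' + (1 + 2 *\<^sub>R j) * x * F' - 4 *\<^sub>R (j * x * j)"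
    have RN: "R \<in> N" using FN w x j by (simp add: R_def)
    let ?d = "w * x * w' + y - ?u"
    have d: "?d = 2 *\<^sub>R (j * x - x * j) + R"
    proof -
      have e1: "w = 1 + 2 *\<^sub>R j + F" and e2: "w' = 1 - 2 *\<^sub>R j + F'" using w1 w2 by (simp_all add: F_def F'_def)
      have "w * x * w' = F * x * w' + (1 + 2 *\<^sub>R j) * x * w'"
        by (subst e1) (simp add: algebra_simps)
      also have "(1 + 2 *\<^sub>R j) * x * w' = (1 + 2 *\<^sub>R j) * x * F' + (1 + 2 *\<^sub>R j) * x * (1 - 2 *\<^sub>R j)"
        by (subst e2) (simp add: algebra_simps)
      also have "(1 + 2 *\<^sub>R j) * x * (1 - 2 *\<^sub>R j) = x + 2 *\<^sub>R (j * x - x * j) - 4 *\<^sub>R (j * x * j)"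
        by (simp add: algebra_simps scaleR_diff_right)
      finally show ?thesis by (simp add: R_def algebra_simps)
    qed
    have nR: "norm R \<le> c1 * s\<^sup>2"
    proof -
      have "norm (1 + 2 *\<^sub>R j) \<le> norm (1 :: 'h endo) + norm (2 *\<^sub>R j)" by (rule norm_triangle_ineq)
      also have "\<dots> \<le> 1 + 2 * (s * k)" using norm_one_endo_le nj by (intro add_mono) auto
      also have "\<dots> \<le> 1 + 2 * k" using s k0 by (simp add: mult_left_le_one_le)
      finally have n1: "norm (1 + 2 *\<^sub>R j) \<le> 1 + 2 * k" .
      have "norm R \<le> norm (F * x * w') + norm ((1 + 2 *\<^sub>R j) * x * F') + norm (4 *\<^sub>R (j * x * j))"
        unfolding R_def by (meson add_mono_thms_linordered_semiring(3) norm_triangle_ineq norm_triangle_ineq4 order_trans)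
      also have "\<dots> \<le> s * k * (s * k) * 2 * b * 1 + (1 + 2 * k) * b * (s * k * (s * k) * 2)
          + 4 * (s * k * b * (s * k))"
      proof (intro add_mono)
        show "norm (F * x * w') \<le> s * k * (s * k) * 2 * b * 1" by (intro norm_mult_le_mult F nx nw)
        show "norm ((1 + 2 *\<^sub>R j) * x * F') \<le> (1 + 2 * k) * b * (s * k * (s * k) * 2)"
          by (intro norm_mult_le_mult F nx n1)
        have "norm (j * x * j) \<le> s * k * b * (s * k)" by (intro norm_mult_le_mult nj nx)
        then show "norm (4 *\<^sub>R (j * x * j)) \<le> 4 * (s * k * b * (s * k))" by simp
      qed
      also have "\<dots> = c1 * s\<^sup>2" by (simp add: c1_def power2_eq_square algebra_simps)
      finally show ?thesis .
    qed
    have nd: "norm ?d \<le> c2 * s"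
    proof -
      have "norm ?d \<le> norm (2 *\<^sub>R (j * x - x * j)) + norm R" unfolding d by (rule norm_triangle_ineq)
      also have "norm (2 *\<^sub>R (j * x - x * j)) \<le> 2 * (norm (j * x) + norm (x * j))"
        using norm_triangle_ineq4 [of "j * x" "x * j"] by simp
      also have "\<dots> \<le> 2 * (s * k * b + b * (s * k))"
        by (intro mult_left_mono add_mono norm_mult_le_mult nj nx) auto
      also have "norm R \<le> c1 * s" 
      proof -
        have "s\<^sup>2 \<le> s" using s by (simp add: power2_eq_square mult_left_le)
        then show ?thesis using nR c1 by (meson mult_left_mono order_trans)
      qed
      finally show ?thesis by (simp add: c2_def algebra_simps)
    qed
    have "t (z * ?d) = 2 * s * (n2 K)\<^sup>2 + t (z * R)"
    proof -
      have "z * ?d = z * (2 *\<^sub>R (j * x - x * j) + R)" by (simp only: d)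
      also have "\<dots> = (- 2 * s) *\<^sub>R (z * (K * x - x * K)) + z * R"
        by (simp add: j_def algebra_simps scaleR_diff_right)
      finally have "z * ?d = (- 2 * s) *\<^sub>R (z * (K * x - x * K)) + z * R" .
      then have "t (z * ?d) = - 2 * s * t (z * (K * x - x * K)) + t (z * R)"
        using z x KN RN by (simp add: t_diff t_scaleR)
      moreover have "t (z * (K * x - x * K)) = t (z * (K * x)) - t (z * x * K)"
        using z x KN by (simp add: right_diff_distrib mult.assoc t_diff)
      moreover have "t (z * (K * x)) = t (K * (x * z))"
        using t_comm [of z "K * x"] z x KN by (simp add: mult.assoc)
      moreover have "t (z * x * K) = t (K * (z * x))" using z x KN by (intro t_comm) auto
      moreover have "t (K * (x * z)) - t (K * (z * x)) = t (K * K)"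
        using z x KN by (simp add: t_diff [symmetric] right_diff_distrib [symmetric] K_def [symmetric])
      moreover have "(n2 K)\<^sup>2 = - t (K * K)"
        using KN by (simp add: n2_square star_eq [OF Ks] t_minus)
      ultimately show ?thesis by simp
    qed
    moreover have "- (c1 / (2 * a) * s\<^sup>2) \<le> t (z * R)"
    proof -
      have "\<bar>t (z * R)\<bar> \<le> norm (z * R)" using z RN by (intro t_le_norm) auto
      also have "\<dots> \<le> 1 / (2 * a) * (c1 * s\<^sup>2)" by (intro norm_mult_le_mult z nR)
      finally show ?thesis by simp
    qed
    moreover have "L ?u + t (z * ?d) - (norm ?d)\<^sup>2 / (2 * a)\<^sup>2 \<le> L (w * x * w' + y)"
      unfolding z_def using w x y
      by (intro L_lower [OF ab2 u] dbl op_between_unitary_conj) auto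
    moreover have "(norm ?d)\<^sup>2 / (2 * a)\<^sup>2 \<le> c2\<^sup>2 / (2 * a)\<^sup>2 * s\<^sup>2"
    proof -
      have "(norm ?d)\<^sup>2 \<le> (c2 * s)\<^sup>2" by (intro power_mono nd) auto
      from divide_right_mono [OF this, of "(2 * a)\<^sup>2"] show ?thesis by (simp add: power_mult_distrib)
    qed
    ultimately have "L ?u + 2 * s * (n2 K)\<^sup>2 - c * s\<^sup>2 \<le> L (w * x * w' + y)"
      by (simp add: c_def algebra_simps)
    moreover have "K = defect x y" by (simp add: K_def defect_def z_def)
    ultimately show "\<exists>w\<in>N. \<exists>w'\<in>N. adjoint_pair w w' \<and> w * w' = 1 \<and> w' * w = 1 \<and>
      L (x + y) + 2 * s * (n2 (defect x y))\<^sup>2 - c * s\<^sup>2 \<le> L (w * x * w' + y)"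
      using w by blast
  qed
qed

text \<open>This bound makes the supremum in \<open>near_maximizer\<close> finite.\<close>

lemma L_le:
  assumes "0 < a" "a < b" "op_between a b x" "x \<in> N"
  shows "L x \<le> ln b"
proof -
  interpret op_interval a b x using assms by unfold_locales
  have c: "continuous_on {a..b} ln" using assms by (intro continuous_intros) auto
  have "op_between (ln a) (ln b) (fc ln x)" using assms by (intro fc_between c) auto
  then have "0 \<le> inner (ap (ln b *\<^sub>R 1 - fc ln x) v) v" for v
    by (simp add: op_between_def ap_simps inner_diff_left power2_norm_eq_inner)
  moreover have "selfadj (ln b *\<^sub>R 1 - fc ln x)" by (intro adjoint_pair_intros fc_selfadj c)
  moreover have "fc ln x \<in> N" using assms c by (intro fc_N) auto
  ultimately have "0 \<le> t (ln b *\<^sub>R 1 - fc ln x)" by (intro t_nonneg) auto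
  then show ?thesis using \<open>fc ln x \<in> N\<close> by (simp add: L_def t_diff t_scaleR t_one)
qed

text \<open>If the defect exceeded \<open>d\<close>, one step of \<open>unitary_ascent\<close> would
  lift \<open>L (x' + y)\<close> above the supremum. As the supremum is only approached, the error
  \<open>e\<close> has to be at most \<open>s * d\<^sup>2\<close>, the scale of the possible
  gain.\<close>

lemma near_maximizer:
  assumes ab: "0 < a" "a < b" and x: "op_between a b x" "x \<in> N" and y: "op_between a b y" "y \<in> N"
    and d: "0 < d"
  obtains x' where "x' \<in> spectral_class a b x" "L (x + y) \<le> L (x' + y) + d" "n2 (defect x' y) \<le> d"
proof -
  obtain c where c0: "0 \<le> c" and c: "\<And>x y s. op_between a b x \<Longrightarrow> x \<in> N \<Longrightarrow> op_between a b y \<Longrightarrow> y \<in> N \<Longrightarrow>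
    0 \<le> s \<Longrightarrow> s \<le> 1 \<Longrightarrow> \<exists>w\<in>N. \<exists>w'\<in>N. adjoint_pair w w' \<and> w * w' = 1 \<and> w' * w = 1 \<and>
      L (x + y) + 2 * s * (n2 (defect x y))\<^sup>2 - c * s\<^sup>2 \<le> L (w * x * w' + y)"
    using unitary_ascent [OF ab] by blast
  \<comment> \<open>The step length makes the quadratic loss \<open>c * s\<^sup>2\<close> at most
    \<open>s * d\<^sup>2\<close>; the denominator \<open>c + 1\<close> avoids division by
    zero.\<close>
  define s where "s = min 1 (d\<^sup>2 / (c + 1))"
  have s: "0 < s" "s \<le> 1" "c * s \<le> d\<^sup>2"
  proof -
    show "0 < s" "s \<le> 1" using d c0 by (auto simp: s_def)
    then have "c * s \<le> (c + 1) * s" by simp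
    also have "\<dots> \<le> (c + 1) * (d\<^sup>2 / (c + 1))" using c0 by (intro mult_left_mono) (auto simp: s_def)
    finally show "c * s \<le> d\<^sup>2" using c0 by simp
  qed
  define e where "e = min d (s * d\<^sup>2)"
  have e: "0 < e" "e \<le> d" "e \<le> s * d\<^sup>2" using s d by (auto simp: e_def)
  let ?V = "(\<lambda>z. L (z + y)) ` spectral_class a b x"
  have xin: "x \<in> spectral_class a b x" using x by (simp add: spectral_class_def)
  have bdd: "bdd_above ?V"
  proof (rule bdd_aboveI2)
    fix z assume "z \<in> spectral_class a b x"
    then have "op_between (a + a) (b + b) (z + y)" "z + y \<in> N"
      using y op_between_add [of a b z a b y] by (auto simp: spectral_class_def)
    then show "L (z + y) \<le> ln (b + b)" using ab by (intro L_le) auto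
  qed
  have "Sup ?V - e < Sup ?V" using e by simp
  then obtain x' where x': "x' \<in> spectral_class a b x" "Sup ?V - e < L (x' + y)"
    using less_cSup_iff [of ?V "Sup ?V - e"] xin bdd by blast
  have up: "L (z + y) \<le> L (x' + y) + e" if "z \<in> spectral_class a b x" for z
    using cSup_upper [OF imageI [OF that, of "\<lambda>z. L (z + y)"] bdd] x'(2) by simp
  have x'N: "op_between a b x'" "x' \<in> N" using x' by (auto simp: spectral_class_def)
  obtain w w' where w: "w \<in> N" "w' \<in> N" "adjoint_pair w w'" "w * w' = 1" "w' * w = 1"
    and asc: "L (x' + y) + 2 * s * (n2 (defect x' y))\<^sup>2 - c * s\<^sup>2 \<le> L (w * x' * w' + y)"
    using c [OF x'N y, of s] s by auto
  have "L (w * x' * w' + y) \<le> L (x' + y) + e" by (rule up [OF spectral_class_conj [OF x'(1) w]])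
  with asc have "2 * s * (n2 (defect x' y))\<^sup>2 \<le> s * d\<^sup>2 + s * (c * s)"
    using e by (simp add: power2_eq_square algebra_simps)
  also have "\<dots> \<le> s * d\<^sup>2 + s * d\<^sup>2" using s by (intro add_left_mono mult_left_mono) auto
  finally have "s * (n2 (defect x' y))\<^sup>2 \<le> s * d\<^sup>2" by simp
  then have "(n2 (defect x' y))\<^sup>2 \<le> d\<^sup>2" using s by simp
  then have "n2 (defect x' y) \<le> d" by (rule power2_le_imp_le) (use d in simp)
  moreover have "L (x + y) \<le> L (x' + y) + d" using up [OF xin] e by simp
  ultimately show ?thesis using that x' by blast
qed

text \<open>Multiplying the defect by \<open>x + y\<close> on both sides gives
  \<open>(x + y) * x - x * (x + y) = y * x - x * y\<close>, and
  \<open>norm (x + y) \<le> 2 * b\<close>.\<close>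

lemma n2_commutator_le_defect:
  assumes ab: "0 < a" "a < b" and x: "op_between a b x" "x \<in> N" and y: "op_between a b y" "y \<in> N"
  shows "n2 (y * x - x * y) \<le> (2 * b)\<^sup>2 * n2 (defect x y)"
proof -
  let ?u = "x + y"
  have u: "op_between (2 * a) (2 * b) ?u" "?u \<in> N" using op_between_add [OF x(1) y(1)] x y by simp_all
  interpret U: op_interval "2 * a" "2 * b" ?u using u ab by unfold_locales auto
  let ?z = "fc inverse ?u"
  have z: "?u * ?z = 1" "?z * ?u = 1" using U.fc_inverse ab by auto
  have "continuous_on {2 * a..2 * b} (inverse :: real \<Rightarrow> real)" using ab by (intro continuous_intros) auto
  then have zN: "?z \<in> N" using fc_N [OF u(1) _ _ u(2)] ab by auto
  have nu: "norm ?u \<le> 2 * b" using ab by (intro op_between_norm_le [OF u(1)]) auto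
  have "?u * defect x y * ?u = ?u * x * (?z * ?u) - (?u * ?z) * x * ?u"
    by (simp only: defect_def right_diff_distrib left_diff_distrib mult.assoc)
  also have "\<dots> = y * x - x * y" unfolding z by (simp add: algebra_simps)
  finally have "n2 (y * x - x * y) = n2 (?u * defect x y * ?u)" by simp
  also have "\<dots> \<le> n2 (?u * defect x y) * norm ?u"
    using u x zN by (intro n2_mult_right) (auto simp: defect_def)
  also have "\<dots> \<le> norm ?u * n2 (defect x y) * norm ?u"
    using u x zN by (intro mult_right_mono n2_mult_left) (auto simp: defect_def)
  also have "\<dots> \<le> 2 * b * n2 (defect x y) * (2 * b)"
    using nu ab x zN by (intro mult_mono mult_nonneg_nonneg n2_nonneg) (auto simp: defect_def)
  finally show ?thesis by (simp add: power2_eq_square algebra_simps)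
qed

end

section \<open>The triangle inequality\<close>

lemma self_le_sinh: "0 \<le> x \<Longrightarrow> x \<le> sinh (x :: real)"
proof -
  assume x: "0 \<le> x"
  have "sinh 0 - 0 \<le> sinh x - x"
  proof (rule DERIV_nonneg_imp_nondecreasing [OF x])
    fix y :: real
    have "((\<lambda>y. sinh y - y) has_real_derivative cosh y - 1) (at y)"
      by (auto intro!: derivative_eq_intros)
    moreover have "0 \<le> cosh y - 1" by (simp add: cosh_real_ge_1)
    ultimately show "\<exists>d. ((\<lambda>y. sinh y - y) has_real_derivative d) (at y) \<and> 0 \<le> d" by blast
  qed
  then show ?thesis by simp
qed

text \<open>The difference has derivative \<open>(sinh y * cosh y - y) / (cosh y)\<^sup>2\<close>,
  nonnegative since \<open>y \<le> sinh y\<close>.\<close>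

lemma mult_tanh_le: "0 \<le> x \<Longrightarrow> x * tanh x \<le> 2 * ln (cosh (x :: real))"
proof -
  assume x: "0 \<le> x"
  have "2 * ln (cosh 0) - 0 * tanh 0 \<le> 2 * ln (cosh x) - x * tanh x"
  proof (rule DERIV_nonneg_imp_nondecreasing [OF x])
    fix y :: real assume y: "0 \<le> y"
    have c: "cosh y > 0" by simp
    have "((\<lambda>y. 2 * ln (cosh y) - y * tanh y) has_real_derivative
      2 * (sinh y / cosh y) - (tanh y + y * (1 - (tanh y)\<^sup>2))) (at y)"
      using c by (auto intro!: derivative_eq_intros simp: divide_inverse)
    moreover have "2 * (sinh y / cosh y) - (tanh y + y * (1 - (tanh y)\<^sup>2)) = (sinh y * cosh y - y) / (cosh y)\<^sup>2"
    proof -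
      have e: "1 - (tanh y)\<^sup>2 = 1 / (cosh y)\<^sup>2"
        using c by (simp add: tanh_def power_divide sinh_square_eq diff_divide_distrib)
      show ?thesis unfolding e using c by (simp add: tanh_def diff_divide_distrib power2_eq_square)
    qed
    moreover have "y * 1 \<le> sinh y * cosh y"
      using y self_le_sinh [OF y] by (intro mult_mono) (auto simp: cosh_real_ge_1)
    ultimately show "\<exists>d. ((\<lambda>y. 2 * ln (cosh y) - y * tanh y) has_real_derivative d) (at y) \<and> 0 \<le> d"
      by (metis (no_types, lifting) diff_ge_0_iff_ge mult.right_neutral zero_le_divide_iff zero_le_power2)
  qed
  then show ?thesis by simp
qed

text \<open>Cleared form of the monotonicity of \<open>ln (cosh y) / y\<^sup>2\<close>, whose
  derivative has the sign of \<open>y * tanh y - 2 * ln (cosh y)\<close>.\<close>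

lemma ln_cosh_ratio:
  fixes x z :: real
  assumes "0 < x" "x \<le> z"
  shows "x\<^sup>2 * ln (cosh z) \<le> z\<^sup>2 * ln (cosh x)"
proof -
  have "ln (cosh z) / z\<^sup>2 \<le> ln (cosh x) / x\<^sup>2"
  proof (rule DERIV_nonpos_imp_nonincreasing [OF assms(2)])
    fix y assume "x \<le> y"
    then have y: "0 < y" using assms by simp
    have "((\<lambda>y. ln (cosh y)) has_real_derivative sinh y / cosh y) (at y)"
      by (auto intro!: derivative_eq_intros simp: divide_inverse)
    moreover have "((\<lambda>y. y\<^sup>2) has_real_derivative 2 * y) (at y)"
      by (auto intro!: derivative_eq_intros)
    ultimately have "((\<lambda>y. ln (cosh y) / y\<^sup>2) has_real_derivative
      (sinh y / cosh y * y\<^sup>2 - ln (cosh y) * (2 * y)) / (y\<^sup>2 * y\<^sup>2)) (at y)"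
      by (rule DERIV_divide) (use y in simp)
    moreover have "sinh y / cosh y * y\<^sup>2 - ln (cosh y) * (2 * y) = y * (y * tanh y - 2 * ln (cosh y))"
      by (simp add: tanh_def power2_eq_square algebra_simps)
    moreover have "y * (y * tanh y - 2 * ln (cosh y)) \<le> 0"
      using y mult_tanh_le [of y] by (intro mult_nonneg_nonpos) auto
    ultimately show "\<exists>d. ((\<lambda>y. ln (cosh y) / y\<^sup>2) has_real_derivative d) (at y) \<and> d \<le> 0"
      by (metis divide_nonpos_nonneg zero_le_mult_iff zero_le_power2)
  qed
  then show ?thesis using assms by (simp add: field_simps)
qed

text \<open>A function \<open>S\<close> with \<open>S w / w\<close> nonincreasing is subadditive on
  positive arguments. Other signs reduce to this case because \<open>ln (cosh w)\<close> is even and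
  increases with \<open>\<bar>w\<bar>\<close>.\<close>

lemma sqrt_ln_cosh_triangle:
  fixes x y :: real
  shows "sqrt (ln (cosh (x + y))) \<le> sqrt (ln (cosh x)) + sqrt (ln (cosh y))"
proof -
  have nn: "0 \<le> ln (cosh w)" for w :: real by (simp add: cosh_real_ge_1)
  have pos: "sqrt (ln (cosh (u + v))) \<le> sqrt (ln (cosh u)) + sqrt (ln (cosh v))"
    if uv: "0 < u" "0 < v" for u v :: real
  proof -
    let ?S = "\<lambda>w. sqrt (ln (cosh w))"
    have r: "w * ?S (u + v) \<le> (u + v) * ?S w" if "0 < w" "w \<le> u + v" for w
    proof (rule power2_le_imp_le)
      show "(w * ?S (u + v))\<^sup>2 \<le> ((u + v) * ?S w)\<^sup>2"
        using ln_cosh_ratio [OF that] nn by (simp add: power_mult_distrib)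
    qed (use nn uv in auto)
    have "(u + v) * ?S (u + v) \<le> (u + v) * (?S u + ?S v)"
      using r [of u] r [of v] uv by (simp add: algebra_simps)
    then show ?thesis using uv by simp
  qed
  have abs: "ln (cosh \<bar>w\<bar>) = ln (cosh w)" for w :: real by (simp add: abs_if)
  have "cosh \<bar>x + y\<bar> \<le> cosh (\<bar>x\<bar> + \<bar>y\<bar>)"
    by (subst cosh_real_nonneg_le_iff) auto
  then have "ln (cosh (x + y)) \<le> ln (cosh (\<bar>x\<bar> + \<bar>y\<bar>))"
    unfolding abs [of "x + y", symmetric] by simp
  then have "sqrt (ln (cosh (x + y))) \<le> sqrt (ln (cosh (\<bar>x\<bar> + \<bar>y\<bar>)))" by simp
  also have "\<dots> \<le> sqrt (ln (cosh \<bar>x\<bar>)) + sqrt (ln (cosh \<bar>y\<bar>))"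
    using pos [of "\<bar>x\<bar>" "\<bar>y\<bar>"] by (cases "x = 0"; cases "y = 0") auto
  finally show ?thesis by (simp only: abs)
qed

definition log_mean_gap :: "real \<Rightarrow> real \<Rightarrow> real"
  where "log_mean_gap u v = ln ((u + v) / 2) - 1 / 2 * ln u - 1 / 2 * ln v"

text \<open>For \<open>u = p * p\<close> and \<open>v = q * q\<close>, the arithmetic mean divided
  by the geometric mean is \<open>(p / q + q / p) / 2\<close>, a hyperbolic cosine.\<close>

lemma log_mean_gap_eq_ln_cosh:
  assumes "0 < u" "0 < v"
  shows "log_mean_gap u v = ln (cosh ((ln u - ln v) / 2))"
proof -
  define p q where "p = exp (ln u / 2)" and "q = exp (ln v / 2)"
  have pq: "0 < p" "0 < q" by (simp_all add: p_def q_def)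
  have uv: "u = p * p" "v = q * q" using assms by (simp_all add: p_def q_def flip: exp_add)
  have l: "ln p = ln u / 2" "ln q = ln v / 2" by (simp_all add: p_def q_def)
  have "cosh ((ln u - ln v) / 2) = (p / q + q / p) / 2"
    by (simp add: cosh_def p_def q_def exp_diff [symmetric] diff_divide_distrib)
  also have "\<dots> = (u + v) / 2 / (p * q)" using pq by (simp add: uv field_simps)
  finally have "ln (cosh ((ln u - ln v) / 2)) = ln ((u + v) / 2) - (ln p + ln q)"
    using pq assms by (simp add: ln_div ln_mult)
  then show ?thesis by (simp add: log_mean_gap_def l)
qed

text \<open>Minimizing over \<open>r\<close> gives equality, so that the triangle inequality for \<open>sqrt\<close> of a divergence
  is a family of inequalities that are linear in the divergence itself.\<close>

lemma sum_square_le_weighted: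
  fixes x y r :: real
  assumes "0 < r" "r < 1"
  shows "(x + y)\<^sup>2 \<le> x\<^sup>2 / r + y\<^sup>2 / (1 - r)"
proof -
  have "x\<^sup>2 / r + y\<^sup>2 / (1 - r) - (x + y)\<^sup>2 = ((1 - r) * x - r * y)\<^sup>2 / (r * (1 - r))"
    using assms by (simp add: field_simps power2_eq_square)
  also have "\<dots> \<ge> 0" using assms by simp
  finally show ?thesis by simp
qed

lemma log_mean_gap_le_weighted:
  assumes uv: "0 < u" "0 < v" and r: "0 < r" "r < 1"
  shows "log_mean_gap u v \<le> log_mean_gap u 1 / r + log_mean_gap v 1 / (1 - r)"
proof -
  have nn: "0 \<le> ln (cosh w)" for w :: real by (simp add: cosh_real_ge_1)
  \<comment> \<open>The sum \<open>?a + ?b\<close> is half of \<open>ln u - ln v\<close>; the sign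
    of \<open>?b\<close> is harmless because \<open>cosh\<close> is even.\<close>
  let ?a = "ln u / 2" and ?b = "- ln v / 2"
  have e: "log_mean_gap u v = ln (cosh (?a + ?b))" "log_mean_gap u 1 = ln (cosh ?a)" "log_mean_gap v 1 = ln (cosh ?b)"
    using uv by (simp_all add: log_mean_gap_eq_ln_cosh diff_divide_distrib)
  have "log_mean_gap u v = (sqrt (ln (cosh (?a + ?b))))\<^sup>2" using nn by (simp add: e)
  also have "\<dots> \<le> (sqrt (ln (cosh ?a)) + sqrt (ln (cosh ?b)))\<^sup>2"
    using nn by (intro power_mono sqrt_ln_cosh_triangle) auto
  also have "\<dots> \<le> (sqrt (ln (cosh ?a)))\<^sup>2 / r + (sqrt (ln (cosh ?b)))\<^sup>2 / (1 - r)"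
    by (rule sum_square_le_weighted [OF r])
  finally show ?thesis using nn by (simp add: e)
qed

lemma sqrt_le_of_weighted:
  fixes x a b :: real
  assumes ab: "0 \<le> a" "0 \<le> b" and x: "\<And>r. 0 < r \<Longrightarrow> r < 1 \<Longrightarrow> x \<le> a / r + b / (1 - r)"
  shows "sqrt x \<le> sqrt a + sqrt b"
proof (rule field_le_epsilon)
  fix e :: real assume e: "0 < e"
  \<comment> \<open>The optimal \<open>r\<close> is \<open>sqrt a / (sqrt a + sqrt b)\<close>; the
    shift by \<open>e / 2\<close> keeps it strictly between \<open>0\<close> and \<open>1\<close>
    when \<open>a\<close> or \<open>b\<close> vanishes.\<close>
  define p q where "p = sqrt a + e / 2" and "q = sqrt b + e / 2"
  have pq: "0 < p" "0 < q" using ab e by (simp_all add: p_def q_def add_nonneg_pos)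
  have "(sqrt a)\<^sup>2 \<le> p\<^sup>2" "(sqrt b)\<^sup>2 \<le> q\<^sup>2"
    using ab e by (intro power_mono; simp add: p_def q_def)+
  then have a: "a \<le> p * p" "b \<le> q * q" using ab by (simp_all add: power2_eq_square)
  have "x \<le> a / (p / (p + q)) + b / (1 - p / (p + q))" using pq by (intro x) auto
  also have "1 - p / (p + q) = q / (p + q)" using pq by (simp add: field_simps)
  also have "a / (p / (p + q)) + b / (q / (p + q)) \<le> (p * p) / (p / (p + q)) + (q * q) / (q / (p + q))"
    using pq a by (intro add_mono divide_right_mono) auto
  also have "\<dots> = (p + q)\<^sup>2" using pq by (simp add: field_simps power2_eq_square)
  finally have "sqrt x \<le> sqrt ((p + q)\<^sup>2)" by (rule real_sqrt_le_mono)
  then show "sqrt x \<le> sqrt a + sqrt b + e" using pq by (simp add: p_def q_def)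
qed

lemma continuous_on_log_mean_gap: "0 < a \<Longrightarrow> 0 < v \<Longrightarrow> continuous_on {a..b} (\<lambda>u. log_mean_gap u v)"
  unfolding log_mean_gap_def by (intro continuous_intros) auto

section \<open>The triangle inequality in a tracial algebra\<close>

context tracial_algebra
begin

lemma L_half:
  assumes ab: "0 < a" "a < b" and x: "op_between a b x" "x \<in> N"
  shows "L ((1 / 2) *\<^sub>R x) = t (fc (\<lambda>r. ln (r / 2)) x)"
proof -
  interpret op_interval a b x using assms by unfold_locales
  have e: "peval [:0, 1 / 2:] x = (1 / 2) *\<^sub>R x" by simp
  have "op_between (1 / 2 * a) (1 / 2 * b) ((1 / 2) *\<^sub>R x)" by (intro op_between_scaleR x) simp
  then have "fc ln (peval [:0, 1 / 2:] x) = fc (\<lambda>r. ln (poly [:0, 1 / 2:] r)) x"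
    unfolding e [symmetric] using ab by (intro fc_pcompose [of "1 / 2 * a" "1 / 2 * b"] continuous_intros) auto
  then show ?thesis by (simp add: L_def)
qed

lemma D_one:
  assumes ab: "0 < a" "a < b" and x: "op_between a b x" "x \<in> N"
  shows "D x 1 = t (fc (\<lambda>u. log_mean_gap u 1) x)"
proof -
  interpret op_interval a b x using assms by unfold_locales
  have e: "peval [:1 / 2, 1 / 2:] x = (1 / 2) *\<^sub>R (x + 1)" by (simp add: scaleR_add_right)
  have "op_between (1 / 2 * (a + 1)) (1 / 2 * (b + 1)) ((1 / 2) *\<^sub>R (x + 1))"
    using op_between_scalar [of 1] by (intro op_between_scaleR op_between_add x) auto
  then have 1: "fc ln (peval [:1 / 2, 1 / 2:] x) = fc (\<lambda>r. ln (poly [:1 / 2, 1 / 2:] r)) x"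
    unfolding e [symmetric] using ab
    by (intro fc_pcompose [of "1 / 2 * (a + 1)" "1 / 2 * (b + 1)"] continuous_intros) auto
  \<comment> \<open>Here \<open>1\<close> is treated as a constant polynomial in \<open>x\<close>,
    so that \<open>fc_pcompose\<close> yields \<open>L 1 = 0\<close>.\<close>
  have "op_between (1 / 2) 2 (1 *\<^sub>R (1 :: 'h endo))" by (rule op_between_mono [OF op_between_scalar]) auto
  then have 2: "fc ln (peval [:1:] x) = fc (\<lambda>r. ln (poly [:1:] r)) x"
    by (intro fc_pcompose [of "1 / 2" 2] continuous_intros) auto
  then have L1: "L 1 = 0" by (simp add: L_def)
  have c: "continuous_on {a..b} ln" "continuous_on {a..b} (\<lambda>r. ln (r / 2 + 1 / 2))"
    using ab by (auto intro!: continuous_intros)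
  have "fc (\<lambda>u. log_mean_gap u 1) x = fc (\<lambda>u. ln (u / 2 + 1 / 2) - 1 / 2 * ln u) x"
    by (rule fc_cong) (simp add: log_mean_gap_def add_divide_distrib)
  also have "\<dots> = fc (\<lambda>r. ln (r / 2 + 1 / 2)) x - (1 / 2) *\<^sub>R fc ln x"
    by (simp only: fc_diff [OF c(2) continuous_on_mult [OF continuous_on_const c(1)]] fc_scale [OF c(1)])
  finally have "t (fc (\<lambda>u. log_mean_gap u 1) x) = t (fc (\<lambda>r. ln (r / 2 + 1 / 2)) x) - 1 / 2 * L x"
    using fc_N [OF x(1) lt _ x(2)] c by (simp add: t_diff t_scaleR L_def)
  moreover have "L ((1 / 2) *\<^sub>R (x + 1)) = t (fc (\<lambda>r. ln (r / 2 + 1 / 2)) x)"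
    using 1 unfolding e by (simp add: L_def add.commute)
  ultimately show ?thesis by (simp add: D_def L1)
qed

text \<open>Once \<open>1 / 2 * L x\<close> and \<open>1 / 2 * L y\<close> are moved to the right,
  the right-hand side depends on the two spectral distributions only and the left-hand side is the
  joint term alone, so the element from \<open>near_maximizer\<close> may take the place of
  \<open>x\<close>.\<close>

theorem D_le_weighted:
  assumes ab: "0 < a" "a < b" and x: "op_between a b x" "x \<in> N" and y: "op_between a b y" "y \<in> N"
    and r: "0 < r" "r < 1"
  shows "D x y \<le> D x 1 / r + D y 1 / (1 - r)"
proof -
  define f where "f = (\<lambda>c u. c * log_mean_gap u 1 + 1 / 2 * ln u)"
  have cf: "continuous_on {a..b} (f c)" for c
    unfolding f_def using ab by (intro continuous_intros continuous_on_log_mean_gap) auto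
  have tf: "t (fc (f c) z) = c * D z 1 + 1 / 2 * L z" if z: "op_between a b z" "z \<in> N" for c z
  proof -
    interpret op_interval a b z using z ab by unfold_locales auto
    have cl: "continuous_on {a..b} ln" using ab by (intro continuous_intros) auto
    have cs: "continuous_on {a..b} (\<lambda>u. log_mean_gap u 1)" using ab by (intro continuous_on_log_mean_gap) auto
    have "fc (f c) z = c *\<^sub>R fc (\<lambda>u. log_mean_gap u 1) z + (1 / 2) *\<^sub>R fc ln z"
      unfolding f_def
      by (simp only: fc_add [OF continuous_on_mult [OF continuous_on_const cs] continuous_on_mult [OF continuous_on_const cl]]
          fc_scale [OF cl] fc_scale [OF cs])
    then show ?thesis
      using fc_N [OF z(1) lt _ z(2)] cl cs D_one [OF ab z] by (simp add: t_add t_scaleR L_def)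
  qed
  have ab2: "0 < 2 * a" "2 * a < 2 * b" using ab by auto
  have dbl: "op_between (2 * a) (2 * b) (z + y)" if "op_between a b z" for z
    using op_between_add [OF that y(1)] by simp
  have key: "L ((1 / 2) *\<^sub>R (x + y)) \<le> t (fc (f (1 / r)) x) + t (fc (f (1 / (1 - r))) y) + e"
    if e: "0 < e" for e
  proof -
    define h where "h = (\<lambda>w :: real. ln (w / 2))"
    have ch: "continuous_on {2 * a..2 * b} h" unfolding h_def using ab by (intro continuous_intros) auto
    \<comment> \<open>The comparison with ordered powers is available for polynomials, so
      \<open>h\<close> is approximated. The error is spent twice: on the operator
      \<open>x' + y\<close> and on the scalars \<open>u + v\<close>.\<close>
    have "0 < e / 4" using e by simp
    from uniform_limitD [OF bern_poly_uniform_limit [OF ab2(2) ch] this]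
    obtain p where p: "\<And>w. w \<in> {2 * a..2 * b} \<Longrightarrow> \<bar>poly p w - h w\<bar> < e / 4"
      unfolding eventually_sequentially dist_real_def by blast
    obtain k where k0: "0 \<le> k" and k: "\<And>x y. x \<in> N \<Longrightarrow> y \<in> N \<Longrightarrow> norm x \<le> b \<Longrightarrow> norm y \<le> b \<Longrightarrow>
        t (peval p (x + y)) \<le> t (ordered_poly p x y) + k * n2 (y * x - x * y)"
      using ordered_poly_approx [of b p] by blast
    \<comment> \<open>With this tolerance, the loss \<open>d\<close> of near maximality and the
      commutator term \<open>k * ((2 * b)\<^sup>2 * d)\<close> add up to
      \<open>e / 4\<close>.\<close>
    define d where "d = e / (4 * (1 + k * (2 * b)\<^sup>2))"
    have kb: "0 < 1 + k * (2 * b)\<^sup>2" using k0 by (intro add_pos_nonneg) auto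
    have d: "0 < d" using e kb by (simp add: d_def)
    have "d * (1 + k * (2 * b)\<^sup>2) = e / 4" using kb by (simp add: d_def field_simps)
    then have dk: "d + k * ((2 * b)\<^sup>2 * d) = e / 4" by (simp add: algebra_simps)
    obtain x' where x': "x' \<in> spectral_class a b x" and near: "L (x + y) \<le> L (x' + y) + d"
      and defect: "n2 (defect x' y) \<le> d"
      using near_maximizer [OF ab x y d] .
    have x'N: "op_between a b x'" "x' \<in> N" using x' by (auto simp: spectral_class_def)
    have u: "op_between (2 * a) (2 * b) (z + y)" "z + y \<in> N" if "op_between a b z" "z \<in> N" for z
      using dbl that y by auto
    \<comment> \<open>Near maximality concerns \<open>L\<close> at sums, the claim concerns
      midpoints; the two differ by the constant \<open>ln 2\<close>.\<close>
    have shift: "L ((1 / 2) *\<^sub>R (z + y)) = L (z + y) - ln 2" if z: "op_between a b z" "z \<in> N" for z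
    proof -
      interpret op_interval "2 * a" "2 * b" "z + y" using u [OF z] ab2 by unfold_locales auto
      have cl: "continuous_on {2 * a..2 * b} ln" using ab by (intro continuous_intros) auto
      have "fc (\<lambda>r. ln (r / 2)) (z + y) = fc (\<lambda>r. ln r - ln 2) (z + y)"
        using ab by (intro fc_cong) (auto simp: ln_div)
      also have "\<dots> = fc ln (z + y) - ln 2 *\<^sub>R 1" using fc_diff [OF cl continuous_on_const] by simp
      finally show ?thesis
        using L_half [OF ab2 u [OF z]] fc_N [OF u(1) lt cl u(2)] z
        by (simp add: L_def t_diff t_scaleR t_one)
    qed
    interpret U: op_interval "2 * a" "2 * b" "x' + y" using u [OF x'N] ab2 by unfold_locales auto
    have fhN: "fc h (x' + y) \<in> N" using fc_N [OF u(1) U.lt ch u(2)] x'N by blast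
    have "fc (\<lambda>w. h w - poly p w) (x' + y) = fc h (x' + y) - peval p (x' + y)"
      using ch by (simp add: U.fc_diff continuous_on_poly)
    moreover have "norm (fc (\<lambda>w. h w - poly p w) (x' + y)) \<le> e / 4"
      using ch p by (intro U.fc_norm continuous_intros) (auto simp: abs_minus_commute less_imp_le)
    ultimately have "t (fc h (x' + y)) - t (peval p (x' + y)) \<le> e / 4"
      using t_le_norm [of "fc h (x' + y) - peval p (x' + y)"] fhN u [OF x'N] by (simp add: t_diff)
    moreover have "L ((1 / 2) *\<^sub>R (x' + y)) = t (fc h (x' + y))"
      unfolding h_def by (rule L_half [OF ab2 u [OF x'N]])
    moreover have "t (peval p (x' + y)) \<le> t (ordered_poly p x' y) + k * n2 (y * x' - x' * y)"
      using ab x'N y by (intro k) (auto intro: op_between_norm_le)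
    moreover have "k * n2 (y * x' - x' * y) \<le> k * ((2 * b)\<^sup>2 * d)"
    proof (rule mult_left_mono [OF _ k0])
      have "(2 * b)\<^sup>2 * n2 (defect x' y) \<le> (2 * b)\<^sup>2 * d" by (intro mult_left_mono defect) simp
      with n2_commutator_le_defect [OF ab x'N y]
      show "n2 (y * x' - x' * y) \<le> (2 * b)\<^sup>2 * d" by (rule order_trans)
    qed
    moreover have "t (ordered_poly p x' y) \<le> t (fc (f (1 / r)) x') + t (fc (f (1 / (1 - r))) y) + e / 4"
    proof -
      interpret op_pair N t a b x' y using ab x'N y by unfold_locales
      show ?thesis
      proof (rule has_expect_mono)
        show "has_expect (\<lambda>u v. poly p (u + v)) (t (ordered_poly p x' y))" by (rule has_expect_ordered_poly)
        show "has_expect (\<lambda>u v. f (1 / r) u + f (1 / (1 - r)) v + e / 4)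
            (t (fc (f (1 / r)) x') + t (fc (f (1 / (1 - r))) y) + e / 4)"
          by (intro has_expect_add has_expect_left has_expect_right has_expect_const cf)
        fix u v assume uv: "u \<in> {a..b}" "v \<in> {a..b}"
        then have "\<bar>poly p (u + v) - h (u + v)\<bar> < e / 4" by (intro p) auto
        then have "poly p (u + v) < ln ((u + v) / 2) + e / 4" unfolding h_def by arith
        moreover have "log_mean_gap u v \<le> log_mean_gap u 1 / r + log_mean_gap v 1 / (1 - r)"
          using uv ab r by (intro log_mean_gap_le_weighted) auto
        ultimately show "poly p (u + v) \<le> f (1 / r) u + f (1 / (1 - r)) v + e / 4"
          by (simp add: f_def log_mean_gap_def [of u v])
      qed
    qed
    moreover have "t (fc (f (1 / r)) x') = t (fc (f (1 / r)) x)"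
      by (rule spectral_class_fc [OF x' x ab(2) cf])
    ultimately show ?thesis using near dk e shift [OF x] shift [OF x'N] by simp
  qed
  have "L ((1 / 2) *\<^sub>R (x + y)) \<le> t (fc (f (1 / r)) x) + t (fc (f (1 / (1 - r))) y)"
    by (rule field_le_epsilon) (rule key)
  then show ?thesis unfolding tf [OF x] tf [OF y] by (simp add: D_def)
qed

text \<open>Congruence by the inverse square root of \<open>y\<close> preserves \<open>D\<close> and
  moves \<open>y\<close> to \<open>1\<close>, where the weighted inequalities hold;
  \<open>sqrt_le_of_weighted\<close> then optimizes over \<open>r\<close>.\<close>

theorem sqrt_D_triangle:
  assumes ab: "0 < a" "a < b" and x: "op_between a b x" "x \<in> N" and y: "op_between a b y" "y \<in> N"
    and z: "op_between a b z" "z \<in> N"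
  shows "sqrt (D x z) \<le> sqrt (D x y) + sqrt (D y z)"
proof -
  interpret Y: op_interval a b y using ab y by unfold_locales
  let ?f = "\<lambda>u :: real. 1 / sqrt u" and ?g = "\<lambda>u :: real. sqrt u"
  have c: "continuous_on {a..b} ?f" "continuous_on {a..b} ?g" using ab by (auto intro!: continuous_intros)
  define s s' where "s = fc ?f y" and "s' = fc ?g y"
  have s: "selfadj s" "s \<in> N" "s' \<in> N"
    using Y.fc_selfadj [OF c(1)] fc_N [OF y(1) ab(2) _ y(2)] c by (auto simp: s_def s'_def)
  have "s' * s = fc (\<lambda>u. 1) y" "s * s' = fc (\<lambda>u. 1) y" "s' * s' = fc (\<lambda>u. u) y"
    unfolding s_def s'_def using ab by (simp_all only: Y.fc_mult [symmetric] c, (intro Y.fc_cong; simp)+)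
  then have ss: "s' * s = 1" "s * s' = 1" "s' * s' = y" by simp_all
  have sys: "s * y * s = 1"
  proof -
    have "s * y * s = s * s' * (s' * s)" by (simp add: ss(3) [symmetric] mult.assoc)
    then show ?thesis by (simp add: ss)
  qed
  define c where "c = norm s' + 1"
  have c: "norm s' \<le> c" "0 < c" by (auto simp: c_def intro: add_nonneg_pos)
  define a' where "a' = a / c\<^sup>2"
  define b' where "b' = max (b * (norm s)\<^sup>2) (a' + 1)"
  have ab': "0 < a'" "a' < b'" using ab c by (auto simp: a'_def b'_def)
  have bt: "op_between a' b' (s * w * s)" "s * w * s \<in> N" if "op_between a b w" "w \<in> N" for w
    using op_between_congruence [OF that(1) _ _ s(1) ss(1) c] ab that s
    by (auto simp: a'_def b'_def intro: op_between_mono)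
  have cong: "D (s * v * s) (s * w * s) = D v w"
    if "op_between a b v" "v \<in> N" "op_between a b w" "w \<in> N" for v w
    using D_congruence [OF ab that s(1,2) ss(1,2) s(3)] .
  let ?x = "s * x * s" and ?z = "s * z * s"
  have e: "D x y = D ?x 1" "D y z = D ?z 1" "D x z = D ?x ?z"
    using cong [OF x y] cong [OF z y] cong [OF x z] D_commute [of y z] by (simp_all add: sys)
  show ?thesis
  proof (rule sqrt_le_of_weighted)
    show "0 \<le> D x y" "0 \<le> D y z" using D_nonneg [OF ab] x y z by blast+
    fix r :: real assume "0 < r" "r < 1"
    then show "D x z \<le> D x y / r + D y z / (1 - r)"
      unfolding e using D_le_weighted [OF ab' bt [OF x] bt [OF z]] by blast
  qed
qed

end

section \<open>Von Neumann algebras\<close>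

lemma cip_add_right: "cip x (y + z) = cip x y + cip x (z :: 'a::complex_hilbert_space)"
  by (metis cip_add_left cip_commute complex_cnj_add)

lemma cip_cscale_right: "cip x (cscale c y) = cnj c * cip x (y :: 'a::complex_hilbert_space)"
  by (metis cip_cscale_left cip_commute complex_cnj_mult)

lemma inner_i_left: "inner (cscale \<i> x) y = - Im (cip x (y :: 'a::complex_hilbert_space))"
  by (simp flip: Re_cip add: cip_cscale_left)

lemma inner_i_right: "inner x (cscale \<i> y) = Im (cip x (y :: 'a::complex_hilbert_space))"
  by (simp flip: Re_cip add: cip_cscale_right)

lemma norm_cscale: "norm (cscale c x) = norm c * norm (x :: 'a::complex_hilbert_space)"
proof -
  have "(norm (cscale c x))\<^sup>2 = Re (c * cnj c * cip x x)"
    by (simp add: power2_norm_eq_inner cip_cscale_left cip_cscale_right mult_ac flip: Re_cip)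
  also have "\<dots> = (norm c)\<^sup>2 * (norm x)\<^sup>2"
    by (simp add: power2_norm_eq_inner complex_norm_square [symmetric] flip: Re_cip of_real_power)
  finally show ?thesis by (simp add: power_mult_distrib [symmetric] power2_eq_iff_nonneg)
qed

lemma bounded_linear_cscale: "bounded_linear (cscale c :: 'a::complex_hilbert_space \<Rightarrow> 'a)"
proof
  show "cscale c (r *\<^sub>R x) = r *\<^sub>R cscale c x" for r and x :: 'a
    by (metis cscale_cscale cscale_of_real mult.commute)
  show "\<exists>K. \<forall>x::'a. norm (cscale c x) \<le> norm x * K"
    by (intro exI [of _ "norm c"]) (simp add: norm_cscale mult.commute)
qed (rule cscale_add_right)

lemma cscale_op_apply:
  "blinfun_apply (cscale_op c T) x = cscale c (blinfun_apply T (x :: 'a::complex_hilbert_space))"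
proof -
  have "bounded_linear (\<lambda>x. cscale c (blinfun_apply T x))"
    using bounded_linear_cscale by (rule bounded_linear_compose) (rule blinfun.bounded_linear_right)
  then show ?thesis by (simp add: cscale_op_def bounded_linear_Blinfun_apply)
qed

lemma cscale_op_of_real: "cscale_op (complex_of_real r) T = r *\<^sub>R (T :: 'a::complex_hilbert_space \<Rightarrow>\<^sub>L 'a)"
  by (rule blinfun_eqI) (simp add: cscale_op_apply cscale_of_real blinfun.scaleR_left)

lemma bounded_ops_cscale_op: "T \<in> bounded_ops \<Longrightarrow> cscale_op c T \<in> bounded_ops"
  by (simp add: bounded_ops_def cscale_op_apply cscale_cscale mult.commute)

lemma bounded_ops_id: "id_blinfun \<in> bounded_ops"
  and bounded_ops_add: "S \<in> bounded_ops \<Longrightarrow> T \<in> bounded_ops \<Longrightarrow> S + T \<in> bounded_ops"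
  and bounded_ops_compose: "S \<in> bounded_ops \<Longrightarrow> T \<in> bounded_ops \<Longrightarrow> S o\<^sub>L T \<in> bounded_ops"
  by (simp_all add: bounded_ops_def blinfun.add_left cscale_add_right)

lemma bounded_ops_lim:
  fixes X :: "nat \<Rightarrow> ('a::complex_hilbert_space \<Rightarrow>\<^sub>L 'a)"
  assumes "\<And>n. X n \<in> bounded_ops" "X \<longlonglongrightarrow> T"
  shows "T \<in> bounded_ops"
  unfolding bounded_ops_def
proof (intro CollectI allI)
  fix c and x :: 'a
  have "(\<lambda>n. blinfun_apply (X n) (cscale c x)) \<longlonglongrightarrow> blinfun_apply T (cscale c x)"
    by (intro blinfun.tendsto tendsto_const assms)
  moreover have "(\<lambda>n. cscale c (blinfun_apply (X n) x)) \<longlonglongrightarrow> cscale c (blinfun_apply T x)"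
    by (intro bounded_linear.tendsto [OF bounded_linear_cscale] blinfun.tendsto tendsto_const assms)
  moreover have "blinfun_apply (X n) (cscale c x) = cscale c (blinfun_apply (X n) x)" for n
    using assms(1) by (simp add: bounded_ops_def)
  ultimately show "blinfun_apply T (cscale c x) = cscale c (blinfun_apply T x)"
    using LIMSEQ_unique by simp
qed

lemma commutant_id: "id_blinfun \<in> commutant S"
  by (auto simp: commutant_def bounded_ops_id intro!: blinfun_eqI)

lemma commutant_add: "X \<in> commutant S \<Longrightarrow> Y \<in> commutant S \<Longrightarrow> X + Y \<in> commutant S"
  by (simp add: commutant_def bounded_ops_add bounded_bilinear.add_left [OF bounded_bilinear_blinfun_compose]
      bounded_bilinear.add_right [OF bounded_bilinear_blinfun_compose])

lemma blinfun_compose_assoc: "(X o\<^sub>L Y) o\<^sub>L Z = X o\<^sub>L (Y o\<^sub>L Z)"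
  by (rule blinfun_eqI) simp

lemma commutant_compose: "X \<in> commutant S \<Longrightarrow> Y \<in> commutant S \<Longrightarrow> X o\<^sub>L Y \<in> commutant S"
  unfolding commutant_def by (auto simp: bounded_ops_compose) (metis blinfun_compose_assoc)

lemma commutant_cscale_op:
  assumes "S \<subseteq> bounded_ops" "X \<in> commutant S"
  shows "cscale_op c X \<in> commutant S"
  unfolding commutant_def
proof (intro CollectI conjI ballI)
  show "cscale_op c X \<in> bounded_ops" using assms by (simp add: commutant_def bounded_ops_cscale_op)
  fix T assume T: "T \<in> S"
  then have "X o\<^sub>L T = T o\<^sub>L X" using assms by (simp add: commutant_def)
  then have "blinfun_apply X (blinfun_apply T v) = blinfun_apply T (blinfun_apply X v)" for v
    by (metis blinfun_apply_blinfun_compose)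
  then show "cscale_op c X o\<^sub>L T = T o\<^sub>L cscale_op c X"
    using T assms(1) by (auto intro!: blinfun_eqI simp: cscale_op_apply bounded_ops_def)
qed

lemma commutant_lim:
  assumes "\<And>n. X n \<in> commutant S" "X \<longlonglongrightarrow> T"
  shows "T \<in> commutant S"
  unfolding commutant_def
proof (intro CollectI conjI ballI)
  show "T \<in> bounded_ops"
    using assms(1) unfolding commutant_def by (intro bounded_ops_lim [OF _ assms(2)]) blast
  fix Y assume "Y \<in> S"
  then have "X n o\<^sub>L Y = Y o\<^sub>L X n" for n using assms(1) by (simp add: commutant_def)
  moreover have "(\<lambda>n. X n o\<^sub>L Y) \<longlonglongrightarrow> (T o\<^sub>L Y)" "(\<lambda>n. Y o\<^sub>L X n) \<longlonglongrightarrow> (Y o\<^sub>L T)"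
    by (intro bounded_bilinear.tendsto [OF bounded_bilinear_blinfun_compose] tendsto_const assms)+
  ultimately show "T o\<^sub>L Y = Y o\<^sub>L T" using LIMSEQ_unique by simp
qed

lemma ap_Endo [simp]: "ap (Endo T) v = blinfun_apply T v"
  by (simp add: ap.rep_eq Endo_inverse)

lemma rep_Endo [simp]: "rep_endo (Endo T) = T"
  by (simp add: Endo_inverse)

lemmas rep_simps = zero_endo.rep_eq one_endo.rep_eq plus_endo.rep_eq minus_endo.rep_eq
  uminus_endo.rep_eq times_endo.rep_eq scaleR_endo.rep_eq

lemma bounded_opsD: "rep_endo x \<in> bounded_ops \<Longrightarrow> ap x (cscale c v) = cscale c (ap x v)"
  by (simp add: bounded_ops_def ap.rep_eq)

text \<open>The imaginary part of \<open>cip\<close> is a real inner product with one argument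
  multiplied by \<open>\<i>\<close>, and complex linearity moves this factor through
  \<open>x\<close>.\<close>

lemma adjoint_pair_cip:
  fixes x y :: "'a::complex_hilbert_space endo"
  assumes "rep_endo x \<in> bounded_ops" "adjoint_pair x y"
  shows "cip (ap x u) v = cip u (ap y v)"
proof (rule complex_eqI)
  show "Re (cip (ap x u) v) = Re (cip u (ap y v))"
    using assms(2) by (simp add: Re_cip adjoint_pair_def)
  have "- Im (cip (ap x u) v) = inner (ap x (cscale \<i> u)) v"
    by (simp add: inner_i_left bounded_opsD [OF assms(1)])
  also have "\<dots> = - Im (cip u (ap y v))" using assms(2) by (simp add: adjoint_pair_def inner_i_left)
  finally show "Im (cip (ap x u) v) = Im (cip u (ap y v))" by simp
qed

text \<open>A complex quadratic form with real values belongs to a symmetric operator, so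
  \<open>selfadj\<close> follows from \<open>positive_op\<close>; in terms of the real form it has
  to be stated.\<close>

lemma positive_op_iff:
  fixes x :: "'a::complex_hilbert_space endo"
  shows "positive_op (rep_endo x) \<longleftrightarrow>
    rep_endo x \<in> bounded_ops \<and> selfadj x \<and> (\<forall>v. 0 \<le> inner (ap x v) v)"
proof (cases "rep_endo x \<in> bounded_ops")
  case True
  note lin = bounded_opsD [OF True]
  have q: "cip (ap x v) v \<in> \<real>\<^sub>\<ge>\<^sub>0 \<longleftrightarrow> 0 \<le> inner (ap x v) v \<and> Im (cip (ap x v) v) = 0" for v
    by (auto simp: complex_nonneg_Reals_iff Re_cip)
  have im: "Im (cip (ap x v) v) = 0" if "selfadj x" for v
  proof -
    have "cip (ap x v) v = cnj (cip (ap x v) v)"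
      using adjoint_pair_cip [OF True that, of v v] cip_commute by metis
    then show ?thesis by (metis Reals_cnj_iff complex_is_Real_iff)
  qed
  have "selfadj x" if pos: "\<And>v. cip (ap x v) v \<in> \<real>\<^sub>\<ge>\<^sub>0"
    unfolding adjoint_pair_def
  proof (intro allI)
    fix u v
    have z: "Im (cip (ap x w) w) = 0" for w using pos q by blast
    \<comment> \<open>Polarization: the mixed terms at \<open>u + cscale \<i> v\<close> have
      imaginary part \<open>Re (cip (ap x v) u) - Re (cip (ap x u) v)\<close>.\<close>
    have "Im (cip (ap x (u + cscale \<i> v)) (u + cscale \<i> v)) = 0" by (rule z)
    then have "Re (cip (ap x v) u) = Re (cip (ap x u) v)"
      by (simp add: ap.add_right lin cip_add_left cip_add_right cip_cscale_left cip_cscale_right z)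
    then show "inner (ap x u) v = inner u (ap x v)" by (simp add: Re_cip inner_commute)
  qed
  then have "(\<forall>v. cip (ap x v) v \<in> \<real>\<^sub>\<ge>\<^sub>0) \<longleftrightarrow> selfadj x \<and> (\<forall>v. 0 \<le> inner (ap x v) v)"
    using q im by blast
  then show ?thesis using True by (simp add: positive_op_def ap.rep_eq)
qed (simp add: positive_op_def)

text \<open>On the left an inverse has to be complex-linear, on the right only real-linear; the
  inverse of a complex-linear bijection is complex-linear.\<close>

lemma rspec_Endo:
  fixes T :: "'a::complex_hilbert_space \<Rightarrow>\<^sub>L 'a"
  assumes "T \<in> bounded_ops"
  shows "{r. complex_of_real r \<in> spectrum_op T} = rspec (Endo T)"
proof -
  have "(\<exists>S\<in>bounded_ops. S o\<^sub>L (T - r *\<^sub>R id_blinfun) = id_blinfun \<and>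
      (T - r *\<^sub>R id_blinfun) o\<^sub>L S = id_blinfun) \<longleftrightarrow> invertible_elem (Endo T - r *\<^sub>R 1)" for r
  proof
    assume "\<exists>S\<in>bounded_ops. S o\<^sub>L (T - r *\<^sub>R id_blinfun) = id_blinfun \<and>
      (T - r *\<^sub>R id_blinfun) o\<^sub>L S = id_blinfun"
    then obtain S where "S o\<^sub>L (T - r *\<^sub>R id_blinfun) = id_blinfun" "(T - r *\<^sub>R id_blinfun) o\<^sub>L S = id_blinfun"
      by blast
    then have "Endo S * (Endo T - r *\<^sub>R 1) = 1" "(Endo T - r *\<^sub>R 1) * Endo S = 1"
      by (simp_all add: rep_simps flip: rep_endo_inject)
    then show "invertible_elem (Endo T - r *\<^sub>R 1)" unfolding invertible_elem_def by blast
  next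
    assume "invertible_elem (Endo T - r *\<^sub>R 1)"
    then obtain y where y: "(Endo T - r *\<^sub>R 1) * y = 1" "y * (Endo T - r *\<^sub>R 1) = 1"
      unfolding invertible_elem_def by blast
    let ?x = "Endo T - r *\<^sub>R 1"
    have lin: "ap ?x (cscale c v) = cscale c (ap ?x v)" for c v
    proof -
      have "r *\<^sub>R cscale c v = cscale c (r *\<^sub>R v)"
        by (simp add: linear_scale [OF bounded_linear.linear [OF bounded_linear_cscale]])
      then show ?thesis using assms
        by (simp add: ap_simps bounded_ops_def linear_diff [OF bounded_linear.linear [OF bounded_linear_cscale]])
    qed
    have "rep_endo y \<in> bounded_ops" unfolding bounded_ops_def
    proof (intro CollectI allI)
      fix c v
      have "ap y (cscale c v) = ap y (cscale c (ap ?x (ap y v)))" using y(1) by (metis ap_mult ap_one)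
      also have "\<dots> = cscale c (ap y v)" using y(2) by (metis lin ap_mult ap_one)
      finally show "blinfun_apply (rep_endo y) (cscale c v) = cscale c (blinfun_apply (rep_endo y) v)"
        by (simp add: ap.rep_eq)
    qed
    moreover have "rep_endo y o\<^sub>L (T - r *\<^sub>R id_blinfun) = id_blinfun"
      "(T - r *\<^sub>R id_blinfun) o\<^sub>L rep_endo y = id_blinfun"
      using y by (simp_all add: rep_simps flip: rep_endo_inject)
    ultimately show "\<exists>S\<in>bounded_ops. S o\<^sub>L (T - r *\<^sub>R id_blinfun) = id_blinfun \<and>
      (T - r *\<^sub>R id_blinfun) o\<^sub>L S = id_blinfun" by blast
  qed
  then show ?thesis by (simp only: spectrum_op_def rspec_def cscale_op_of_real mem_Collect_eq)
qed

lemma poly_op_eq: "poly_op p T = rep_endo (peval p (Endo T))"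
proof -
  have pw: "((o\<^sub>L) T ^^ i) id_blinfun = rep_endo (Endo T ^ i)" for i
    by (induction i) (simp_all add: rep_simps)
  have "rep_endo (sum f I) = (\<Sum>i\<in>I. rep_endo (f i))" for f :: "nat \<Rightarrow> 'a endo" and I
    by (induction I rule: infinite_finite_induct) (simp_all add: rep_simps)
  then show ?thesis by (simp add: poly_op_def peval_altdef pw rep_simps)
qed

lemma cfc_op_eq:
  assumes T: "T \<in> bounded_ops" and x: "op_between a b (Endo T)" "a < b" "continuous_on {a..b} f"
  shows "cfc_op f T = rep_endo (fc f (Endo T))"
proof -
  let ?P = "\<lambda>y. \<forall>p. uniform_limit (rspec (Endo T)) (\<lambda>n. poly (p n)) f sequentially
    \<longrightarrow> (\<lambda>n. peval (p n) (Endo T)) \<longlonglongrightarrow> y"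
  have P: "?P (fc f (Endo T))" unfolding fc_def by (rule theI' [OF fc_spec [OF x]])
  have tr: "(\<lambda>n. poly_op (p n) T) \<longlonglongrightarrow> S \<longleftrightarrow> (\<lambda>n. peval (p n) (Endo T)) \<longlonglongrightarrow> Endo S" for p S
    using tendsto_rep_endo_iff [of "\<lambda>n. peval (p n) (Endo T)" "Endo S"] by (simp add: poly_op_eq)
  show ?thesis unfolding cfc_op_def rspec_Endo [OF T] tr
  proof (rule the_equality)
    show "?P (Endo (rep_endo (fc f (Endo T))))" using P by (simp add: rep_endo_inverse)
    fix S assume "?P (Endo S)"
    then have "Endo S = fc f (Endo T)" using P fc_spec [OF x] by blast
    then show "S = rep_endo (fc f (Endo T))" by (metis rep_Endo)
  qed
qed

section \<open>The tracial algebra of a von Neumann algebra\<close>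

locale vn_trace =
  fixes M :: "('h::complex_hilbert_space \<Rightarrow>\<^sub>L 'h) set" and \<tau> :: "('h \<Rightarrow>\<^sub>L 'h) \<Rightarrow> complex"
  assumes vn: "von_neumann_algebra M"
    and state: "state_on M \<tau>" and faithful: "faithful_on M \<tau>" and tracial: "tracial_on M \<tau>"
begin

lemma M_bounded: "T \<in> M \<Longrightarrow> T \<in> bounded_ops"
  using vn by (auto simp: von_neumann_algebra_def)

lemma M_commutant: "M = commutant (commutant M)" "commutant M \<subseteq> bounded_ops"
  using vn by (auto simp: von_neumann_algebra_def commutant_def)

lemma M_id: "id_blinfun \<in> M"
  and M_add: "S \<in> M \<Longrightarrow> T \<in> M \<Longrightarrow> S + T \<in> M"
  and M_compose: "S \<in> M \<Longrightarrow> T \<in> M \<Longrightarrow> S o\<^sub>L T \<in> M"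
  and M_cscale: "S \<in> M \<Longrightarrow> cscale_op c S \<in> M"
  and M_scaleR: "S \<in> M \<Longrightarrow> r *\<^sub>R S \<in> M"
  and M_lim: "(\<And>n. X n \<in> M) \<Longrightarrow> X \<longlonglongrightarrow> T \<Longrightarrow> T \<in> M"
  using commutant_id commutant_add commutant_compose commutant_cscale_op [OF M_commutant(2)] commutant_lim
    commutant_cscale_op [OF M_commutant(2), of _ "complex_of_real r", unfolded cscale_op_of_real]
  by (metis M_commutant(1))+

lemma M_diff: "S \<in> M \<Longrightarrow> T \<in> M \<Longrightarrow> S - T \<in> M"
  using M_add [of S "- T"] M_scaleR [of T "- 1"] by simp

lemma tau_add: "S \<in> M \<Longrightarrow> T \<in> M \<Longrightarrow> \<tau> (S + T) = \<tau> S + \<tau> T"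
  and tau_cscale: "S \<in> M \<Longrightarrow> \<tau> (cscale_op c S) = c * \<tau> S"
  and tau_pos: "S \<in> M \<Longrightarrow> positive_op S \<Longrightarrow> \<tau> S \<in> \<real>\<^sub>\<ge>\<^sub>0"
  and tau_id: "\<tau> id_blinfun = 1"
  using state by (auto simp: state_on_def)

lemma tau_scaleR: "S \<in> M \<Longrightarrow> \<tau> (r *\<^sub>R S) = complex_of_real r * \<tau> S"
  using tau_cscale [of S "complex_of_real r"] by (simp add: cscale_op_of_real)

text \<open>Adding \<open>norm x\<close> times the identity makes \<open>x\<close> positive, and the
  trace of a positive element is real.\<close>

lemma Im_tau_selfadj:
  assumes x: "rep_endo x \<in> M" "selfadj x"
  shows "Im (\<tau> (rep_endo x)) = 0"
proof -
  let ?y = "x + norm x *\<^sub>R 1"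
  have y: "rep_endo ?y = rep_endo x + norm x *\<^sub>R id_blinfun" by (simp add: rep_simps)
  have "op_between (- norm x + norm x) (norm x + norm x) ?y"
    by (intro op_between_add selfadj_op_between_norm op_between_scalar x)
  then have "selfadj ?y" "\<And>v. 0 \<le> inner (ap ?y v) v" by (auto simp: op_between_def)
  moreover have yM: "rep_endo ?y \<in> M" unfolding y by (intro M_add M_scaleR M_id x)
  ultimately have "\<tau> (rep_endo ?y) \<in> \<real>\<^sub>\<ge>\<^sub>0"
    using M_bounded by (intro tau_pos) (auto simp: positive_op_iff)
  then have "Im (\<tau> (rep_endo ?y)) = 0" by (simp add: complex_nonneg_Reals_iff)
  then show ?thesis unfolding y using x M_id by (simp add: tau_add M_scaleR tau_scaleR tau_id)
qed

text \<open>The adjoint is asked for as a witness in \<open>M\<close>, which avoids the definite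
  description behind \<open>adj_op\<close>.\<close>

definition N :: "'h endo set"
  where "N = {x. rep_endo x \<in> M \<and> (\<exists>y. rep_endo y \<in> M \<and> adjoint_pair x y)}"

definition t :: "'h endo \<Rightarrow> real"
  where "t x = Re (\<tau> (rep_endo x))"

lemma N_M: "x \<in> N \<Longrightarrow> rep_endo x \<in> M"
  by (simp add: N_def)

lemma selfadj_N: "rep_endo x \<in> M \<Longrightarrow> selfadj x \<Longrightarrow> x \<in> N"
  by (auto simp: N_def)

text \<open>For \<open>k = x - y\<close> skew-adjoint, \<open>\<i> k\<close> is self-adjoint, so that \<open>\<tau> k\<close> is imaginary.\<close>

lemma t_adjoint:
  assumes xy: "rep_endo x \<in> M" "rep_endo y \<in> M" "adjoint_pair x y"
  shows "t x = t y"
proof -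
  define k where "k = x - y"
  have kM: "rep_endo k \<in> M" using xy by (simp add: k_def rep_simps M_diff)
  have "adjoint_pair (x - y) (y - x)" using xy by (intro adjoint_pair_diff adjoint_pair_commute [OF xy(3)]) auto
  then have ks: "adjoint_pair k (- k)" by (simp add: k_def)
  have "selfadj (Endo (cscale_op \<i> (rep_endo k)))"
    unfolding adjoint_pair_def
  proof (intro allI)
    fix u v
    have "cip (ap k u) v = - cip u (ap k v)"
      using adjoint_pair_cip [OF M_bounded [OF kM] ks, of u v] cip_cscale_right [of u "- 1" "ap k v"]
        cscale_of_real [of "- 1" "ap k v"] by (simp add: ap_simps)
    then show "inner (ap (Endo (cscale_op \<i> (rep_endo k))) u) v = inner u (ap (Endo (cscale_op \<i> (rep_endo k))) v)"
      by (simp add: cscale_op_apply inner_i_left inner_i_right flip: ap.rep_eq)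
  qed
  then have "Im (\<tau> (cscale_op \<i> (rep_endo k))) = 0"
    using Im_tau_selfadj [of "Endo (cscale_op \<i> (rep_endo k))"] M_cscale [OF kM] by simp
  then have "Re (\<tau> (rep_endo k)) = 0" using tau_cscale [OF kM] by simp
  moreover have "\<tau> (rep_endo x) = \<tau> (rep_endo k) + \<tau> (rep_endo y)"
    using tau_add [OF kM xy(2)] by (simp add: k_def rep_simps)
  ultimately show ?thesis by (simp add: t_def)
qed

sublocale tracial_algebra N t
proof
  show "1 \<in> N" by (rule selfadj_N) (simp_all add: rep_simps M_id adjoint_pair_1)
  fix x y :: "'h endo" and c :: real
  show "x + y \<in> N" if "x \<in> N" "y \<in> N"
    using that unfolding N_def by (auto simp: rep_simps) (metis M_add adjoint_pair_add plus_endo.rep_eq)+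
  show "c *\<^sub>R x \<in> N" if "x \<in> N"
    using that unfolding N_def by (auto simp: rep_simps) (metis M_scaleR adjoint_pair_scaleR scaleR_endo.rep_eq)+
  show "x * y \<in> N" if "x \<in> N" "y \<in> N"
    using that unfolding N_def by (auto simp: rep_simps) (metis M_compose adjoint_pair_mult times_endo.rep_eq)+
  show "\<exists>y\<in>N. adjoint_pair x y" if "x \<in> N"
    using that unfolding N_def using adjoint_pair_commute by blast
  show "x \<in> N" if "\<And>n. X n \<in> N" "X \<longlonglongrightarrow> x" "selfadj x" for X
  proof (rule selfadj_N [OF _ that(3)])
    show "rep_endo x \<in> M"
      using N_M [OF that(1)] that(2) [folded tendsto_rep_endo_iff] by (rule M_lim)
  qed
  show "t (x + y) = t x + t y" if "x \<in> N" "y \<in> N"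
    using that N_M by (simp add: t_def rep_simps tau_add)
  show "t (c *\<^sub>R x) = c * t x" if "x \<in> N"
    using that N_M by (simp add: t_def rep_simps tau_scaleR)
  show "t (x * y) = t (y * x)" if "x \<in> N" "y \<in> N"
    using that N_M tracial by (simp add: t_def rep_simps tracial_on_def)
  show "t 1 = 1" by (simp add: t_def rep_simps tau_id)
  have pos: "\<tau> (rep_endo x) \<in> \<real>\<^sub>\<ge>\<^sub>0 \<and> positive_op (rep_endo x)"
    if "x \<in> N" "selfadj x" "\<And>v. 0 \<le> inner (ap x v) v"
    using that N_M M_bounded tau_pos by (auto simp: positive_op_iff)
  show "0 \<le> t x" if "x \<in> N" "selfadj x" "\<And>v. 0 \<le> inner (ap x v) v"
    using pos [OF that] by (simp add: t_def complex_nonneg_Reals_iff)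
  show "t x = t y" if "x \<in> N" "y \<in> N" "adjoint_pair x y"
    using that N_M by (intro t_adjoint) auto
  show "x = 0" if "x \<in> N" "selfadj x" "\<And>v. 0 \<le> inner (ap x v) v" "t x = 0"
  proof -
    have "\<tau> (rep_endo x) = 0"
      using pos [OF that(1-3)] that(4) by (simp add: t_def complex_nonneg_Reals_iff complex_eq_iff)
    then have "rep_endo x = 0" using pos [OF that(1-3)] that(1) N_M faithful by (auto simp: faithful_on_def)
    then show ?thesis by (simp add: rep_simps flip: rep_endo_inject)
  qed
qed

text \<open>The upper bound comes from the norm. For the lower one, with \<open>x = Endo A\<close>
  and its square root \<open>r\<close>, invertibility gives
  \<open>norm v \<le> norm B * norm r * norm (ap r v)\<close>, and
  \<open>(norm (ap r v))\<^sup>2 = inner (ap x v) v\<close>.\<close>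

lemma positive_invertible_between:
  assumes A: "A \<in> positive_invertibles M"
  obtains a b where "0 < a" "a < b" "op_between a b (Endo A)" "Endo A \<in> N"
proof -
  define x where "x = Endo A"
  obtain B where AM: "A \<in> M" and pos: "positive_op A" and B: "B o\<^sub>L A = id_blinfun"
    using A by (auto simp: positive_invertibles_def)
  have s: "selfadj x" and p: "\<And>v. 0 \<le> inner (ap x v) v"
    using pos positive_op_iff [of x] by (auto simp: x_def)
  define b where "b = norm x + 1"
  have bt: "op_between 0 b x"
    using op_between_mono [OF selfadj_op_between_norm [OF s], of "- norm x" b] p s
    by (auto simp: op_between_def b_def)
  interpret op_interval 0 b x using bt by unfold_locales (auto simp: b_def intro: add_nonneg_pos)
  define r where "r = fc sqrt x"
  have "fc (\<lambda>u. u) x = fc sqrt x * fc sqrt x"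
    by (rule fc_nonneg(1)) (auto intro: continuous_intros)
  then have r: "x = r * r" by (simp only: fc_id r_def)
  have rs: "selfadj r" unfolding r_def by (rule fc_selfadj) (intro continuous_intros)
  define c where "c = (norm B + 1) * (norm r + 1)"
  have c: "0 < c" unfolding c_def by (intro mult_pos_pos add_nonneg_pos) auto
  have low: "1 / c\<^sup>2 * (norm v)\<^sup>2 \<le> inner (ap x v) v" for v
  proof -
    have xr: "ap x v = ap r (ap r v)" by (subst r) simp
    have "norm v = norm (blinfun_apply B (ap x v))"
      using B by (metis ap_Endo blinfun_apply_blinfun_compose id_blinfun.rep_eq x_def)
    also have "\<dots> \<le> norm B * norm (ap x v)" by (rule norm_blinfun)
    also have "\<dots> \<le> norm B * (norm r * norm (ap r v))"
      unfolding xr by (intro mult_left_mono norm_ap) auto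
    also have "\<dots> \<le> c * norm (ap r v)"
      unfolding c_def mult.assoc [symmetric] by (intro mult_right_mono mult_mono) auto
    finally have "(norm v)\<^sup>2 \<le> (c * norm (ap r v))\<^sup>2" by (intro power_mono) auto
    then have "1 / c\<^sup>2 * (norm v)\<^sup>2 \<le> (norm (ap r v))\<^sup>2" using c by (simp add: field_simps)
    also have "\<dots> = inner (ap x v) v"
      using rs unfolding xr by (simp add: adjoint_pair_def power2_norm_eq_inner)
    finally show ?thesis .
  qed
  have "op_between (1 / c\<^sup>2) b x" using bt low by (simp add: op_between_def)
  then have "op_between (1 / c\<^sup>2) (max b (1 / c\<^sup>2 + 1)) x" by (rule op_between_mono) auto
  moreover have "x \<in> N" using AM s by (intro selfadj_N) (simp_all add: x_def)
  ultimately show ?thesis using c by (intro that [of "1 / c\<^sup>2" "max b (1 / c\<^sup>2 + 1)"]) (auto simp: x_def)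
qed

lemma tau_log_op:
  assumes x: "op_between a b x" "x \<in> N" and ab: "0 < a" "a < b"
  shows "\<tau> (log_op (rep_endo x)) = complex_of_real (L x)"
proof -
  interpret op_interval a b x using assms by unfold_locales
  have c: "continuous_on {a..b} ln" using ab by (intro continuous_intros) auto
  have "log_op (rep_endo x) = rep_endo (fc ln x)"
    using cfc_op_eq [of "rep_endo x" a b ln] x N_M M_bounded ab c
    by (simp add: log_op_def rep_endo_inverse)
  moreover have "Im (\<tau> (rep_endo (fc ln x))) = 0"
    using fc_N [OF x(1) ab(2) c x(2)] fc_selfadj [OF c] N_M by (intro Im_tau_selfadj) auto
  ultimately show ?thesis by (simp add: complex_eq_iff L_def t_def)
qed

lemma d_tau_sq_eq:
  assumes x: "op_between a b x" "x \<in> N" and y: "op_between a b y" "y \<in> N" and ab: "0 < a" "a < b"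
  shows "d_tau_sq \<tau> (rep_endo x) (rep_endo y) = complex_of_real (D x y)"
proof -
  have "(1 / 2) *\<^sub>R (rep_endo x + rep_endo y) = rep_endo ((1 / 2) *\<^sub>R (x + y))" by (simp add: rep_simps)
  moreover have "op_between a b ((1 / 2) *\<^sub>R (x + y))" "(1 / 2) *\<^sub>R (x + y) \<in> N"
    using x y by (auto intro: op_between_midpoint)
  ultimately show ?thesis
    using tau_log_op [OF x ab] tau_log_op [OF y ab] tau_log_op [OF _ _ ab]
    by (simp add: d_tau_sq_def D_def)
qed

text \<open>The estimates for \<open>D\<close> refer to a single interval, so the intervals of three
  elements are merged by minima and maxima.\<close>

lemma common_interval:
  assumes "A \<in> positive_invertibles M" "B \<in> positive_invertibles M" "C \<in> positive_invertibles M"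
  obtains a b where "0 < a" "a < b"
    "op_between a b (Endo A)" "Endo A \<in> N" "op_between a b (Endo B)" "Endo B \<in> N"
    "op_between a b (Endo C)" "Endo C \<in> N"
proof -
  obtain a1 b1 where 1: "0 < a1" "a1 < b1" "op_between a1 b1 (Endo A)" "Endo A \<in> N"
    using positive_invertible_between [OF assms(1)] .
  obtain a2 b2 where 2: "0 < a2" "a2 < b2" "op_between a2 b2 (Endo B)" "Endo B \<in> N"
    using positive_invertible_between [OF assms(2)] .
  obtain a3 b3 where 3: "0 < a3" "a3 < b3" "op_between a3 b3 (Endo C)" "Endo C \<in> N"
    using positive_invertible_between [OF assms(3)] .
  show ?thesis
    using 1 2 3
    by (intro that [of "min a1 (min a2 a3)" "max b1 (max b2 b3)"])
      (auto intro: op_between_mono)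
qed

theorem d_tau_metric:
  "(\<forall>A\<in>positive_invertibles M. \<forall>B\<in>positive_invertibles M. d_tau_sq \<tau> A B \<in> \<real>\<^sub>\<ge>\<^sub>0) \<and>
    metric_on (positive_invertibles M) (d_tau \<tau>)"
proof -
  let ?P = "positive_invertibles M"
  have sq: "d_tau_sq \<tau> A B = complex_of_real (D (Endo A) (Endo B)) \<and> 0 \<le> D (Endo A) (Endo B)
      \<and> (D (Endo A) (Endo B) = 0 \<longleftrightarrow> A = B)"
    if AB: "A \<in> ?P" "B \<in> ?P" for A B
  proof -
    obtain a b where ab: "0 < a" "a < b" and A: "op_between a b (Endo A)" "Endo A \<in> N"
      and B: "op_between a b (Endo B)" "Endo B \<in> N"
      using common_interval [OF AB AB(1)] by metis
    have "A = B" if "Endo A = Endo B" using that by (metis rep_Endo)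
    then show ?thesis
      using d_tau_sq_eq [OF A B ab] D_nonneg [OF ab A B] D_eq_0 [OF ab A B] D_self by auto
  qed
  have tri: "sqrt (D (Endo A) (Endo C)) \<le> sqrt (D (Endo A) (Endo B)) + sqrt (D (Endo B) (Endo C))"
    if ABC: "A \<in> ?P" "B \<in> ?P" "C \<in> ?P" for A B C
    using common_interval [OF ABC] sqrt_D_triangle by metis
  have d: "d_tau \<tau> A B = sqrt (D (Endo A) (Endo B))" if "A \<in> ?P" "B \<in> ?P" for A B
    using sq [OF that] by (simp add: d_tau_def)
  have "Metric_space ?P (\<lambda>x y. if x \<in> ?P \<and> y \<in> ?P then d_tau \<tau> x y else 0)"
  proof
    fix x y z
    show "0 \<le> (if x \<in> ?P \<and> y \<in> ?P then d_tau \<tau> x y else 0)" using d sq by simp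
    show "(if x \<in> ?P \<and> y \<in> ?P then d_tau \<tau> x y else 0) = (if y \<in> ?P \<and> x \<in> ?P then d_tau \<tau> y x else 0)"
      using d D_commute by auto
    show "((if x \<in> ?P \<and> y \<in> ?P then d_tau \<tau> x y else 0) = 0) = (x = y)" if "x \<in> ?P" "y \<in> ?P"
      using that d sq by simp
    show "(if x \<in> ?P \<and> z \<in> ?P then d_tau \<tau> x z else 0)
        \<le> (if x \<in> ?P \<and> y \<in> ?P then d_tau \<tau> x y else 0) + (if y \<in> ?P \<and> z \<in> ?P then d_tau \<tau> y z else 0)"
      if "x \<in> ?P" "y \<in> ?P" "z \<in> ?P"
      using that d tri by simp
  qed
  moreover have "d_tau_sq \<tau> A B \<in> \<real>\<^sub>\<ge>\<^sub>0" if "A \<in> ?P" "B \<in> ?P" for A B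
    using sq [OF that] by (simp add: complex_nonneg_Reals_iff)
  ultimately show ?thesis by (simp add: metric_on_def)
qed

end

theorem theorem6p4:
  fixes M :: "('h::complex_hilbert_space \<Rightarrow>\<^sub>L 'h) set"
    and \<tau> :: "('h \<Rightarrow>\<^sub>L 'h) \<Rightarrow> complex"
  assumes "finite_von_neumann_algebra M"
    and "faithful_normal_tracial_state M \<tau>"
  shows "(\<forall>A\<in>positive_invertibles M. \<forall>B\<in>positive_invertibles M. d_tau_sq \<tau> A B \<in> \<real>\<^sub>\<ge>\<^sub>0) \<and>
         metric_on (positive_invertibles M) (d_tau \<tau>)"
proof -
  interpret vn_trace M \<tau>
    using assms by unfold_locales
      (auto simp: finite_von_neumann_algebra_def faithful_normal_tracial_state_def)
  show ?thesis by (rule d_tau_metric)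
qed

end
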